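(* Let $N\ge 1$, $0<s<1$, $2<p<\infty$, and let $\Omega\subset\mathbb{R}^N$ be a bounded domain with smooth boundary. Let $F$ be the unique positive solution of $\mathcal{L}_{p,s}F=\frac{1}{p-2}F$ in $\Omega$, $F=0$ in $\mathbb{R}^N\setminus\Omega$, and let $U(x,t)=t^{-1/(p-2)}F(x)$. For every nonnegative solution $u(x,t)$ of the problem $$\partial_t u+\mathcal{L}_{p,s}u=0 \ \text{ in } \Omega\times(0,\infty),\qquad u(\cdot,0)=u_0 \ \text{ in } \Omega,\qquad u(x,t)=0 \ \text{ for } x\in\mathbb{R}^N\setminus\Omega,\ t>0,$$ with $u_0\in L^1(\Omega)$, $u_0\ge 0$, $u_0\not\equiv 0$, we have $$\lim_{t\to\infty}t^{1/(p-2)}\|u(\cdot,t)-U(\cdot,t)\|_{L^q(\Omega)}=0$$ for every $1\le q\le\infty$. In other words, $t^{1/(p-2)}u(x,t)$ tends to $F(x)$ as $t\to\infty$ uniformly in $\Omega$.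
   Context: Functions on $\Omega$ are extended by zero to $\mathbb{R}^N\setminus\Omega$. Let $$J_{p,s}(u)=\frac1p\int_{\mathbb{R}^N}\int_{\mathbb{R}^N}\frac{|u(x)-u(y)|^p}{|x-y|^{N+sp}}\,dx\,dy ,$$ and let $W^{s,p}_0(\Omega)$ be the closure of $C_c^\infty(\Omega)$ in the norm given by $\|u\|^p=J_{p,s}(u)+\int_{\mathbb{R}^N}|u|^p\,dx$. The fractional $p$-Laplacian is $$\mathcal{L}_{p,s}u(x)=2\,\mathrm{p.v.}\int_{\mathbb{R}^N}\frac{|u(x)-u(y)|^{p-2}(u(x)-u(y))}{|x-y|^{N+sp}}\,dy,\qquad x\in\Omega,$$ understood on $\Omega$ as the sub-differential in $L^2(\Omega)$ of $J_{p,s}$ (defined on $W^{s,p}_0(\Omega)$, and $+\infty$ elsewhere): $\mathcal{L}_{p,s}u=w\in L^2(\Omega)$ means $u\in W^{s,p}_0(\Omega)$ and $$\int_{\mathbb{R}^N}\int_{\mathbb{R}^N}\frac{|u(x)-u(y)|^{p-2}(u(x)-u(y))(\phi(x)-\phi(y))}{|x-y|^{N+sp}}\,dx\,dy=\int_\Omega w\,\phi\,dx\quad\text{for all }\phi\in W^{s,p}_0(\Omega).$$ For $u_0\in L^2(\Omega)$ the solution is the unique strong solution $u\in C([0,\infty);L^2(\Omega))$ given by the semigroup generated by this maximal monotone operator ($\mathcal{L}_{p,s}u(t)\in L^2(\Omega)$ for all $t>0$ and $du/dt=-\mathcal{L}_{p,s}u$ for a.e. $t>0$). This semigroup is order preserving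 and contractive in the $L^1(\Omega)$ norm; for $u_0\in L^1(\Omega)$ the solution is defined by extending the semigroup to $L^1(\Omega)$ by $L^1$-contractivity. The function $F$ exists and is unique, is positive in $\Omega$, Hölder continuous, and vanishes on $\partial\Omega$. *)

theory Defs
  imports "HOL-Analysis.Analysis" "HOL-Probability.Essential_Supremum"
begin

text \<open>The space \<open>\<real>\<^sup>N\<close> is an arbitrary Euclidean space \<^typ>\<open>'a::euclidean_space\<close>, with
  \<open>N = DIM('a) \<ge> 1\<close>. Elements of Lebesgue and Sobolev spaces are represented by functions; all
  notions below are invariant under changes on null sets.\<close>

subsection \<open>Lebesgue norms\<close>

text \<open>The root \<open>x\<^bsup>1/r\<^esup>\<close> of an extended nonnegative real.\<close>

definition ennreal_root :: "real \<Rightarrow> ennreal \<Rightarrow> ennreal" where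
  "ennreal_root r x = (if x = \<infinity> then \<infinity> else ennreal (enn2real x powr (1 / r)))"

text \<open>The norm is meant for \<open>1 \<le> q \<le> \<infinity>\<close> and measurable \<open>f\<close>.\<close>

definition Lq_norm :: "'a::euclidean_space set \<Rightarrow> ennreal \<Rightarrow> ('a \<Rightarrow> real) \<Rightarrow> ennreal" where
  "Lq_norm \<Omega> q f =
     (if q = \<infinity> then esssup (lebesgue_on \<Omega>) (\<lambda>x. ennreal \<bar>f x\<bar>)
      else ennreal_root (enn2real q)
             (\<integral>\<^sup>+ x. ennreal (\<bar>f x\<bar> powr enn2real q) \<partial>lebesgue_on \<Omega>))"

definition Lq_space :: "'a::euclidean_space set \<Rightarrow> ennreal \<Rightarrow> ('a \<Rightarrow> real) set" where
  "Lq_space \<Omega> q = {f \<in> borel_measurable (lebesgue_on \<Omega>). Lq_norm \<Omega> q f < \<infinity>}"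

subsection \<open>Smooth functions and domains\<close>

primrec Ck :: "nat \<Rightarrow> ('a::euclidean_space \<Rightarrow> real) \<Rightarrow> bool" where
  "Ck 0 f \<longleftrightarrow> continuous_on UNIV f"
| "Ck (Suc k) f \<longleftrightarrow> (\<forall>x. f differentiable (at x)) \<and>
     (\<forall>b\<in>Basis. Ck k (\<lambda>x. frechet_derivative f (at x) b))"

definition smooth :: "('a::euclidean_space \<Rightarrow> real) \<Rightarrow> bool" where
  "smooth f \<longleftrightarrow> (\<forall>k. Ck k f)"

definition test_functions :: "'a::euclidean_space set \<Rightarrow> ('a \<Rightarrow> real) set" where
  "test_functions \<Omega> = {\<phi>. smooth \<phi> \<and>
     compact (closure {x. \<phi> x \<noteq> 0}) \<and> closure {x. \<phi> x \<noteq> 0} \<subseteq> \<Omega>}"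

text \<open>Near each boundary point the domain is the region on one side of a smooth graph over the
  hyperplane orthogonal to some unit vector \<open>e\<close>: \<open>x - (x \<bullet> e) e\<close> is the orthogonal projection of
  \<open>x\<close> onto that hyperplane, so only the restriction of \<open>\<gamma>\<close> to the hyperplane matters.\<close>

definition smooth_boundary :: "'a::euclidean_space set \<Rightarrow> bool" where
  "smooth_boundary \<Omega> \<longleftrightarrow> (\<forall>z\<in>frontier \<Omega>. \<exists>r>0. \<exists>e \<gamma>. norm e = 1 \<and> smooth \<gamma> \<and>
     \<Omega> \<inter> ball z r = {x \<in> ball z r. x \<bullet> e > \<gamma> (x - (x \<bullet> e) *\<^sub>R e)})"

definition smooth_bounded_domain :: "'a::euclidean_space set \<Rightarrow> bool" where
  "smooth_bounded_domain \<Omega> \<longleftrightarrow>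
     open \<Omega> \<and> connected \<Omega> \<and> \<Omega> \<noteq> {} \<and> bounded \<Omega> \<and> smooth_boundary \<Omega>"

subsection \<open>The fractional energy, Sobolev space and p-Laplacian\<close>

definition frac_energy :: "real \<Rightarrow> real \<Rightarrow> ('a::euclidean_space \<Rightarrow> real) \<Rightarrow> ennreal" where
  "frac_energy p s u = ennreal (1 / p) *
     (\<integral>\<^sup>+ (x, y). ennreal (\<bar>u x - u y\<bar> powr p / norm (x - y) powr (real DIM('a) + s * p))
        \<partial>(lebesgue \<Otimes>\<^sub>M lebesgue))"

definition frac_sobolev_norm :: "real \<Rightarrow> real \<Rightarrow> ('a::euclidean_space \<Rightarrow> real) \<Rightarrow> ennreal" where
  "frac_sobolev_norm p s u =
     ennreal_root p (frac_energy p s u + (\<integral>\<^sup>+ x. ennreal (\<bar>u x\<bar> powr p) \<partial>lebesgue))"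

text \<open>Elements of the closure are functions on the whole space, vanishing almost everywhere
  outside \<open>\<Omega>\<close>.\<close>

definition frac_sobolev0 :: "real \<Rightarrow> real \<Rightarrow> 'a::euclidean_space set \<Rightarrow> ('a \<Rightarrow> real) set" where
  "frac_sobolev0 p s \<Omega> = {u \<in> borel_measurable lebesgue. frac_sobolev_norm p s u < \<infinity> \<and>
     (\<forall>\<epsilon>>0. \<exists>\<phi>\<in>test_functions \<Omega>. frac_sobolev_norm p s (\<lambda>x. u x - \<phi> x) < \<epsilon>)}"

text \<open>\<open>frac_plaplacian p s \<Omega> u w\<close> states that the fractional p-Laplacian of \<open>u\<close>, as a
  subdifferential in \<open>L\<^sup>2(\<Omega>)\<close>, is \<open>w\<close>. Both integrands are integrable for \<open>u\<close>, \<open>w\<close>, \<open>\<phi>\<close> as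
  indicated when \<open>p > 2\<close> and \<open>\<Omega>\<close> is bounded.\<close>

definition frac_plaplacian ::
    "real \<Rightarrow> real \<Rightarrow> 'a::euclidean_space set \<Rightarrow> ('a \<Rightarrow> real) \<Rightarrow> ('a \<Rightarrow> real) \<Rightarrow> bool" where
  "frac_plaplacian p s \<Omega> u w \<longleftrightarrow> u \<in> frac_sobolev0 p s \<Omega> \<and> w \<in> Lq_space \<Omega> 2 \<and>
     (\<forall>\<phi>\<in>frac_sobolev0 p s \<Omega>.
        (LINT (x, y)|(lebesgue \<Otimes>\<^sub>M lebesgue).
           \<bar>u x - u y\<bar> powr (p - 2) * (u x - u y) * (\<phi> x - \<phi> y)
             / norm (x - y) powr (real DIM('a) + s * p))
        = (LINT x|lebesgue_on \<Omega>. w x * \<phi> x))"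

subsection \<open>The evolution problem\<close>

text \<open>Local absolute continuity of a curve \<open>(0,\<infinity>) \<rightarrow> L\<^sup>2(\<Omega>)\<close>.\<close>

definition locally_AC_L2 :: "'a::euclidean_space set \<Rightarrow> (real \<Rightarrow> 'a \<Rightarrow> real) \<Rightarrow> bool" where
  "locally_AC_L2 \<Omega> u \<longleftrightarrow> (\<forall>a b. 0 < a \<and> a \<le> b \<longrightarrow>
     (\<forall>\<epsilon>>0. \<exists>\<delta>>0. \<forall>n (\<alpha> :: nat \<Rightarrow> real) \<beta>.
        (\<forall>i<n. a \<le> \<alpha> i \<and> \<alpha> i \<le> \<beta> i \<and> \<beta> i \<le> b) \<and>
        (\<forall>i<n. \<forall>j<n. i \<noteq> j \<longrightarrow> {\<alpha> i<..<\<beta> i} \<inter> {\<alpha> j<..<\<beta> j} = {}) \<and>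
        (\<Sum>i<n. \<beta> i - \<alpha> i) < \<delta>
        \<longrightarrow> (\<Sum>i<n. Lq_norm \<Omega> 2 (\<lambda>x. u (\<beta> i) x - u (\<alpha> i) x)) < \<epsilon>))"

definition has_L2_derivative ::
    "'a::euclidean_space set \<Rightarrow> (real \<Rightarrow> 'a \<Rightarrow> real) \<Rightarrow> ('a \<Rightarrow> real) \<Rightarrow> real \<Rightarrow> bool" where
  "has_L2_derivative \<Omega> u g t \<longleftrightarrow> g \<in> Lq_space \<Omega> 2 \<and>
     ((\<lambda>h. Lq_norm \<Omega> 2 (\<lambda>x. (u (t + h) x - u t x) / h - g x)) \<longlongrightarrow> 0) (at 0)"

text \<open>Strong solutions with data in \<open>L\<^sup>2(\<Omega>)\<close>. Local absolute continuity is part of the notion of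
  a strong solution of \<open>du/dt = - \<L>u\<close>; differentiability almost everywhere alone would not
  give uniqueness.\<close>

definition strong_solution ::
    "real \<Rightarrow> real \<Rightarrow> 'a::euclidean_space set \<Rightarrow> ('a \<Rightarrow> real) \<Rightarrow> (real \<Rightarrow> 'a \<Rightarrow> real) \<Rightarrow> bool" where
  "strong_solution p s \<Omega> u0 u \<longleftrightarrow>
     u0 \<in> Lq_space \<Omega> 2 \<and>
     (\<forall>t\<ge>0. u t \<in> Lq_space \<Omega> 2) \<and>
     (\<forall>t\<ge>0. ((\<lambda>\<tau>. Lq_norm \<Omega> 2 (\<lambda>x. u \<tau> x - u t x)) \<longlongrightarrow> 0) (at t within {0..})) \<and>
     (AE x in lebesgue_on \<Omega>. u 0 x = u0 x) \<and>
     locally_AC_L2 \<Omega> u \<and>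
     (\<forall>t>0. \<exists>w. frac_plaplacian p s \<Omega> (u t) w) \<and>
     (AE t in lebesgue_on {0<..}. \<exists>w. frac_plaplacian p s \<Omega> (u t) w \<and>
        has_L2_derivative \<Omega> u (\<lambda>x. - w x) t)"

text \<open>Solutions with data in \<open>L\<^sup>1(\<Omega>)\<close>, given by the extension of the \<open>L\<^sup>2\<close> semigroup by
  \<open>L\<^sup>1\<close>-contractivity: limits in \<open>L\<^sup>1(\<Omega>)\<close>, at each time, of strong solutions whose data
  converge to \<open>u0\<close> in \<open>L\<^sup>1(\<Omega>)\<close>. By contractivity the limit does not depend on the sequence.\<close>

definition semigroup_solution ::
    "real \<Rightarrow> real \<Rightarrow> 'a::euclidean_space set \<Rightarrow> ('a \<Rightarrow> real) \<Rightarrow> (real \<Rightarrow> 'a \<Rightarrow> real) \<Rightarrow> bool" where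
  "semigroup_solution p s \<Omega> u0 u \<longleftrightarrow>
     u0 \<in> Lq_space \<Omega> 1 \<and>
     (\<forall>t\<ge>0. u t \<in> Lq_space \<Omega> 1) \<and>
     (\<exists>v0 v. (\<forall>n::nat. strong_solution p s \<Omega> (v0 n) (v n)) \<and>
        (\<lambda>n. Lq_norm \<Omega> 1 (\<lambda>x. v0 n x - u0 x)) \<longlonglongrightarrow> 0 \<and>
        (\<forall>t\<ge>0. (\<lambda>n. Lq_norm \<Omega> 1 (\<lambda>x. v n t x - u t x)) \<longlonglongrightarrow> 0))"

definition dirichlet_solution ::
    "real \<Rightarrow> real \<Rightarrow> 'a::euclidean_space set \<Rightarrow> ('a \<Rightarrow> real) \<Rightarrow> (real \<Rightarrow> 'a \<Rightarrow> real) \<Rightarrow> bool" where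
  "dirichlet_solution p s \<Omega> u0 u \<longleftrightarrow>
     semigroup_solution p s \<Omega> u0 u \<and> (\<forall>t>0. \<forall>x. x \<notin> \<Omega> \<longrightarrow> u t x = 0)"

subsection \<open>The stationary profile and the separated solution\<close>

definition positive_profile ::
    "real \<Rightarrow> real \<Rightarrow> 'a::euclidean_space set \<Rightarrow> ('a \<Rightarrow> real) \<Rightarrow> bool" where
  "positive_profile p s \<Omega> F \<longleftrightarrow>
     frac_plaplacian p s \<Omega> F (\<lambda>x. 1 / (p - 2) * F x) \<and>
     (\<forall>x\<in>\<Omega>. F x > 0) \<and> (\<forall>x. x \<notin> \<Omega> \<longrightarrow> F x = 0)"

definition separated_solution :: "real \<Rightarrow> ('a \<Rightarrow> real) \<Rightarrow> 'a \<Rightarrow> real \<Rightarrow> real" where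
  "separated_solution p F x t = t powr (- 1 / (p - 2)) * F x"

end

theory Submission
  imports Defs
begin

text \<open>Write \<open>\<gamma> = 1/(p - 2)\<close> and \<open>U(t) = t\<^bsup>-\<gamma>\<^esup>F\<close>. Since \<open>F > 0\<close> in \<open>\<Omega>\<close>, the datum \<open>U(\<tau>)\<close> absorbs every
  integrable datum as \<open>\<tau> \<rightarrow> 0\<close>, so \<open>L\<^sup>1\<close> contraction against \<open>U(\<cdot> + \<tau>)\<close> gives \<open>u(t) \<le> U(t)\<close>. The same
  comparison as \<open>\<tau> \<rightarrow> \<infinity>\<close> gives \<open>t\<^bsup>\<gamma>\<^esup>u(t) \<rightarrow> F\<close> in \<open>L\<^sup>1\<close>, provided that \<open>u\<close> becomes positive almost
  everywhere, which the long-range interaction enforces. Boundedness of \<open>F\<close> and the passage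
  from \<open>L\<^sup>1\<close> to uniform convergence use one observation: a set \<open>S\<close> of small measure loses to its
  complement at a rate \<open>\<integral>\<^bsub>y \<notin> S\<^esub> |x - y|\<^bsup>-N-sp\<^esup> dy\<close> which is large uniformly in \<open>x\<close>.\<close>

subsection \<open>Absolutely continuous functions\<close>

definition interval_family :: "real \<Rightarrow> real \<Rightarrow> nat \<Rightarrow> (nat \<Rightarrow> real) \<Rightarrow> (nat \<Rightarrow> real) \<Rightarrow> bool" where
  "interval_family a b n \<alpha> \<beta> \<longleftrightarrow> (\<forall>i<n. a \<le> \<alpha> i \<and> \<alpha> i \<le> \<beta> i \<and> \<beta> i \<le> b) \<and>
     (\<forall>i<n. \<forall>j<n. i \<noteq> j \<longrightarrow> {\<alpha> i<..<\<beta> i} \<inter> {\<alpha> j<..<\<beta> j} = {})"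

definition abs_cont :: "real \<Rightarrow> real \<Rightarrow> (real \<Rightarrow> real) \<Rightarrow> bool" where
  "abs_cont a b g \<longleftrightarrow> (\<forall>\<epsilon>>0. \<exists>\<delta>>0. \<forall>n \<alpha> \<beta>. interval_family a b n \<alpha> \<beta> \<longrightarrow>
     (\<Sum>i<n. \<beta> i - \<alpha> i) < \<delta> \<longrightarrow> (\<Sum>i<n. \<bar>g (\<beta> i) - g (\<alpha> i)\<bar>) < \<epsilon>)"

lemma abs_contD:
  "abs_cont a b g \<Longrightarrow> 0 < \<epsilon> \<Longrightarrow> \<exists>\<delta>>0. \<forall>n \<alpha> \<beta>. interval_family a b n \<alpha> \<beta> \<longrightarrow>
     (\<Sum>i<n. \<beta> i - \<alpha> i) < \<delta> \<longrightarrow> (\<Sum>i<n. \<bar>g (\<beta> i) - g (\<alpha> i)\<bar>) < \<epsilon>"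
  unfolding abs_cont_def by simp

lemma abs_contI:
  assumes "\<And>\<epsilon>. 0 < \<epsilon> \<Longrightarrow> \<exists>\<delta>>0. \<forall>n \<alpha> \<beta>. interval_family a b n \<alpha> \<beta> \<longrightarrow>
     (\<Sum>i<n. \<beta> i - \<alpha> i) < \<delta> \<longrightarrow> (\<Sum>i<n. \<bar>g (\<beta> i) - g (\<alpha> i)\<bar>) < \<epsilon>"
  shows "abs_cont a b g"
  using assms unfolding abs_cont_def by simp

lemma abs_cont_add:
  assumes f: "abs_cont a b f" and g: "abs_cont a b g"
  shows "abs_cont a b (\<lambda>t. f t + g t)"
proof (rule abs_contI)
  fix \<epsilon> :: real assume "\<epsilon> > 0"
  then have e: "0 < \<epsilon> / 2" by simp
  obtain d1 where d1: "0 < d1" "\<forall>n \<alpha> \<beta>. interval_family a b n \<alpha> \<beta> \<longrightarrow>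
     (\<Sum>i<n. \<beta> i - \<alpha> i) < d1 \<longrightarrow> (\<Sum>i<n. \<bar>f (\<beta> i) - f (\<alpha> i)\<bar>) < \<epsilon> / 2"
    using abs_contD[OF f e] by blast
  obtain d2 where d2: "0 < d2" "\<forall>n \<alpha> \<beta>. interval_family a b n \<alpha> \<beta> \<longrightarrow>
     (\<Sum>i<n. \<beta> i - \<alpha> i) < d2 \<longrightarrow> (\<Sum>i<n. \<bar>g (\<beta> i) - g (\<alpha> i)\<bar>) < \<epsilon> / 2"
    using abs_contD[OF g e] by blast
  show "\<exists>\<delta>>0. \<forall>n \<alpha> \<beta>. interval_family a b n \<alpha> \<beta> \<longrightarrow> (\<Sum>i<n. \<beta> i - \<alpha> i) < \<delta>
     \<longrightarrow> (\<Sum>i<n. \<bar>(f (\<beta> i) + g (\<beta> i)) - (f (\<alpha> i) + g (\<alpha> i))\<bar>) < \<epsilon>"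
  proof (intro exI[of _ "min d1 d2"] conjI allI impI)
    fix n and \<alpha> \<beta> :: "nat \<Rightarrow> real"
    assume *: "interval_family a b n \<alpha> \<beta>" "(\<Sum>i<n. \<beta> i - \<alpha> i) < min d1 d2"
    have "(\<Sum>i<n. \<bar>(f (\<beta> i) + g (\<beta> i)) - (f (\<alpha> i) + g (\<alpha> i))\<bar>)
      \<le> (\<Sum>i<n. \<bar>f (\<beta> i) - f (\<alpha> i)\<bar> + \<bar>g (\<beta> i) - g (\<alpha> i)\<bar>)"
      by (intro sum_mono) linarith
    also have "\<dots> = (\<Sum>i<n. \<bar>f (\<beta> i) - f (\<alpha> i)\<bar>) + (\<Sum>i<n. \<bar>g (\<beta> i) - g (\<alpha> i)\<bar>)"
      by (rule sum.distrib)
    also have "\<dots> < \<epsilon> / 2 + \<epsilon> / 2"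
      using * d1(2) d2(2) by (intro add_strict_mono) auto
    finally show "(\<Sum>i<n. \<bar>(f (\<beta> i) + g (\<beta> i)) - (f (\<alpha> i) + g (\<alpha> i))\<bar>) < \<epsilon>" by simp
  qed (use d1 d2 in auto)
qed

lemma abs_cont_cmult:
  assumes f: "abs_cont a b f"
  shows "abs_cont a b (\<lambda>t. c * f t)"
proof (rule abs_contI)
  fix \<epsilon> :: real assume "\<epsilon> > 0"
  then have e: "0 < \<epsilon> / (\<bar>c\<bar> + 1)" by simp
  obtain d1 where d1: "0 < d1" "\<forall>n \<alpha> \<beta>. interval_family a b n \<alpha> \<beta> \<longrightarrow>
     (\<Sum>i<n. \<beta> i - \<alpha> i) < d1 \<longrightarrow> (\<Sum>i<n. \<bar>f (\<beta> i) - f (\<alpha> i)\<bar>) < \<epsilon> / (\<bar>c\<bar> + 1)"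
    using abs_contD[OF f e] by blast
  show "\<exists>\<delta>>0. \<forall>n \<alpha> \<beta>. interval_family a b n \<alpha> \<beta> \<longrightarrow> (\<Sum>i<n. \<beta> i - \<alpha> i) < \<delta>
     \<longrightarrow> (\<Sum>i<n. \<bar>c * f (\<beta> i) - c * f (\<alpha> i)\<bar>) < \<epsilon>"
  proof (intro exI[of _ d1] conjI allI impI)
    fix n and \<alpha> \<beta> :: "nat \<Rightarrow> real"
    assume *: "interval_family a b n \<alpha> \<beta>" "(\<Sum>i<n. \<beta> i - \<alpha> i) < d1"
    have "(\<Sum>i<n. \<bar>c * f (\<beta> i) - c * f (\<alpha> i)\<bar>) = \<bar>c\<bar> * (\<Sum>i<n. \<bar>f (\<beta> i) - f (\<alpha> i)\<bar>)"
      by (simp add: sum_distrib_left abs_mult flip: right_diff_distrib)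
    also have "\<dots> \<le> (\<bar>c\<bar> + 1) * (\<Sum>i<n. \<bar>f (\<beta> i) - f (\<alpha> i)\<bar>)"
      by (intro mult_right_mono sum_nonneg) auto
    also have "\<dots> < (\<bar>c\<bar> + 1) * (\<epsilon> / (\<bar>c\<bar> + 1))"
      using * d1(2) by (intro mult_strict_left_mono) auto
    finally show "(\<Sum>i<n. \<bar>c * f (\<beta> i) - c * f (\<alpha> i)\<bar>) < \<epsilon>" by simp
  qed (use d1 in auto)
qed

lemma abs_cont_id: "abs_cont a b (\<lambda>t. t)"
proof (rule abs_contI)
  fix \<epsilon> :: real assume "\<epsilon> > 0"
  then show "\<exists>\<delta>>0. \<forall>n \<alpha> \<beta>. interval_family a b n \<alpha> \<beta> \<longrightarrow> (\<Sum>i<n. \<beta> i - \<alpha> i) < \<delta>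
     \<longrightarrow> (\<Sum>i<n. \<bar>\<beta> i - \<alpha> i\<bar>) < \<epsilon>"
    by (intro exI[of _ \<epsilon>]) (auto simp: interval_family_def)
qed

text \<open>Off the null set the gauge comes from differentiability; on it, from an open set of small measure,
  and absolute continuity bounds the intervals tagged there.\<close>

lemma abs_cont_increment_nonpos:
  fixes g :: "real \<Rightarrow> real"
  assumes ac: "abs_cont a b g" and "a \<le> b" and "negligible N"
    and der: "\<And>t. t \<in> {a..b} - N \<Longrightarrow> \<exists>D\<le>0. (g has_real_derivative D) (at t)"
  shows "g b \<le> g a"
proof -
  have main: "g b - g a \<le> e * (b - a + 1)" if e: "e > 0" for e
  proof -
    obtain \<delta> where \<delta>: "0 < \<delta>" "\<forall>n \<alpha> \<beta>. interval_family a b n \<alpha> \<beta> \<longrightarrow>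
     (\<Sum>i<n. \<beta> i - \<alpha> i) < \<delta> \<longrightarrow> (\<Sum>i<n. \<bar>g (\<beta> i) - g (\<alpha> i)\<bar>) < e"
      using abs_contD[OF ac e] by blast
    have "N \<in> null_sets lebesgue" using \<open>negligible N\<close> negligible_iff_null_sets by blast
    then obtain O' where O': "open O'" "N \<subseteq> O'" "O' \<in> lmeasurable" "measure lebesgue O' < \<delta>"
    proof -
      obtain T where T: "open T" "N \<subseteq> T" "T - N \<in> lmeasurable" "emeasure lebesgue (T - N) < ennreal \<delta>"
        using sets_lebesgue_outer_open[of N \<delta>] \<open>N \<in> null_sets lebesgue\<close> \<open>0 < \<delta>\<close> by (metis null_setsD2)
      have "emeasure lebesgue T = emeasure lebesgue (T - N)"
        using \<open>N \<in> null_sets lebesgue\<close> \<open>open T\<close> by (intro emeasure_Diff_null_set[symmetric]) auto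
      moreover have "T \<in> sets lebesgue" using \<open>open T\<close> by auto
      ultimately have "T \<in> lmeasurable" "measure lebesgue T < \<delta>"
        using T(4) \<open>0 < \<delta>\<close> less_trans[OF T(4) ennreal_less_top]
        by (auto simp add: fmeasurable_def measure_def enn2real_less_iff simp del: emeasure_completion)
      then show ?thesis using that T by metis
    qed
    have "\<exists>r>0. \<forall>s t'. s \<le> t \<and> t \<le> t' \<and> t - r < s \<and> t' < t + r \<longrightarrow> g t' - g s \<le> e * (t' - s)"
      if t: "t \<in> {a..b} - N" for t
    proof -
      obtain D where D: "D \<le> 0" "(g has_real_derivative D) (at t)" using der[OF t] by blast
      then have "((\<lambda>h. (g (t + h) - g t) / h) \<longlongrightarrow> D) (at 0)"
        by (simp add: DERIV_def)
      then have "\<forall>\<^sub>F h in at 0. \<bar>(g (t + h) - g t) / h - D\<bar> < e"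
        using e by (auto simp: tendsto_iff dist_real_def)
      then obtain r where r: "r > 0" "\<And>h. h \<noteq> 0 \<Longrightarrow> \<bar>h\<bar> < r \<Longrightarrow> \<bar>(g (t + h) - g t) / h - D\<bar> < e"
        unfolding eventually_at by (auto simp: dist_real_def)
      have 1: "g t' - g t \<le> e * (t' - t)" if "t \<le> t'" "t' < t + r" for t'
      proof (cases "t' = t")
        case False
        then have "(g t' - g t) / (t' - t) \<le> e" using r(2)[of "t' - t"] D that by auto
        then show ?thesis using False that by (simp add: divide_le_eq)
      qed simp
      have 2: "g t - g s \<le> e * (t - s)" if "s \<le> t" "t - r < s" for s
      proof (cases "s = t")
        case False
        then have "(g s - g t) / (s - t) \<le> e" using r(2)[of "s - t"] D that by auto
        then show ?thesis using False that by (simp add: divide_le_eq algebra_simps split: if_splits)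
      qed simp
      show ?thesis
        by (intro exI[of _ r] conjI allI impI r(1)) (use 1 2 in \<open>force simp: algebra_simps\<close>)
    qed
    then obtain R where R: "\<And>t. t \<in> {a..b} - N \<Longrightarrow> R t > 0"
      "\<And>t s t'. t \<in> {a..b} - N \<Longrightarrow> s \<le> t \<Longrightarrow> t \<le> t' \<Longrightarrow> t - R t < s \<Longrightarrow> t' < t + R t \<Longrightarrow> g t' - g s \<le> e * (t' - s)"
      by metis
    define G where "G t = (if t \<in> N then O' else if t \<in> {a..b} then ball t (R t) else ball t 1)" for t
    have "gauge G" unfolding gauge_def G_def using O' R(1) by auto
    then obtain \<D> where \<D>: "\<D> tagged_division_of {a..b}" "G fine \<D>"
      by (rule fine_division_exists_real)
    have fin: "finite \<D>" using \<D>(1) by blast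
    have form: "\<exists>c d. K = {c..d} \<and> c \<le> x \<and> x \<le> d \<and> a \<le> c \<and> d \<le> b" if "(x, K) \<in> \<D>" for x K
    proof -
      have "x \<in> K" "K \<subseteq> {a..b}" "\<exists>c d. K = cbox c d"
        using tagged_division_ofD(2,3,4)[OF \<D>(1) that] by auto
      then obtain c d where "K = {c..d}" "c \<le> x" "x \<le> d" by auto
      moreover have "c \<in> {a..b}" "d \<in> {a..b}" using calculation \<open>K \<subseteq> {a..b}\<close> by auto
      ultimately show ?thesis by auto
    qed
    define inc where "inc = (\<lambda>(x::real, K::real set). g (Sup K) - g (Inf K))"
    have tot: "(\<Sum>z\<in>\<D>. inc z) = g b - g a"
      using additive_tagged_division_1[OF \<open>a \<le> b\<close> \<D>(1), of g] by (simp add: inc_def case_prod_beta)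
    have len: "(\<Sum>z\<in>\<D>. Sup (snd z) - Inf (snd z)) = b - a"
      using additive_tagged_division_1[OF \<open>a \<le> b\<close> \<D>(1), of "\<lambda>x. x"] by (simp add: case_prod_beta)
    define A where "A = {z\<in>\<D>. fst z \<in> N}"
    define B where "B = {z\<in>\<D>. fst z \<notin> N}"
    have "\<D> = A \<union> B" "A \<inter> B = {}" "finite A" "finite B" using fin by (auto simp: A_def B_def)
    have "(\<Sum>z\<in>B. inc z) \<le> (\<Sum>z\<in>B. e * (Sup (snd z) - Inf (snd z)))"
    proof (rule sum_mono)
      fix z assume z: "z \<in> B"
      obtain x K where xK: "z = (x, K)" by force
      then obtain c d where cd: "K = {c..d}" "c \<le> x" "x \<le> d" "a \<le> c" "d \<le> b"
        using form[of x K] z by (auto simp: B_def)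
      have "K \<subseteq> G x" using \<D>(2) z xK unfolding fine_def B_def by auto
      then have "c \<in> G x" "d \<in> G x" using cd by auto
      moreover have "x \<in> {a..b} - N" using cd z xK by (auto simp: B_def)
      ultimately show "inc z \<le> e * (Sup (snd z) - Inf (snd z))"
        using R(2)[of x c d] cd xK by (auto simp: inc_def G_def dist_real_def)
    qed
    also have "\<dots> \<le> (\<Sum>z\<in>\<D>. e * (Sup (snd z) - Inf (snd z)))"
    proof (rule sum_mono2)
      fix z assume z: "z \<in> \<D> - B"
      obtain x K where xK: "z = (x, K)" by force
      then obtain c d where cd: "K = {c..d}" "c \<le> x" "x \<le> d" "a \<le> c" "d \<le> b"
        using form[of x K] z by auto
      then show "0 \<le> e * (Sup (snd z) - Inf (snd z))" using e xK by auto
    qed (use fin in \<open>auto simp: B_def\<close>)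
    also have "\<dots> = e * (b - a)" using len by (simp flip: sum_distrib_left)
    finally have SB: "(\<Sum>z\<in>B. inc z) \<le> e * (b - a)" .
    have SA: "(\<Sum>z\<in>A. inc z) \<le> e"
    proof -
      obtain h where h: "bij_betw h {..<card A} A"
        using ex_bij_betw_nat_finite[OF \<open>finite A\<close>] by (auto simp: atLeast0LessThan)
      define \<alpha> where "\<alpha> i = Inf (snd (h i))" for i
      define \<beta> where "\<beta> i = Sup (snd (h i))" for i
      have hA: "h i \<in> A" if "i < card A" for i using h that by (auto simp: bij_betw_def)
      have ab: "snd (h i) = {\<alpha> i..\<beta> i} \<and> a \<le> \<alpha> i \<and> \<alpha> i \<le> \<beta> i \<and> \<beta> i \<le> b \<and> {\<alpha> i..\<beta> i} \<subseteq> O'" if i: "i < card A" for i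
      proof -
        obtain x K where xK: "h i = (x, K)" by force
        then have "(x, K) \<in> \<D>" "x \<in> N" using hA[OF i] by (auto simp: A_def)
        then obtain c d where cd: "K = {c..d}" "c \<le> x" "x \<le> d" "a \<le> c" "d \<le> b" using form by blast
        have "K \<subseteq> G x" using \<D>(2) \<open>(x, K) \<in> \<D>\<close> unfolding fine_def by auto
        then show ?thesis using cd xK \<open>x \<in> N\<close> by (auto simp: \<alpha>_def \<beta>_def G_def)
      qed
      have disj: "{\<alpha> i<..<\<beta> i} \<inter> {\<alpha> j<..<\<beta> j} = {}" if "i < card A" "j < card A" "i \<noteq> j" for i j
      proof -
        have "h i \<noteq> h j" using h that by (auto simp: bij_betw_def inj_on_def)
        moreover have "h i \<in> \<D>" "h j \<in> \<D>" using hA that by (auto simp: A_def)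
        ultimately have "interior (snd (h i)) \<inter> interior (snd (h j)) = {}"
          using tagged_division_ofD(5)[OF \<D>(1)] by (metis prod.collapse)
        then show ?thesis using ab[OF that(1)] ab[OF that(2)] by simp
      qed
      have "(\<Sum>i<card A. \<beta> i - \<alpha> i) = (\<Sum>i<card A. measure lebesgue {\<alpha> i<..<\<beta> i})"
        using ab by (intro sum.cong) auto
      also have "\<dots> = measure lebesgue (\<Union>i<card A. {\<alpha> i<..<\<beta> i})"
        using disj ab by (intro measure_finite_Union[symmetric]) (auto simp: disjoint_family_on_def emeasure_lborel_Ioo)
      also have "\<dots> \<le> measure lebesgue O'"
        using ab O' by (intro measure_mono_fmeasurable) (auto, meson atLeastAtMost_iff less_imp_le subsetD)
      also have "\<dots> < \<delta>" by (rule O')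
      finally have "(\<Sum>i<card A. \<bar>g (\<beta> i) - g (\<alpha> i)\<bar>) < e"
        using ab disj \<delta>(2) by (auto simp: interval_family_def)
      moreover have "(\<Sum>z\<in>A. inc z) = (\<Sum>i<card A. inc (h i))"
        using h by (simp add: sum.reindex_bij_betw)
      moreover have "(\<Sum>i<card A. inc (h i)) \<le> (\<Sum>i<card A. \<bar>g (\<beta> i) - g (\<alpha> i)\<bar>)"
        by (intro sum_mono) (auto simp: inc_def \<alpha>_def \<beta>_def case_prod_beta)
      ultimately show ?thesis by linarith
    qed
    have "(\<Sum>z\<in>\<D>. inc z) = (\<Sum>z\<in>A. inc z) + (\<Sum>z\<in>B. inc z)"
      using \<open>\<D> = A \<union> B\<close> \<open>A \<inter> B = {}\<close> \<open>finite A\<close> \<open>finite B\<close> by (simp add: sum.union_disjoint)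
    then show ?thesis using SA SB tot by (simp add: algebra_simps)
  qed
  have *: "g b - g a \<le> e" if "e > 0" for e
  proof -
    have "b - a + 1 > 0" using \<open>a \<le> b\<close> by simp
    then have "g b - g a \<le> (e / (b - a + 1)) * (b - a + 1)" using main[of "e / (b - a + 1)"] \<open>e > 0\<close> by simp
    then show ?thesis using \<open>b - a + 1 > 0\<close> by simp
  qed
  show ?thesis by (rule field_le_epsilon) (use * in \<open>auto simp: algebra_simps\<close>)
qed

lemma abs_cont_increment_le:
  fixes g :: "real \<Rightarrow> real"
  assumes ac: "abs_cont a b g" and "a \<le> b" and "negligible N"
    and der: "\<And>t. t \<in> {a..b} - N \<Longrightarrow> \<exists>D\<le>c. (g has_real_derivative D) (at t)"
  shows "g b - g a \<le> c * (b - a)"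
proof -
  have "g b + (- c) * b \<le> g a + (- c) * a"
  proof (rule abs_cont_increment_nonpos[where N = N and g = "\<lambda>t. g t + (- c) * t" and a = a and b = b])
    show "abs_cont a b (\<lambda>t. g t + (- c) * t)"
      by (intro abs_cont_add ac abs_cont_cmult abs_cont_id)
    fix t assume "t \<in> {a..b} - N"
    then obtain D where "D \<le> c" "(g has_real_derivative D) (at t)" using der by blast
    then show "\<exists>D\<le>0. ((\<lambda>t. g t + (- c) * t) has_real_derivative D) (at t)"
      by (intro exI[of _ "D - c"]) (auto intro!: derivative_eq_intros)
  qed (use assms in auto)
  then show ?thesis by (simp add: algebra_simps)
qed

subsection \<open>Smooth functions and truncation\<close>

lemma Ck_mono: "Ck (Suc k) f \<Longrightarrow> Ck k f"
proof (induction k arbitrary: f)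
  case 0
  then have "\<forall>x. f differentiable (at x)" by simp
  then show ?case
    by (auto intro!: continuous_at_imp_continuous_on differentiable_imp_continuous_within)
qed simp

lemma Ck_const: "Ck k (\<lambda>x. c)"
  by (induction k arbitrary: c) auto

lemma Ck_Suc_has_derivative: "Ck (Suc k) f \<Longrightarrow> (f has_derivative frechet_derivative f (at x)) (at x)"
  using frechet_derivative_works by auto

lemma Ck_Suc_derivative: "Ck (Suc k) f \<Longrightarrow> b \<in> Basis \<Longrightarrow> Ck k (\<lambda>x. frechet_derivative f (at x) b)"
  by simp

lemma Ck_Suc_of_has_derivative:
  assumes D: "\<And>x. (f has_derivative f' x) (at x)"
    and "\<And>b. b \<in> Basis \<Longrightarrow> Ck k (\<lambda>x. f' x b)"
  shows "Ck (Suc k) f"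
proof -
  have "frechet_derivative f (at x) = f' x" for x
    using D by (rule frechet_derivative_at[symmetric])
  then show ?thesis using assms by (auto simp: differentiable_def)
qed

lemma Ck_add: "Ck k f \<Longrightarrow> Ck k g \<Longrightarrow> Ck k (\<lambda>x. f x + g x)"
proof (induction k arbitrary: f g)
  case (Suc k)
  show ?case
    by (rule Ck_Suc_of_has_derivative, rule has_derivative_add)
      (rule Ck_Suc_has_derivative Suc.prems Suc.IH Ck_Suc_derivative | assumption)+
qed (auto intro: continuous_intros)

lemma Ck_mult: "Ck k f \<Longrightarrow> Ck k g \<Longrightarrow> Ck k (\<lambda>x. f x * g x)"
proof (induction k arbitrary: f g)
  case (Suc k)
  show ?case
    by (rule Ck_Suc_of_has_derivative, rule has_derivative_mult)
      (rule Ck_Suc_has_derivative Suc.prems Suc.IH Ck_add Ck_Suc_derivative Ck_mono | assumption)+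
qed (auto intro: continuous_intros)

lemma Ck_powr:
  fixes f :: "'a::euclidean_space \<Rightarrow> real"
  assumes pos: "\<And>x. f x > 0"
  shows "Ck k f \<Longrightarrow> Ck k (\<lambda>x. f x powr a)"
proof (induction k arbitrary: a)
  case 0
  then show ?case using pos by (auto intro!: continuous_intros simp: less_imp_neq[symmetric])
next
  case (Suc k)
  have D: "((\<lambda>x. f x powr a) has_derivative (\<lambda>v. a * f x powr (a - 1) * frechet_derivative f (at x) v)) (at x)" for x
  proof -
    have "(f has_derivative frechet_derivative f (at x)) (at x)"
      using Suc.prems by (rule Ck_Suc_has_derivative)
    moreover have "((\<lambda>y. y powr a) has_derivative (\<lambda>h. h * (a * f x powr (a - 1)))) (at (f x))"
      using has_real_derivative_powr[OF pos[of x], of a] by (simp add: has_field_derivative_def mult_commute_abs)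
    ultimately have "((\<lambda>x. f x powr a) has_derivative (\<lambda>v. frechet_derivative f (at x) v * (a * f x powr (a - 1)))) (at x)"
      by (rule has_derivative_compose)
    then show ?thesis by (simp add: mult_ac)
  qed
  show ?case
    by (rule Ck_Suc_of_has_derivative[OF D])
      (rule Suc.prems Ck_mult Ck_const Suc.IH Ck_Suc_derivative Ck_mono | assumption)+
qed

lemma smooth_const: "smooth (\<lambda>x. c)"
  by (simp add: smooth_def Ck_const)

lemma smooth_add: "smooth f \<Longrightarrow> smooth g \<Longrightarrow> smooth (\<lambda>x. f x + g x)"
  by (simp add: smooth_def Ck_add)

lemma smooth_mult: "smooth f \<Longrightarrow> smooth g \<Longrightarrow> smooth (\<lambda>x. f x * g x)"
  by (simp add: smooth_def Ck_mult)

lemma smooth_sqrt: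
  fixes f :: "'a::euclidean_space \<Rightarrow> real"
  assumes "\<And>x. f x > 0" "smooth f"
  shows "smooth (\<lambda>x. sqrt (f x))"
proof -
  have "smooth (\<lambda>x. f x powr (1/2))" using assms by (simp add: smooth_def Ck_powr)
  then show ?thesis using assms(1) by (simp add: powr_half_sqrt less_imp_le)
qed

definition pos :: "real \<Rightarrow> real" where "pos x = max x 0"

definition smpos :: "real \<Rightarrow> real \<Rightarrow> real" where
  "smpos e x = (x + sqrt (x\<^sup>2 + e\<^sup>2)) / 2"

lemma smpos_lipschitz: "\<bar>smpos e x - smpos e y\<bar> \<le> \<bar>x - y\<bar>"
proof -
  have "\<bar>norm (x, e) - norm (y, e)\<bar> \<le> norm ((x, e) - (y, e))" by (rule norm_triangle_ineq3)
  then have "\<bar>sqrt (x\<^sup>2 + e\<^sup>2) - sqrt (y\<^sup>2 + e\<^sup>2)\<bar> \<le> \<bar>x - y\<bar>" by (simp add: norm_Pair)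
  moreover have "\<bar>(x + r) / 2 - (y + t) / 2\<bar> \<le> \<bar>x - y\<bar>" if "\<bar>r - t\<bar> \<le> \<bar>x - y\<bar>" for r t :: real
  proof -
    have "\<bar>(x - y) + (r - t)\<bar> \<le> \<bar>x - y\<bar> + \<bar>r - t\<bar>" by (rule abs_triangle_ineq)
    also have "\<dots> \<le> \<bar>x - y\<bar> + \<bar>x - y\<bar>" using that by (rule add_left_mono)
    finally have "\<bar>((x - y) + (r - t)) / 2\<bar> \<le> \<bar>x - y\<bar>" unfolding abs_divide by simp
    moreover have "(x + r) / 2 - (y + t) / 2 = ((x - y) + (r - t)) / 2" by (simp add: field_simps)
    ultimately show ?thesis by (simp only:)
  qed
  ultimately show ?thesis unfolding smpos_def by blast
qed

lemma smpos_approx: "\<bar>smpos e x - pos x\<bar> \<le> \<bar>e\<bar>"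
proof -
  have "sqrt (x\<^sup>2 + e\<^sup>2) \<le> \<bar>x\<bar> + \<bar>e\<bar>" using sqrt_add_le_add_sqrt[of "x\<^sup>2" "e\<^sup>2"] by simp
  moreover have "\<bar>x\<bar> \<le> sqrt (x\<^sup>2 + e\<^sup>2)" by (rule real_le_rsqrt) simp
  moreover have "\<bar>(x + r) / 2 - pos x\<bar> \<le> \<bar>e\<bar>" if "\<bar>x\<bar> \<le> r" "r \<le> \<bar>x\<bar> + \<bar>e\<bar>" for r
    using that unfolding pos_def max_def by (cases "x \<le> 0") auto
  ultimately show ?thesis unfolding smpos_def by blast
qed

lemma pos_nonneg [simp]: "pos x \<ge> 0" by (simp add: pos_def)

lemma pos_lipschitz: "\<bar>pos x - pos y\<bar> \<le> \<bar>x - y\<bar>" by (simp add: pos_def)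

lemma pos_mono: "x \<le> y \<Longrightarrow> pos x \<le> pos y" by (simp add: pos_def)

lemma borel_measurable_pos [measurable]: "pos \<in> borel_measurable borel"
  unfolding pos_def by measurable
lemma compact_closure_subset:
  fixes A B :: "'a::t2_space set"
  assumes "closure A \<subseteq> B" "compact B"
  shows "compact (closure A)"
proof -
  have "compact (B \<inter> closure A)" using assms(2) by (rule compact_Int_closed) simp
  then show ?thesis using assms(1) by (simp add: inf_absorb2)
qed

lemma test_function_truncate:
  assumes \<phi>: "\<phi> \<in> test_functions \<Omega>" and "e \<noteq> 0"
  shows "(\<lambda>x. smpos e (\<phi> x - c) - smpos e (- c)) \<in> test_functions \<Omega>"
proof -
  let ?h = "\<lambda>x. smpos e (\<phi> x - c) - smpos e (- c)"
  have s: "smooth \<phi>" "compact (closure {x. \<phi> x \<noteq> 0})" "closure {x. \<phi> x \<noteq> 0} \<subseteq> \<Omega>"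
    using \<phi> by (auto simp: test_functions_def)
  have s1: "smooth (\<lambda>x. \<phi> x + (- c))" by (intro smooth_add smooth_const s)
  have "smooth (\<lambda>x. sqrt ((\<phi> x + (- c)) * (\<phi> x + (- c)) + e\<^sup>2))"
    using \<open>e \<noteq> 0\<close> by (intro smooth_sqrt smooth_add smooth_mult smooth_const s) (auto intro: add_nonneg_pos)
  then have "smooth (\<lambda>x. (1/2) * ((\<phi> x + (- c)) + sqrt ((\<phi> x + (- c)) * (\<phi> x + (- c)) + e\<^sup>2)) + (- smpos e (- c)))"
    using s1 by (intro smooth_add smooth_mult smooth_const s)
  moreover have "?h = (\<lambda>x. (1/2) * ((\<phi> x + (- c)) + sqrt ((\<phi> x + (- c)) * (\<phi> x + (- c)) + e\<^sup>2)) + (- smpos e (- c)))"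
    by (auto simp: smpos_def power2_eq_square)
  ultimately have "smooth ?h" by simp
  moreover have sub: "closure {x. ?h x \<noteq> 0} \<subseteq> closure {x. \<phi> x \<noteq> 0}"
    by (rule closure_mono) auto
  moreover have "compact (closure {x. ?h x \<noteq> 0})"
    by (rule compact_closure_subset[OF sub s(2)])
  ultimately show ?thesis using s(3) by (auto simp: test_functions_def)
qed

lemma test_function_cmult:
  assumes \<phi>: "\<phi> \<in> test_functions \<Omega>"
  shows "(\<lambda>x. c * \<phi> x) \<in> test_functions \<Omega>"
proof -
  have sub: "closure {x. c * \<phi> x \<noteq> 0} \<subseteq> closure {x. \<phi> x \<noteq> 0}"
    by (rule closure_mono) auto
  moreover have "compact (closure {x. c * \<phi> x \<noteq> 0})"
    by (rule compact_closure_subset[OF sub]) (use \<phi> in \<open>simp add: test_functions_def\<close>)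
  ultimately show ?thesis using \<phi> by (auto simp: test_functions_def intro!: smooth_mult smooth_const)
qed

lemma test_function_add:
  assumes \<phi>: "\<phi> \<in> test_functions \<Omega>" and \<psi>: "\<psi> \<in> test_functions \<Omega>"
  shows "(\<lambda>x. \<phi> x + \<psi> x) \<in> test_functions \<Omega>"
proof -
  have "{x. \<phi> x + \<psi> x \<noteq> 0} \<subseteq> {x. \<phi> x \<noteq> 0} \<union> {x. \<psi> x \<noteq> 0}" by auto
  then have sub: "closure {x. \<phi> x + \<psi> x \<noteq> 0} \<subseteq> closure {x. \<phi> x \<noteq> 0} \<union> closure {x. \<psi> x \<noteq> 0}"
    by (metis closure_Un closure_mono)
  moreover have "compact (closure {x. \<phi> x \<noteq> 0} \<union> closure {x. \<psi> x \<noteq> 0})"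
    using \<phi> \<psi> by (auto simp: test_functions_def)
  moreover have "compact (closure {x. \<phi> x + \<psi> x \<noteq> 0})"
    by (rule compact_closure_subset[OF sub]) (use \<phi> \<psi> in \<open>simp add: test_functions_def compact_Un\<close>)
  ultimately show ?thesis using \<phi> \<psi> by (auto simp: test_functions_def intro!: smooth_add)
qed
subsection \<open>The fractional Sobolev space\<close>

lemma sigma_finite_lebesgue: "sigma_finite_measure (lebesgue :: 'a::euclidean_space measure)"
proof
  obtain A :: "'a set set" where A: "countable A" "A \<subseteq> sets lborel" "\<Union>A = space lborel" "\<forall>a\<in>A. emeasure lborel a \<noteq> \<infinity>"
    using lborel.sigma_finite_countable by metis
  then show "\<exists>A. countable A \<and> A \<subseteq> sets lebesgue \<and> \<Union>A = space (lebesgue :: 'a measure) \<and> (\<forall>a\<in>A. emeasure lebesgue a \<noteq> \<infinity>)"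
    by (intro exI[of _ A]) (auto simp: subset_iff)
qed

interpretation lebesgue: sigma_finite_measure "lebesgue :: 'a::euclidean_space measure"
  by (rule sigma_finite_lebesgue)

interpretation lebesgue_pair: pair_sigma_finite "lebesgue :: 'a::euclidean_space measure" "lebesgue :: 'b::euclidean_space measure" ..

lemma borel_measurable_ident_lebesgue [measurable]: "(\<lambda>x. x) \<in> borel_measurable lebesgue"
  by (intro measurable_completion) simp

lemma borel_measurable_norm_diff [measurable]:
  "(\<lambda>z. norm (fst z - snd z)) \<in> borel_measurable (lebesgue \<Otimes>\<^sub>M (lebesgue :: 'a::euclidean_space measure))"
proof -
  have [measurable]: "fst \<in> borel_measurable (lebesgue \<Otimes>\<^sub>M (lebesgue :: 'a measure))"
    "snd \<in> borel_measurable (lebesgue \<Otimes>\<^sub>M (lebesgue :: 'a measure))"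
    using measurable_compose[OF measurable_fst borel_measurable_ident_lebesgue]
      measurable_compose[OF measurable_snd borel_measurable_ident_lebesgue] by auto
  show ?thesis by measurable
qed

lemma AE_lebesgue_pair:
  fixes P :: "'a::euclidean_space \<Rightarrow> bool"
  assumes "AE x in lebesgue. P x"
  shows "AE z in lebesgue \<Otimes>\<^sub>M (lebesgue :: 'a measure). P (fst z) \<and> P (snd z)"
proof -
  obtain N where N: "N \<in> null_sets lebesgue" "\<And>x. x \<notin> N \<Longrightarrow> P x"
    using assms by (auto simp: eventually_ae_filter)
  have [measurable]: "N \<in> sets lebesgue" using N(1) by (rule null_setsD2)
  have ae: "AE x in lebesgue. x \<notin> N" using N(1) by (rule AE_not_in)
  have "AE z in lebesgue \<Otimes>\<^sub>M (lebesgue :: 'a measure). fst z \<notin> N \<and> snd z \<notin> N"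
  proof (rule lebesgue_pair.AE_pair_measure)
    show "{z \<in> space (lebesgue \<Otimes>\<^sub>M lebesgue). fst z \<notin> N \<and> snd z \<notin> N} \<in> sets (lebesgue \<Otimes>\<^sub>M lebesgue)"
      by measurable
    show "AE x in lebesgue. AE y in lebesgue. fst (x, y) \<notin> N \<and> snd (x, y) \<notin> N"
      using ae by eventually_elim (use ae in auto)
  qed
  then show ?thesis by eventually_elim (use N(2) in auto)
qed
definition gmeasure :: "real \<Rightarrow> real \<Rightarrow> ('a::euclidean_space \<times> 'a) measure" where
  "gmeasure p s = density (lebesgue \<Otimes>\<^sub>M lebesgue)
     (\<lambda>z. ennreal (1 / norm (fst z - snd z) powr (real DIM('a) + s * p)))"

definition dif :: "('a \<Rightarrow> real) \<Rightarrow> 'a \<times> 'a \<Rightarrow> real" where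
  "dif u z = u (fst z) - u (snd z)"

definition sob :: "real \<Rightarrow> real \<Rightarrow> ('a::euclidean_space \<Rightarrow> real) \<Rightarrow> ennreal" where
  "sob p s u = frac_energy p s u + (\<integral>\<^sup>+ x. ennreal (\<bar>u x\<bar> powr p) \<partial>lebesgue)"

definition psi :: "real \<Rightarrow> real \<Rightarrow> real" where
  "psi p a = \<bar>a\<bar> powr (p - 2) * a"

lemma sets_gmeasure [measurable_cong]: "sets (gmeasure p s) = sets (lebesgue \<Otimes>\<^sub>M lebesgue)"
  by (simp add: gmeasure_def)

lemma borel_measurable_dif [measurable]:
  assumes [measurable]: "u \<in> borel_measurable lebesgue"
  shows "dif u \<in> borel_measurable (lebesgue \<Otimes>\<^sub>M lebesgue)"
  unfolding dif_def by measurable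

lemma borel_measurable_psi [measurable]: "psi p \<in> borel_measurable borel"
  unfolding psi_def by measurable

lemma AE_gmeasure:
  assumes "AE z in lebesgue \<Otimes>\<^sub>M (lebesgue :: 'a::euclidean_space measure). P z"
  shows "AE z in gmeasure p s. P z"
proof -
  have [measurable]: "(\<lambda>z. ennreal (1 / norm (fst z - snd z) powr (real DIM('a) + s * p)))
    \<in> borel_measurable (lebesgue \<Otimes>\<^sub>M (lebesgue :: 'a measure))" by measurable
  show ?thesis unfolding gmeasure_def using assms by (subst AE_density) auto
qed

lemma nn_integral_gmeasure:
  fixes f :: "'a::euclidean_space \<times> 'a \<Rightarrow> ennreal"
  assumes [measurable]: "f \<in> borel_measurable (lebesgue \<Otimes>\<^sub>M lebesgue)"
  shows "(\<integral>\<^sup>+ z. f z \<partial>gmeasure p s) = (\<integral>\<^sup>+ x. \<integral>\<^sup>+ y. ennreal (1 / norm (x - y) powr (real DIM('a) + s * p)) * f (x, y) \<partial>lebesgue \<partial>lebesgue)"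
  unfolding gmeasure_def
  by (subst nn_integral_density) (auto simp: lebesgue.nn_integral_fst[symmetric])

lemma frac_energy_eq:
  assumes [measurable]: "u \<in> borel_measurable lebesgue"
  shows "frac_energy p s u = ennreal (1 / p) * (\<integral>\<^sup>+ z. ennreal (\<bar>dif u z\<bar> powr p) \<partial>gmeasure p s)"
proof -
  have "(\<integral>\<^sup>+ z. ennreal (\<bar>dif u z\<bar> powr p) \<partial>gmeasure p s) =
    (\<integral>\<^sup>+ (x, y). ennreal (\<bar>u x - u y\<bar> powr p / norm (x - y) powr (real DIM('a) + s * p)) \<partial>(lebesgue \<Otimes>\<^sub>M lebesgue))"
    unfolding gmeasure_def
    by (subst nn_integral_density) (auto simp: dif_def case_prod_beta simp flip: ennreal_mult' intro!: nn_integral_cong)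
  then show ?thesis by (simp add: frac_energy_def)
qed

lemma LINT_gmeasure:
  assumes [measurable]: "u \<in> borel_measurable lebesgue" "v \<in> borel_measurable lebesgue"
  shows "(LINT (x, y)|(lebesgue \<Otimes>\<^sub>M lebesgue).
           \<bar>u x - u y\<bar> powr (p - 2) * (u x - u y) * (v x - v y)
             / norm (x - y) powr (real DIM('a::euclidean_space) + s * p))
    = (LINT z|gmeasure p s. psi p (dif u z) * dif v (z :: 'a \<times> 'a))"
  unfolding gmeasure_def
  by (subst integral_density) (auto simp: dif_def psi_def case_prod_beta intro!: Bochner_Integration.integral_cong)

lemma abs_add_powr_le:
  fixes a b :: real
  assumes "p \<ge> 0"
  shows "\<bar>a + b\<bar> powr p \<le> 2 powr p * (\<bar>a\<bar> powr p + \<bar>b\<bar> powr p)"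
proof -
  have "\<bar>a + b\<bar> powr p \<le> (2 * max \<bar>a\<bar> \<bar>b\<bar>) powr p"
    using assms by (intro powr_mono2) auto
  also have "\<dots> = 2 powr p * (max \<bar>a\<bar> \<bar>b\<bar>) powr p" by (simp add: powr_mult)
  also have "(max \<bar>a\<bar> \<bar>b\<bar>) powr p \<le> \<bar>a\<bar> powr p + \<bar>b\<bar> powr p" by (simp add: max_def)
  finally show ?thesis by simp
qed

lemma sob_eq:
  assumes "u \<in> borel_measurable lebesgue"
  shows "sob p s u = ennreal (1 / p) * (\<integral>\<^sup>+ z. ennreal (\<bar>dif u z\<bar> powr p) \<partial>gmeasure p s)
    + (\<integral>\<^sup>+ x. ennreal (\<bar>u x\<bar> powr p) \<partial>lebesgue)"
  by (simp add: sob_def frac_energy_eq assms)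

lemma sob_cmult:
  fixes u :: "'a::euclidean_space \<Rightarrow> real"
  assumes [measurable]: "u \<in> borel_measurable lebesgue"
  shows "sob p s (\<lambda>x. c * u x) = ennreal (\<bar>c\<bar> powr p) * sob p s u"
proof -
  have "dif (\<lambda>x. c * u x) z = c * dif u z" for z by (simp add: dif_def algebra_simps)
  then show ?thesis
    by (simp add: sob_eq abs_mult powr_mult ennreal_mult' nn_integral_cmult distrib_left mult_ac)
qed

lemma sob_add_le:
  fixes u v :: "'a::euclidean_space \<Rightarrow> real"
  assumes [measurable]: "u \<in> borel_measurable lebesgue" "v \<in> borel_measurable lebesgue" and "p \<ge> 0"
  shows "sob p s (\<lambda>x. u x + v x) \<le> ennreal (2 powr p) * (sob p s u + sob p s v)"
proof -
  have "(\<integral>\<^sup>+ z. ennreal (\<bar>dif (\<lambda>x. u x + v x) z\<bar> powr p) \<partial>gmeasure p s)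
    \<le> (\<integral>\<^sup>+ z. ennreal (2 powr p) * (ennreal (\<bar>dif u z\<bar> powr p) + ennreal (\<bar>dif v z\<bar> powr p)) \<partial>gmeasure p s)"
  proof (rule nn_integral_mono)
    fix z :: "'a \<times> 'a"
    have "dif (\<lambda>x. u x + v x) z = dif u z + dif v z" by (simp add: dif_def)
    then show "ennreal (\<bar>dif (\<lambda>x. u x + v x) z\<bar> powr p) \<le> ennreal (2 powr p) * (ennreal (\<bar>dif u z\<bar> powr p) + ennreal (\<bar>dif v z\<bar> powr p))"
      using abs_add_powr_le[OF \<open>p \<ge> 0\<close>, of "dif u z" "dif v z"] by (simp flip: ennreal_plus ennreal_mult')
  qed
  moreover have "(\<integral>\<^sup>+ x. ennreal (\<bar>u x + v x\<bar> powr p) \<partial>lebesgue)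
    \<le> (\<integral>\<^sup>+ x. ennreal (2 powr p) * (ennreal (\<bar>u x\<bar> powr p) + ennreal (\<bar>v x\<bar> powr p)) \<partial>lebesgue)"
    using abs_add_powr_le[OF \<open>p \<ge> 0\<close>] by (intro nn_integral_mono) (simp flip: ennreal_plus ennreal_mult')
  ultimately have "sob p s (\<lambda>x. u x + v x) \<le>
    ennreal (1 / p) * (\<integral>\<^sup>+ z. ennreal (2 powr p) * (ennreal (\<bar>dif u z\<bar> powr p) + ennreal (\<bar>dif v z\<bar> powr p)) \<partial>gmeasure p s)
    + (\<integral>\<^sup>+ x. ennreal (2 powr p) * (ennreal (\<bar>u x\<bar> powr p) + ennreal (\<bar>v x\<bar> powr p)) \<partial>lebesgue)"
    by (simp add: sob_eq add_mono mult_left_mono)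
  also have "\<dots> = ennreal (2 powr p) * (sob p s u + sob p s v)"
    by (simp add: sob_eq nn_integral_cmult nn_integral_add) (simp add: distrib_left ac_simps)
  finally show ?thesis .
qed

lemma sob_root_less_iff:
  assumes "r > 0" "e > 0"
  shows "ennreal_root r x < ennreal e \<longleftrightarrow> x < ennreal (e powr r)"
proof (cases x)
  case (real t)
  then have "ennreal_root r x = ennreal (t powr (1 / r))" by (simp add: ennreal_root_def)
  then have "ennreal_root r x < ennreal e \<longleftrightarrow> t powr (1 / r) < e" using assms by (simp add: ennreal_less_iff)
  also have "\<dots> \<longleftrightarrow> (t powr (1 / r)) powr r < e powr r" 
    using assms by (metis less_imp_le not_le powr_ge_zero powr_less_mono2 powr_mono2)
  also have "\<dots> \<longleftrightarrow> t < e powr r" using assms real by (simp add: powr_powr)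
  finally show ?thesis using real by (simp add: ennreal_less_iff)
qed (simp add: ennreal_root_def)

lemma frac_sobolev0_iff:
  assumes "p > 0"
  shows "u \<in> frac_sobolev0 p s \<Omega> \<longleftrightarrow> u \<in> borel_measurable lebesgue \<and> sob p s u < \<infinity> \<and>
     (\<forall>e>0. \<exists>\<phi>\<in>test_functions \<Omega>. sob p s (\<lambda>x. u x - \<phi> x) < ennreal e)"
proof -
  have 1: "frac_sobolev_norm p s u = ennreal_root p (sob p s u)" for u :: "'a \<Rightarrow> real"
    by (simp add: frac_sobolev_norm_def sob_def)
  have 2: "ennreal_root p x < \<infinity> \<longleftrightarrow> x < \<infinity>" for x by (simp add: ennreal_root_def less_top)
  have 3: "(\<forall>\<epsilon>>0. \<exists>\<phi>\<in>test_functions \<Omega>. ennreal_root p (sob p s (\<lambda>x. u x - \<phi> x)) < \<epsilon>)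
    \<longleftrightarrow> (\<forall>e>0. \<exists>\<phi>\<in>test_functions \<Omega>. sob p s (\<lambda>x. u x - \<phi> x) < ennreal e)" (is "?L \<longleftrightarrow> ?R")
  proof
    assume L: ?L
    show ?R
    proof (intro allI impI)
      fix e :: real assume "e > 0"
      then have "ennreal (e powr (1 / p)) > 0" by simp
      with L obtain \<phi> where "\<phi> \<in> test_functions \<Omega>" "ennreal_root p (sob p s (\<lambda>x. u x - \<phi> x)) < ennreal (e powr (1 / p))"
        by blast
      then show "\<exists>\<phi>\<in>test_functions \<Omega>. sob p s (\<lambda>x. u x - \<phi> x) < ennreal e"
        using \<open>e > 0\<close> \<open>p > 0\<close> by (auto simp: sob_root_less_iff powr_powr)
    qed
  next
    assume R: ?R
    show ?L
    proof (intro allI impI)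
      fix e :: ennreal assume "e > 0"
      then obtain r where r: "r > 0" "ennreal r \<le> e"
        using that[of 1] by (cases e) auto
      have "r powr p > 0" using r by simp
      with R obtain \<phi> where "\<phi> \<in> test_functions \<Omega>" "sob p s (\<lambda>x. u x - \<phi> x) < ennreal (r powr p)" by blast
      then show "\<exists>\<phi>\<in>test_functions \<Omega>. ennreal_root p (sob p s (\<lambda>x. u x - \<phi> x)) < e"
        using r \<open>p > 0\<close> by (auto simp flip: sob_root_less_iff intro: less_le_trans)
    qed
  qed
  show ?thesis unfolding frac_sobolev0_def 1 2 mem_Collect_eq 3 by blast
qed

lemma test_function_measurable [measurable_dest]:
  "\<phi> \<in> test_functions \<Omega> \<Longrightarrow> \<phi> \<in> borel_measurable lebesgue"
proof -
  assume "\<phi> \<in> test_functions \<Omega>"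
  then have "Ck 0 \<phi>" by (simp only: test_functions_def smooth_def mem_Collect_eq)
  then show ?thesis by (intro measurable_completion) (simp add: borel_measurable_continuous_onI)
qed

lemma tendsto_0_le_ennreal:
  fixes f g :: "'b \<Rightarrow> ennreal"
  assumes "(g \<longlongrightarrow> 0) F" "\<And>n. f n \<le> g n"
  shows "(f \<longlongrightarrow> 0) F"
  by (rule tendsto_sandwich[OF _ _ tendsto_const assms(1)]) (auto simp: assms(2))

lemma nn_integral_powr_dominated:
  fixes X :: "nat \<Rightarrow> 'b \<Rightarrow> real"
  assumes [measurable]: "\<And>n. X n \<in> borel_measurable M" "g \<in> borel_measurable M" "\<And>n. e n \<in> borel_measurable M"
    and "p > 0"
    and g: "(\<integral>\<^sup>+ x. ennreal (\<bar>g x\<bar> powr p) \<partial>M) < \<infinity>"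
    and e: "(\<lambda>n. \<integral>\<^sup>+ x. ennreal (\<bar>e n x\<bar> powr p) \<partial>M) \<longlonglongrightarrow> 0"
    and X: "AE x in M. (\<lambda>n. X n x) \<longlonglongrightarrow> 0"
    and le: "\<And>n x. \<bar>X n x\<bar> \<le> \<bar>g x\<bar> + \<bar>e n x\<bar>"
  shows "(\<lambda>n. \<integral>\<^sup>+ x. ennreal (\<bar>X n x\<bar> powr p) \<partial>M) \<longlonglongrightarrow> 0"
proof -
  define Y where "Y n x = min \<bar>X n x\<bar> \<bar>g x\<bar>" for n x
  have [measurable]: "Y n \<in> borel_measurable M" for n unfolding Y_def by measurable
  have "(\<lambda>n. \<integral>\<^sup>+ x. ennreal (Y n x powr p) \<partial>M) \<longlonglongrightarrow> (\<integral>\<^sup>+ x. 0 \<partial>M)"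
  proof (rule nn_integral_dominated_convergence[where w = "\<lambda>x. ennreal (\<bar>g x\<bar> powr p)"])
    show "AE x in M. ennreal (Y n x powr p) \<le> ennreal (\<bar>g x\<bar> powr p)" for n
      using \<open>p > 0\<close> by (intro AE_I2 ennreal_leI powr_mono2) (auto simp: Y_def)
    show "AE x in M. (\<lambda>n. ennreal (Y n x powr p)) \<longlonglongrightarrow> 0"
      using X
    proof eventually_elim
      case (elim x)
      have "(\<lambda>n. \<bar>X n x\<bar>) \<longlonglongrightarrow> 0" using tendsto_rabs[OF elim] by simp
      then have "(\<lambda>n. Y n x) \<longlonglongrightarrow> min 0 \<bar>g x\<bar>" unfolding Y_def by (intro tendsto_intros)
      then have "(\<lambda>n. Y n x) \<longlonglongrightarrow> 0" by simp
      then have "(\<lambda>n. Y n x powr p) \<longlonglongrightarrow> 0 powr p"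
        using \<open>p > 0\<close> by (intro tendsto_powr' tendsto_const) (auto simp: Y_def)
      then have "(\<lambda>n. ennreal (Y n x powr p)) \<longlonglongrightarrow> ennreal 0"
        using \<open>p > 0\<close> by (intro tendsto_ennrealI) simp
      then show ?case by simp
    qed
  qed (use g in auto)
  then have lim: "(\<lambda>n. ennreal (2 powr p) * ((\<integral>\<^sup>+ x. ennreal (Y n x powr p) \<partial>M) + (\<integral>\<^sup>+ x. ennreal (\<bar>e n x\<bar> powr p) \<partial>M))) \<longlonglongrightarrow> ennreal (2 powr p) * (0 + 0)"
    using e by (intro ennreal_tendsto_cmult tendsto_add) auto
  have bound: "(\<integral>\<^sup>+ x. ennreal (\<bar>X n x\<bar> powr p) \<partial>M) \<le> ennreal (2 powr p) * ((\<integral>\<^sup>+ x. ennreal (Y n x powr p) \<partial>M) + (\<integral>\<^sup>+ x. ennreal (\<bar>e n x\<bar> powr p) \<partial>M))" for n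
  proof -
    have "(\<integral>\<^sup>+ x. ennreal (\<bar>X n x\<bar> powr p) \<partial>M) \<le> (\<integral>\<^sup>+ x. ennreal (2 powr p) * (ennreal (Y n x powr p) + ennreal (\<bar>e n x\<bar> powr p)) \<partial>M)"
    proof (rule nn_integral_mono)
      fix x
      have "\<bar>X n x\<bar> \<le> \<bar>Y n x + \<bar>e n x\<bar>\<bar>" using le[of n x] by (simp add: Y_def)
      then have "\<bar>X n x\<bar> powr p \<le> \<bar>Y n x + \<bar>e n x\<bar>\<bar> powr p" using \<open>p > 0\<close> by (intro powr_mono2) auto
      also have "\<dots> \<le> 2 powr p * (\<bar>Y n x\<bar> powr p + \<bar>\<bar>e n x\<bar>\<bar> powr p)" using \<open>p > 0\<close> by (intro abs_add_powr_le) simp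
      also have "\<bar>Y n x\<bar> = Y n x" by (simp add: Y_def)
      finally show "ennreal (\<bar>X n x\<bar> powr p) \<le> ennreal (2 powr p) * (ennreal (Y n x powr p) + ennreal (\<bar>e n x\<bar> powr p))"
        by (simp flip: ennreal_plus ennreal_mult')
    qed
    then show ?thesis by (simp add: nn_integral_cmult nn_integral_add)
  qed
  show ?thesis
    by (rule tendsto_sandwich[OF _ _ tendsto_const]) (use lim bound in auto)
qed

context
  fixes p s :: real and \<Omega> :: "'a::euclidean_space set"
  assumes p: "p > 1"
begin

lemma frac_sobolev0_measurable [measurable_dest]:
  "u \<in> frac_sobolev0 p s \<Omega> \<Longrightarrow> u \<in> borel_measurable lebesgue"
  by (simp add: frac_sobolev0_def)

lemma frac_sobolev0_approx:
  assumes "u \<in> frac_sobolev0 p s \<Omega>" "e > 0"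
  obtains \<phi> where "\<phi> \<in> test_functions \<Omega>" "sob p s (\<lambda>x. u x - \<phi> x) < ennreal e"
  using assms p by (auto simp: frac_sobolev0_iff)

lemma frac_sobolev0_cmult:
  assumes u: "u \<in> frac_sobolev0 p s \<Omega>"
  shows "(\<lambda>x. c * u x) \<in> frac_sobolev0 p s \<Omega>"
proof -
  have p0: "p > 0" using p by simp
  note [measurable] = frac_sobolev0_measurable[OF u]
  have fin: "sob p s u < \<infinity>" using u p0 by (simp add: frac_sobolev0_iff)
  have "\<exists>\<phi>\<in>test_functions \<Omega>. sob p s (\<lambda>x. c * u x - \<phi> x) < ennreal e" if "e > 0" for e
  proof -
    have pos: "e / (\<bar>c\<bar> powr p + 1) > 0" using that by (simp add: add_nonneg_pos)
    obtain \<phi> where \<phi>: "\<phi> \<in> test_functions \<Omega>" "sob p s (\<lambda>x. u x - \<phi> x) < ennreal (e / (\<bar>c\<bar> powr p + 1))"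
      using frac_sobolev0_approx[OF u pos] .
    note [measurable] = test_function_measurable[OF \<phi>(1)]
    have "sob p s (\<lambda>x. c * u x - c * \<phi> x) = sob p s (\<lambda>x. c * (u x - \<phi> x))" by (simp add: right_diff_distrib)
    also have "\<dots> = ennreal (\<bar>c\<bar> powr p) * sob p s (\<lambda>x. u x - \<phi> x)" by (rule sob_cmult) measurable
    also have "\<dots> \<le> ennreal (\<bar>c\<bar> powr p) * ennreal (e / (\<bar>c\<bar> powr p + 1))"
      using \<phi>(2) by (intro mult_left_mono) auto
    also have "\<dots> = ennreal (\<bar>c\<bar> powr p * (e / (\<bar>c\<bar> powr p + 1)))" using pos by (intro ennreal_mult'[symmetric]) simp
    also have "\<dots> < ennreal e" using that
      by (intro ennreal_lessI that, subst times_divide_eq_right, subst pos_divide_less_eq)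
        (auto simp: algebra_simps add_pos_nonneg)
    finally show ?thesis by (intro bexI[of _ "\<lambda>x. c * \<phi> x"] test_function_cmult \<phi>)
  qed
  then show ?thesis using fin p0 by (auto simp: frac_sobolev0_iff sob_cmult ennreal_mult_less_top)
qed

lemma frac_sobolev0_add:
  assumes u: "u \<in> frac_sobolev0 p s \<Omega>" and v: "v \<in> frac_sobolev0 p s \<Omega>"
  shows "(\<lambda>x. u x + v x) \<in> frac_sobolev0 p s \<Omega>"
proof -
  have p0: "p > 0" using p by simp
  note [measurable] = frac_sobolev0_measurable[OF u] frac_sobolev0_measurable[OF v]
  have "sob p s u < \<infinity>" "sob p s v < \<infinity>" using u v p0 by (auto simp: frac_sobolev0_iff)
  then have fin: "sob p s (\<lambda>x. u x + v x) < \<infinity>"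
    using sob_add_le[of u v p s] p0
    by (auto simp: ennreal_mult_less_top intro: le_less_trans)
  have "\<exists>\<phi>\<in>test_functions \<Omega>. sob p s (\<lambda>x. (u x + v x) - \<phi> x) < ennreal e" if "e > 0" for e
  proof -
    define d where "d = e / (2 powr p * 4)"
    have d: "d > 0" using that by (simp add: d_def)
    obtain \<phi> where \<phi>: "\<phi> \<in> test_functions \<Omega>" "sob p s (\<lambda>x. u x - \<phi> x) < ennreal d"
      using frac_sobolev0_approx[OF u d] .
    obtain \<psi> where \<psi>: "\<psi> \<in> test_functions \<Omega>" "sob p s (\<lambda>x. v x - \<psi> x) < ennreal d"
      using frac_sobolev0_approx[OF v d] .
    note [measurable] = test_function_measurable[OF \<phi>(1)] test_function_measurable[OF \<psi>(1)]
    have "sob p s (\<lambda>x. (u x + v x) - (\<phi> x + \<psi> x)) = sob p s (\<lambda>x. (u x - \<phi> x) + (v x - \<psi> x))"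
      by (simp add: algebra_simps)
    also have "\<dots> \<le> ennreal (2 powr p) * (sob p s (\<lambda>x. u x - \<phi> x) + sob p s (\<lambda>x. v x - \<psi> x))"
      using p0 by (intro sob_add_le) auto
    also have "\<dots> \<le> ennreal (2 powr p) * (ennreal d + ennreal d)"
      using \<phi>(2) \<psi>(2) by (intro mult_left_mono add_mono) auto
    also have "\<dots> = ennreal (2 powr p * (d + d))" using d by (simp only: ennreal_mult' ennreal_plus less_imp_le powr_ge_zero)
    also have "\<dots> < ennreal e" using that by (intro ennreal_lessI) (auto simp: d_def field_simps)
    finally show ?thesis by (intro bexI[of _ "\<lambda>x. \<phi> x + \<psi> x"] test_function_add \<phi> \<psi>)
  qed
  then show ?thesis using fin p0 by (auto simp: frac_sobolev0_iff)
qed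

lemma frac_sobolev0_diff:
  assumes "u \<in> frac_sobolev0 p s \<Omega>" "v \<in> frac_sobolev0 p s \<Omega>"
  shows "(\<lambda>x. u x - v x) \<in> frac_sobolev0 p s \<Omega>"
  using frac_sobolev0_add[OF assms(1) frac_sobolev0_cmult[OF assms(2), of "-1"]] by simp

lemma frac_sobolev0_energy:
  assumes u: "u \<in> frac_sobolev0 p s \<Omega>"
  shows "integrable (gmeasure p s) (\<lambda>z. \<bar>dif u z\<bar> powr p)"
    and "integrable lebesgue (\<lambda>x. \<bar>u x\<bar> powr p)"
proof -
  note [measurable] = frac_sobolev0_measurable[OF u]
  have "sob p s u < \<infinity>" using u p by (simp add: frac_sobolev0_iff)
  then show "integrable (gmeasure p s) (\<lambda>z. \<bar>dif u z\<bar> powr p)" "integrable lebesgue (\<lambda>x. \<bar>u x\<bar> powr p)"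
    using p by (auto intro!: integrableI_bounded simp: sob_eq ennreal_mult_less_top ennreal_mult_eq_top_iff less_top)
qed

lemma frac_sobolev0_AE_zero:
  assumes u: "u \<in> frac_sobolev0 p s \<Omega>" and [measurable]: "\<Omega> \<in> sets lebesgue"
  shows "AE x in lebesgue. x \<notin> \<Omega> \<longrightarrow> u x = 0"
proof -
  note [measurable] = frac_sobolev0_measurable[OF u]
  have le: "(\<integral>\<^sup>+ x. ennreal (\<bar>u x\<bar> powr p) * indicator (- \<Omega>) x \<partial>lebesgue) \<le> ennreal e" if "e > 0" for e
  proof -
    obtain \<phi> where \<phi>: "\<phi> \<in> test_functions \<Omega>" "sob p s (\<lambda>x. u x - \<phi> x) < ennreal e"
      using frac_sobolev0_approx[OF u \<open>e > 0\<close>] .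
    note [measurable] = test_function_measurable[OF \<phi>(1)]
    have "\<phi> x = 0" if "x \<notin> \<Omega>" for x
      using \<phi>(1) that closure_subset[of "{x. \<phi> x \<noteq> 0}"] by (auto simp: test_functions_def)
    then have "(\<integral>\<^sup>+ x. ennreal (\<bar>u x\<bar> powr p) * indicator (- \<Omega>) x \<partial>lebesgue) \<le> (\<integral>\<^sup>+ x. ennreal (\<bar>u x - \<phi> x\<bar> powr p) \<partial>lebesgue)"
      by (intro nn_integral_mono) (auto simp: indicator_def)
    also have "\<dots> \<le> sob p s (\<lambda>x. u x - \<phi> x)" by (simp add: sob_def)
    finally show ?thesis using \<phi>(2) by simp
  qed
  have "(\<integral>\<^sup>+ x. ennreal (\<bar>u x\<bar> powr p) * indicator (- \<Omega>) x \<partial>lebesgue) \<le> 0"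
    by (rule ennreal_le_epsilon) (simp only: add_0 le)
  then have "(\<integral>\<^sup>+ x. ennreal (\<bar>u x\<bar> powr p) * indicator (- \<Omega>) x \<partial>lebesgue) = 0" by simp
  then have "AE x in lebesgue. ennreal (\<bar>u x\<bar> powr p) * indicator (- \<Omega>) x = 0"
    by (subst (asm) nn_integral_0_iff_AE) auto
  then show ?thesis by eventually_elim (auto simp: indicator_def)
qed

text \<open>Truncations of approximating test functions, smoothed at scale \<open>1/(n+1)\<close>, stay test functions;
  domination by the difference quotients of \<open>u\<close> and of the error gives convergence in energy.\<close>

lemma frac_sobolev0_truncate:
  assumes u: "u \<in> frac_sobolev0 p s \<Omega>" and "c \<ge> 0"
  shows "(\<lambda>x. pos (u x - c)) \<in> frac_sobolev0 p s \<Omega>"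
proof -
  have p0: "p > 0" using p by simp
  note [measurable] = frac_sobolev0_measurable[OF u]
  have "\<exists>\<phi>. \<phi> \<in> test_functions \<Omega> \<and> sob p s (\<lambda>x. u x - \<phi> x) < ennreal (1 / real (Suc n))" for n
    using frac_sobolev0_approx[OF u, of "1 / real (Suc n)"] by (metis divide_pos_pos of_nat_0_less_iff zero_less_Suc zero_less_one)
  then obtain \<phi>0 where \<phi>0: "\<And>n. \<phi>0 n \<in> test_functions \<Omega>" "\<And>n. sob p s (\<lambda>x. u x - \<phi>0 n x) < ennreal (1 / real (Suc n))"
    by metis
  note [measurable] = test_function_measurable[OF \<phi>0(1)]
  have lim0: "(\<lambda>n. sob p s (\<lambda>x. u x - \<phi>0 n x)) \<longlonglongrightarrow> 0"
  proof (rule tendsto_sandwich[OF _ _ tendsto_const])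
    have "(\<lambda>n. ennreal (1 / real (Suc n))) \<longlonglongrightarrow> ennreal 0"
      using LIMSEQ_Suc[OF lim_1_over_n[where 'a = real]] by (intro tendsto_ennrealI) simp
    then show "(\<lambda>n. ennreal (1 / real (Suc n))) \<longlonglongrightarrow> 0" by simp
  qed (use \<phi>0(2) in \<open>auto intro!: always_eventually less_imp_le\<close>)
  have "\<exists>r. strict_mono r \<and> (AE x in lebesgue. (\<lambda>n. \<bar>u x - \<phi>0 (r n) x\<bar> powr p) \<longlonglongrightarrow> 0)"
  proof (rule tendsto_L1_AE_subseq)
    have fin: "(\<integral>\<^sup>+ x. ennreal (\<bar>u x - \<phi>0 n x\<bar> powr p) \<partial>lebesgue) < \<infinity>" for n
      by (rule le_less_trans[OF _ less_trans[OF \<phi>0(2)[of n]]]) (auto simp: sob_def)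
    show int: "integrable lebesgue (\<lambda>x. \<bar>u x - \<phi>0 n x\<bar> powr p)" for n
      using fin[of n] by (intro integrableI_bounded) auto
    have "(\<lambda>n. \<integral>\<^sup>+ x. ennreal (\<bar>u x - \<phi>0 n x\<bar> powr p) \<partial>lebesgue) \<longlonglongrightarrow> 0"
      by (rule tendsto_sandwich[OF _ _ tendsto_const lim0]) (auto simp: sob_def)
    then have "(\<lambda>n. ennreal (LINT x|lebesgue. norm (\<bar>u x - \<phi>0 n x\<bar> powr p))) \<longlonglongrightarrow> ennreal 0"
      using int by (simp add: nn_integral_eq_integral)
    then show "(\<lambda>n. LINT x|lebesgue. norm (\<bar>u x - \<phi>0 n x\<bar> powr p)) \<longlonglongrightarrow> 0"
      by (subst (asm) tendsto_ennreal_iff) auto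
  qed
  then obtain r where r: "strict_mono r" "AE x in lebesgue. (\<lambda>n. \<bar>u x - \<phi>0 (r n) x\<bar> powr p) \<longlonglongrightarrow> 0" by blast
  define \<phi> where "\<phi> n = \<phi>0 (r n)" for n
  define \<psi> where "\<psi> n x = smpos (1 / real (Suc n)) (\<phi> n x - c) - smpos (1 / real (Suc n)) (- c)" for n x
  have \<phi>t: "\<phi> n \<in> test_functions \<Omega>" for n using \<phi>0(1) by (simp add: \<phi>_def)
  have \<psi>t: "\<psi> n \<in> test_functions \<Omega>" for n
    unfolding \<psi>_def by (rule test_function_truncate[OF \<phi>t]) simp
  note [measurable] = test_function_measurable[OF \<phi>t] test_function_measurable[OF \<psi>t]
  have lim: "(\<lambda>n. sob p s (\<lambda>x. u x - \<phi> n x)) \<longlonglongrightarrow> 0"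
    unfolding \<phi>_def using LIMSEQ_subseq_LIMSEQ[OF lim0 r(1)] by (simp add: o_def)
  have aeconv: "AE x in lebesgue. (\<lambda>n. pos (u x - c) - \<psi> n x) \<longlonglongrightarrow> 0"
    using r(2)
  proof eventually_elim
    case (elim x)
    have "(\<lambda>n. (\<bar>u x - \<phi> n x\<bar> powr p) powr (1 / p)) \<longlonglongrightarrow> 0 powr (1 / p)"
      using p0 elim by (intro tendsto_powr' tendsto_const) (auto simp: \<phi>_def)
    then have *: "(\<lambda>n. \<bar>u x - \<phi> n x\<bar>) \<longlonglongrightarrow> 0" using p0 by (simp add: powr_powr)
    have close: "norm (pos (u x - c) - \<psi> n x) \<le> \<bar>u x - \<phi> n x\<bar> + 2 * (1 / real (Suc n))" for n
    proof -
      have "\<bar>smpos (1 / real (Suc n)) (\<phi> n x - c) - pos (\<phi> n x - c)\<bar> \<le> 1 / real (Suc n)"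
        "\<bar>smpos (1 / real (Suc n)) (- c) - pos (- c)\<bar> \<le> 1 / real (Suc n)"
        using smpos_approx[of "1 / real (Suc n)"] by auto
      moreover have "pos (- c) = 0" using \<open>c \<ge> 0\<close> by (simp add: pos_def)
      moreover have "\<bar>pos (u x - c) - pos (\<phi> n x - c)\<bar> \<le> \<bar>u x - \<phi> n x\<bar>"
        using pos_lipschitz[of "u x - c" "\<phi> n x - c"] by simp
      ultimately show ?thesis unfolding \<psi>_def real_norm_def by linarith
    qed
    have "(\<lambda>n. \<bar>u x - \<phi> n x\<bar> + 2 * (1 / real (Suc n))) \<longlonglongrightarrow> 0 + 2 * 0"
      by (intro tendsto_add tendsto_mult tendsto_const * LIMSEQ_Suc[OF lim_1_over_n])
    then show ?case
      using Lim_null_comparison[OF always_eventually[OF allI[OF close]]] by simp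
  qed
  have lip: "\<bar>\<psi> n x - \<psi> n y\<bar> \<le> \<bar>\<phi> n x - \<phi> n y\<bar>" for n x y
    unfolding \<psi>_def using smpos_lipschitz[of "1 / real (Suc n)" "\<phi> n x - c" "\<phi> n y - c"] by simp
  have sz: "\<bar>\<psi> n x\<bar> \<le> \<bar>\<phi> n x\<bar>" for n x
    unfolding \<psi>_def using smpos_lipschitz[of "1 / real (Suc n)" "\<phi> n x - c" "- c"] by simp
  have psz: "\<bar>pos (a - c)\<bar> \<le> \<bar>a\<bar>" for a using \<open>c \<ge> 0\<close> by (simp add: pos_def)
  have "(\<lambda>n. \<integral>\<^sup>+ x. ennreal (\<bar>pos (u x - c) - \<psi> n x\<bar> powr p) \<partial>lebesgue) \<longlonglongrightarrow> 0"
  proof (rule nn_integral_powr_dominated[where g = "\<lambda>x. 2 * u x" and e = "\<lambda>n x. u x - \<phi> n x"])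
    show "(\<integral>\<^sup>+ x. ennreal (\<bar>2 * u x\<bar> powr p) \<partial>lebesgue) < \<infinity>"
      using frac_sobolev0_energy(2)[OF frac_sobolev0_cmult[OF u, of 2]] by (simp add: integrable_iff_bounded)
    show "(\<lambda>n. \<integral>\<^sup>+ x. ennreal (\<bar>u x - \<phi> n x\<bar> powr p) \<partial>lebesgue) \<longlonglongrightarrow> 0"
      by (rule tendsto_sandwich[OF _ _ tendsto_const lim]) (auto simp: sob_def)
    show "\<bar>pos (u x - c) - \<psi> n x\<bar> \<le> \<bar>2 * u x\<bar> + \<bar>u x - \<phi> n x\<bar>" for n x
      using sz[of n x] psz[of "u x"] by linarith
  qed (use p0 aeconv in auto)
  moreover have "(\<lambda>n. \<integral>\<^sup>+ z. ennreal (\<bar>dif (\<lambda>x. pos (u x - c) - \<psi> n x) z\<bar> powr p) \<partial>gmeasure p s) \<longlonglongrightarrow> 0"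
  proof (rule nn_integral_powr_dominated[where g = "\<lambda>z. 2 * dif u z" and e = "\<lambda>n. dif (\<lambda>x. u x - \<phi> n x)"])
    have "dif (\<lambda>x. 2 * u x) = (\<lambda>z. 2 * dif u z)" by (auto simp: dif_def)
    then show "(\<integral>\<^sup>+ z. ennreal (\<bar>2 * dif u z\<bar> powr p) \<partial>gmeasure p s) < \<infinity>"
      using frac_sobolev0_energy(1)[OF frac_sobolev0_cmult[OF u, of 2]] by (simp add: integrable_iff_bounded)
    have l: "(\<lambda>n. ennreal p * sob p s (\<lambda>x. u x - \<phi> n x)) \<longlonglongrightarrow> 0"
      using ennreal_tendsto_cmult[OF _ lim, of "ennreal p"] by simp
    have b: "(\<integral>\<^sup>+ z. ennreal (\<bar>dif (\<lambda>x. u x - \<phi> n x) z\<bar> powr p) \<partial>gmeasure p s) \<le> ennreal p * sob p s (\<lambda>x. u x - \<phi> n x)" for n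
      using p0 by (simp add: sob_eq distrib_left mult.assoc[symmetric] flip: ennreal_mult')
    show "(\<lambda>n. \<integral>\<^sup>+ z. ennreal (\<bar>dif (\<lambda>x. u x - \<phi> n x) z\<bar> powr p) \<partial>gmeasure p s) \<longlonglongrightarrow> 0"
      by (rule tendsto_0_le_ennreal[OF l b])
    show "AE z in gmeasure p s. (\<lambda>n. dif (\<lambda>x. pos (u x - c) - \<psi> n x) z) \<longlonglongrightarrow> 0"
      using AE_gmeasure[OF AE_lebesgue_pair[OF aeconv]]
    proof eventually_elim
      case (elim z)
      then have "(\<lambda>n. (pos (u (fst z) - c) - \<psi> n (fst z)) - (pos (u (snd z) - c) - \<psi> n (snd z))) \<longlonglongrightarrow> 0 - 0"
        using tendsto_diff by blast
      then show ?case by (simp add: dif_def)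
    qed
    show "\<bar>dif (\<lambda>x. pos (u x - c) - \<psi> n x) z\<bar> \<le> \<bar>2 * dif u z\<bar> + \<bar>dif (\<lambda>x. u x - \<phi> n x) z\<bar>" for n z
    proof -
      have aux: "\<bar>P - Q\<bar> \<le> \<bar>2 * U\<bar> + \<bar>U - V\<bar>" if "\<bar>P\<bar> \<le> \<bar>U\<bar>" "\<bar>Q\<bar> \<le> \<bar>V\<bar>" for P Q U V :: real
        using that by linarith
      have "\<bar>pos (u (fst z) - c) - pos (u (snd z) - c)\<bar> \<le> \<bar>u (fst z) - u (snd z)\<bar>"
        using pos_lipschitz[of "u (fst z) - c" "u (snd z) - c"] by simp
      from aux[OF this lip[of n "fst z" "snd z"]] show ?thesis
        by (simp add: dif_def algebra_simps)
    qed
  qed (use p0 in auto)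
  ultimately have "(\<lambda>n. ennreal (1 / p) * (\<integral>\<^sup>+ z. ennreal (\<bar>dif (\<lambda>x. pos (u x - c) - \<psi> n x) z\<bar> powr p) \<partial>gmeasure p s)
     + (\<integral>\<^sup>+ x. ennreal (\<bar>pos (u x - c) - \<psi> n x\<bar> powr p) \<partial>lebesgue)) \<longlonglongrightarrow> ennreal (1 / p) * 0 + 0"
    by (intro tendsto_add ennreal_tendsto_cmult) auto
  then have conv: "(\<lambda>n. sob p s (\<lambda>x. pos (u x - c) - \<psi> n x)) \<longlonglongrightarrow> 0"
    by (simp add: sob_eq)
  have "sob p s (\<lambda>x. pos (u x - c)) \<le> sob p s u"
  proof -
    have "\<bar>dif (\<lambda>x. pos (u x - c)) z\<bar> powr p \<le> \<bar>dif u z\<bar> powr p" for z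
      using p0 pos_lipschitz[of "u (fst z) - c" "u (snd z) - c"] by (intro powr_mono2) (auto simp: dif_def)
    moreover have "\<bar>pos (u x - c)\<bar> powr p \<le> \<bar>u x\<bar> powr p" for x
      using p0 psz by (intro powr_mono2) auto
    ultimately show ?thesis
      by (auto simp: sob_eq intro!: add_mono mult_left_mono nn_integral_mono ennreal_leI)
  qed
  then have fin: "sob p s (\<lambda>x. pos (u x - c)) < \<infinity>" using u p0 by (auto simp: frac_sobolev0_iff intro: le_less_trans)
  have "\<exists>\<phi>\<in>test_functions \<Omega>. sob p s (\<lambda>x. pos (u x - c) - \<phi> x) < ennreal e" if "e > 0" for e
  proof -
    have "\<forall>\<^sub>F n in sequentially. sob p s (\<lambda>x. pos (u x - c) - \<psi> n x) < ennreal e"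
      using conv that by (intro order_tendstoD) auto
    then show ?thesis using \<psi>t by (auto simp: eventually_sequentially)
  qed
  then show ?thesis using fin p0 by (auto simp: frac_sobolev0_iff)
qed

end

subsection \<open>The energy form\<close>

lemma powr_superadditive:
  fixes a b q :: real
  assumes "a \<ge> 0" "b \<ge> 0" "q \<ge> 1"
  shows "a powr q + b powr q \<le> (a + b) powr q"
proof -
  have split: "x powr q = x * x powr (q - 1)" if "x \<ge> 0" for x :: real
    using that by (cases "x = 0") (auto simp: powr_diff)
  have "a powr q + b powr q = a * a powr (q - 1) + b * b powr (q - 1)" using assms split by simp
  also have "\<dots> \<le> a * (a + b) powr (q - 1) + b * (a + b) powr (q - 1)"
    using assms by (intro add_mono mult_left_mono powr_mono2) auto
  also have "\<dots> = (a + b) powr q" using assms split[of "a + b"] by (simp add: algebra_simps)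
  finally show ?thesis .
qed

lemma psi_nonneg_eq: "a \<ge> 0 \<Longrightarrow> psi p a = a powr (p - 1)"
proof -
  assume "a \<ge> 0"
  have "a powr (p - 1) = a powr (p - 2) * a powr 1" unfolding powr_add[symmetric] by simp
  then show ?thesis using \<open>a \<ge> 0\<close> by (simp add: psi_def)
qed

lemma psi_minus: "psi p (- a) = - psi p a"
  by (simp add: psi_def)

lemma psi_zero [simp]: "psi p 0 = 0"
  by (simp add: psi_def)

lemma abs_psi: "\<bar>psi p a\<bar> = \<bar>a\<bar> powr (p - 1)"
proof -
  have "\<bar>psi p a\<bar> = psi p \<bar>a\<bar>" by (simp add: psi_def abs_mult)
  then show ?thesis by (simp add: psi_nonneg_eq)
qed

lemma psi_mult_self: "psi p a * a = \<bar>a\<bar> powr p"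
proof -
  have "\<bar>a\<bar> powr p = \<bar>a\<bar> powr (p - 2 + 2)" by simp
  also have "\<dots> = \<bar>a\<bar> powr (p - 2) * \<bar>a\<bar>\<^sup>2" unfolding powr_add by (cases "a = 0") auto
  finally show ?thesis by (simp add: psi_def power2_eq_square)
qed

lemma psi_diff_ge:
  assumes "p \<ge> 2" "b \<le> a"
  shows "((a - b) / 2) powr (p - 1) \<le> psi p a - psi p b"
proof -
  have main: "((a - b) / 2) powr (p - 1) \<le> psi p a - psi p b" if "0 \<le> b" "b \<le> a" for a b
  proof -
    have "((a - b) / 2) powr (p - 1) \<le> (a - b) powr (p - 1)" using that assms by (intro powr_mono2) auto
    also have "\<dots> \<le> a powr (p - 1) - b powr (p - 1)"
      using powr_superadditive[of b "a - b" "p - 1"] that assms by simp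
    finally show ?thesis using that by (simp add: psi_nonneg_eq)
  qed
  consider "0 \<le> b" | "a \<le> 0" | "b < 0" "0 < a" by linarith
  then show ?thesis
  proof cases
    case 1 then show ?thesis using main assms by blast
  next
    case 2
    then show ?thesis using main[of "- a" "- b"] assms by (simp add: psi_minus)
  next
    case 3
    have "((a - b) / 2) powr (p - 1) \<le> (max a (- b)) powr (p - 1)"
      using 3 assms by (intro powr_mono2) auto
    also have "\<dots> \<le> a powr (p - 1) + (- b) powr (p - 1)" by (simp add: max_def)
    also have "\<dots> = psi p a - psi p b" using 3 psi_nonneg_eq[of a p] psi_nonneg_eq[of "- b" p] by (simp add: psi_minus)
    finally show ?thesis .
  qed
qed

lemma psi_mono:
  assumes "p \<ge> 2" "b \<le> a" shows "psi p b \<le> psi p a"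
  using psi_diff_ge[OF assms] by (smt (verit) powr_ge_zero)

lemma psi_diff_mult_nonneg:
  assumes "p \<ge> 2" "b \<le> a \<Longrightarrow> 0 \<le> d" "a \<le> b \<Longrightarrow> d \<le> 0"
  shows "0 \<le> (psi p a - psi p b) * d"
proof (cases "b \<le> a")
  case True
  then show ?thesis using psi_mono[of p b a] assms by (intro mult_nonneg_nonneg) auto
next
  case False
  then show ?thesis using psi_mono[of p a b] assms by (intro mult_nonpos_nonpos) auto
qed

lemma powr_young:
  fixes x y \<theta> p :: real
  assumes "x \<ge> 0" "y \<ge> 0" "\<theta> > 0" "p > 1"
  shows "x powr (p - 1) * y \<le> (1 / \<theta>) * x powr p + \<theta> powr (p - 1) * y powr p"
proof (cases "\<theta> * y \<le> x")
  case True
  then have "y \<le> x / \<theta>" using assms by (simp add: field_simps)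
  then have "x powr (p - 1) * y \<le> x powr (p - 1) * (x / \<theta>)" by (intro mult_left_mono) auto
  also have "\<dots> = (1 / \<theta>) * (x powr (p - 1) * x)" by simp
  also have "x powr (p - 1) * x = x powr p" using assms by (cases "x = 0") (auto simp: powr_diff)
  finally show ?thesis using assms by (smt (verit) mult_nonneg_nonneg powr_ge_zero)
next
  case False
  then have "x powr (p - 1) * y \<le> (\<theta> * y) powr (p - 1) * y"
    using assms by (intro mult_right_mono powr_mono2) auto
  also have "\<dots> = \<theta> powr (p - 1) * (y powr (p - 1) * y)" using assms by (simp add: powr_mult)
  also have "y powr (p - 1) * y = y powr p" using assms by (cases "y = 0") (auto simp: powr_diff)
  finally show ?thesis using assms by (smt (verit) divide_nonneg_pos mult_nonneg_nonneg powr_ge_zero)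
qed

definition form :: "real \<Rightarrow> real \<Rightarrow> ('a::euclidean_space \<Rightarrow> real) \<Rightarrow> ('a \<Rightarrow> real) \<Rightarrow> real" where
  "form p s u v = (LINT z|gmeasure p s. psi p (dif u z) * dif v z)"

lemma form_integrable:
  assumes p: "p > 1" and u: "u \<in> frac_sobolev0 p s \<Omega>" and v: "v \<in> frac_sobolev0 p s \<Omega>"
  shows "integrable (gmeasure p s) (\<lambda>z. psi p (dif u z) * dif v z)"
proof (rule Bochner_Integration.integrable_bound)
  note [measurable] = frac_sobolev0_measurable[OF p u] frac_sobolev0_measurable[OF p v]
  show "integrable (gmeasure p s) (\<lambda>z. \<bar>dif u z\<bar> powr p + \<bar>dif v z\<bar> powr p)"
    using frac_sobolev0_energy(1)[OF p u] frac_sobolev0_energy(1)[OF p v] by (rule Bochner_Integration.integrable_add)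
  show "(\<lambda>z. psi p (dif u z) * dif v z) \<in> borel_measurable (gmeasure p s)" by measurable
  show "AE z in gmeasure p s. norm (psi p (dif u z) * dif v z) \<le> norm (\<bar>dif u z\<bar> powr p + \<bar>dif v z\<bar> powr p)"
    using powr_young[of "\<bar>dif u _\<bar>" "\<bar>dif v _\<bar>" 1 p] p by (auto simp: abs_mult abs_psi)
qed

lemma frac_plaplacian_iff:
  "frac_plaplacian p s \<Omega> u w \<longleftrightarrow> u \<in> frac_sobolev0 p s \<Omega> \<and> w \<in> Lq_space \<Omega> 2 \<and>
     (\<forall>\<phi>\<in>frac_sobolev0 p s \<Omega>. form p s u \<phi> = (LINT x|lebesgue_on \<Omega>. w x * \<phi> x))"
proof -
  have "(LINT (x, y)|(lebesgue \<Otimes>\<^sub>M lebesgue).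
           \<bar>u x - u y\<bar> powr (p - 2) * (u x - u y) * (\<phi> x - \<phi> y)
             / norm (x - y) powr (real DIM('a) + s * p)) = form p s u \<phi>"
    if "u \<in> frac_sobolev0 p s \<Omega>" "\<phi> \<in> frac_sobolev0 p s \<Omega>" for \<phi>
    unfolding form_def by (intro LINT_gmeasure) (use that in \<open>auto simp: frac_sobolev0_def\<close>)
  then show ?thesis unfolding frac_plaplacian_def by (auto simp: case_prod_beta)
qed

lemma frac_plaplacianD:
  assumes "frac_plaplacian p s \<Omega> u w"
  shows "u \<in> frac_sobolev0 p s \<Omega>" "w \<in> Lq_space \<Omega> 2"
    "\<phi> \<in> frac_sobolev0 p s \<Omega> \<Longrightarrow> form p s u \<phi> = (LINT x|lebesgue_on \<Omega>. w x * \<phi> x)"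
  using assms by (auto simp: frac_plaplacian_iff)

definition killing_rate :: "'a::euclidean_space itself \<Rightarrow> real \<Rightarrow> real \<Rightarrow> real \<Rightarrow> real" where
  "killing_rate _ p s r = unit_ball_vol (real DIM('a)) / 2 * r ^ DIM('a) * (1 / r powr (real DIM('a) + s * p))"

lemma killing_rate_pos: "r > 0 \<Longrightarrow> killing_rate TYPE('a::euclidean_space) p s r > 0"
  by (simp add: killing_rate_def)

lemma killing_rate_large:
  assumes "s * p > 0"
  shows "\<exists>r>0. killing_rate TYPE('a::euclidean_space) p s r \<ge> C"
proof -
  define c where "c = unit_ball_vol (real DIM('a)) / 2"
  have c: "c > 0" by (simp add: c_def)
  define r where "r = (max C 1 / c) powr (- 1 / (s * p))"
  have r: "r > 0" using c by (simp add: r_def)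
  have "1 / r powr (real DIM('a) + s * p) = r powr (- (real DIM('a) + s * p))" by (simp only: powr_minus_divide)
  then have "killing_rate TYPE('a) p s r = c * (r powr real DIM('a) * r powr (- (real DIM('a) + s * p)))"
    unfolding killing_rate_def c_def using powr_realpow[OF r, of "DIM('a)"] by (simp only: mult.assoc)
  also have "\<dots> = c * r powr (- (s * p))" by (simp flip: powr_add)
  also have "r powr (- (s * p)) = max C 1 / c"
  proof -
    have "s \<noteq> 0" "p \<noteq> 0" using assms by auto
    then show ?thesis using c by (simp add: r_def powr_powr)
  qed
  also have "c * (max C 1 / c) \<ge> C" using c by simp
  finally show ?thesis using r by auto
qed

text \<open>The set \<open>S\<close> leaves at least half of each ball of radius \<open>r\<close> uncovered.\<close>

lemma nn_integral_kernel_ge: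
  fixes S :: "'a::euclidean_space set"
  assumes [measurable]: "S \<in> sets lebesgue" and "r > 0" and sp: "s * p > 0"
    and S: "emeasure lebesgue S \<le> ennreal (unit_ball_vol (real DIM('a)) / 2 * r ^ DIM('a))"
  shows "ennreal (killing_rate TYPE('a) p s r)
    \<le> (\<integral>\<^sup>+ y. ennreal (1 / norm (x - y) powr (real DIM('a) + s * p)) * indicator (- S) y \<partial>lebesgue)"
proof -
  define c where "c = unit_ball_vol (real DIM('a)) / 2 * r ^ DIM('a)"
  have c: "c \<ge> 0" using \<open>r > 0\<close> by (simp add: c_def)
  define B where "B = ball x r - {x}"
  have [measurable]: "B \<in> sets lebesgue" by (simp add: B_def)
  have "emeasure lebesgue B = emeasure lebesgue (ball x r)"
    unfolding B_def by (intro emeasure_Diff_null_set) auto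
  then have B: "emeasure lebesgue B = ennreal (2 * c)"
    using \<open>r > 0\<close> by (simp add: emeasure_ball c_def)
  have "ennreal (2 * c) \<le> emeasure lebesgue (B - S) + emeasure lebesgue S"
    unfolding B[symmetric] by (rule order_trans[OF emeasure_mono emeasure_subadditive]) auto
  also have "\<dots> \<le> emeasure lebesgue (B - S) + ennreal c" using S by (intro add_left_mono) (simp add: c_def)
  finally have "ennreal c + ennreal c \<le> emeasure lebesgue (B - S) + ennreal c" using c by (simp flip: ennreal_plus)
  then have BS: "ennreal c \<le> emeasure lebesgue (B - S)"
    by (simp add: ennreal_add_left_cancel_le add.commute)
  have "ennreal (killing_rate TYPE('a) p s r) = ennreal (1 / r powr (real DIM('a) + s * p)) * ennreal c"
    using c by (simp add: killing_rate_def c_def mult.commute flip: ennreal_mult')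
  also have "\<dots> \<le> ennreal (1 / r powr (real DIM('a) + s * p)) * emeasure lebesgue (B - S)"
    using BS by (intro mult_left_mono) auto
  also have "\<dots> = (\<integral>\<^sup>+ y. ennreal (1 / r powr (real DIM('a) + s * p)) * indicator (B - S) y \<partial>lebesgue)"
    by (simp add: nn_integral_cmult_indicator)
  also have "\<dots> \<le> (\<integral>\<^sup>+ y. ennreal (1 / norm (x - y) powr (real DIM('a) + s * p)) * indicator (- S) y \<partial>lebesgue)"
  proof (rule nn_integral_mono)
    fix y
    show "ennreal (1 / r powr (real DIM('a) + s * p)) * indicator (B - S) y \<le> ennreal (1 / norm (x - y) powr (real DIM('a) + s * p)) * indicator (- S) y"
    proof (cases "y \<in> B - S")
      case True
      then have "0 < norm (x - y)" "norm (x - y) \<le> r" by (auto simp: B_def dist_norm)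
      then have "norm (x - y) powr (real DIM('a) + s * p) \<le> r powr (real DIM('a) + s * p)"
        using sp by (intro powr_mono2) auto
      then show ?thesis using True \<open>0 < norm (x - y)\<close> by (auto intro!: ennreal_leI divide_left_mono mult_pos_pos simp: indicator_def \<open>r > 0\<close>)
    qed simp
  qed
  finally show ?thesis .
qed

lemma integral_ge_killing:
  fixes S :: "'a::euclidean_space set"
  assumes S[measurable]: "S \<in> sets lebesgue" and "r > 0" "s * p > 0"
    and "emeasure lebesgue S \<le> ennreal (unit_ball_vol (real DIM('a)) / 2 * r ^ DIM('a))"
    and f: "integrable (gmeasure p s) f" "\<And>z. 0 \<le> f z"
    and g[measurable]: "g \<in> borel_measurable lebesgue"
    and le: "AE z in lebesgue \<Otimes>\<^sub>M (lebesgue :: 'a measure). snd z \<notin> S \<longrightarrow> g (fst z) \<le> f z"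
  shows "ennreal (killing_rate TYPE('a) p s r) * (\<integral>\<^sup>+ x. ennreal (g x) \<partial>lebesgue) \<le> ennreal (LINT z|gmeasure p s. f z)"
proof -
  have [measurable]: "(\<lambda>y. norm (x - y)) \<in> borel_measurable lebesgue" for x :: 'a
    using borel_measurable_ident_lebesgue by measurable
  have "ennreal (killing_rate TYPE('a) p s r) * (\<integral>\<^sup>+ x. ennreal (g x) \<partial>lebesgue)
    = (\<integral>\<^sup>+ x. ennreal (killing_rate TYPE('a) p s r) * ennreal (g x) \<partial>lebesgue)"
    by (simp add: nn_integral_cmult)
  also have "\<dots> \<le> (\<integral>\<^sup>+ x. (\<integral>\<^sup>+ y. ennreal (1 / norm (x - y) powr (real DIM('a) + s * p)) * indicator (- S) y \<partial>lebesgue) * ennreal (g x) \<partial>lebesgue)"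
    using assms by (intro nn_integral_mono mult_right_mono nn_integral_kernel_ge) auto
  also have "\<dots> = (\<integral>\<^sup>+ x. (\<integral>\<^sup>+ y. ennreal (1 / norm (x - y) powr (real DIM('a) + s * p)) * (ennreal (g x) * indicator (- S) y) \<partial>lebesgue) \<partial>lebesgue)"
    by (intro nn_integral_cong) (simp add: nn_integral_cmult mult_ac)
  also have "\<dots> = (\<integral>\<^sup>+ z. ennreal (g (fst z)) * indicator (- S) (snd z) \<partial>gmeasure p s)"
    by (subst nn_integral_gmeasure) auto
  also have "\<dots> \<le> (\<integral>\<^sup>+ z. ennreal (f z) \<partial>gmeasure p s)"
    using AE_gmeasure[OF le, of p s]
    by (intro nn_integral_mono_AE, elim eventually_mono) (auto simp: indicator_def intro: ennreal_leI)
  also have "\<dots> = ennreal (LINT z|gmeasure p s. f z)"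
    using f by (intro nn_integral_eq_integral) auto
  finally show ?thesis .
qed

definition L2 :: "'b measure \<Rightarrow> ('b \<Rightarrow> real) \<Rightarrow> bool" where
  "L2 M f \<longleftrightarrow> f \<in> borel_measurable M \<and> integrable M (\<lambda>x. (f x)\<^sup>2)"

definition n2 :: "'b measure \<Rightarrow> ('b \<Rightarrow> real) \<Rightarrow> real" where
  "n2 M f = sqrt (LINT x|M. (f x)\<^sup>2)"

lemma L2_measurable [measurable_dest]: "L2 M f \<Longrightarrow> f \<in> borel_measurable M"
  by (simp add: L2_def)

lemma L2_mult_integrable:
  assumes "L2 M f" "L2 M g"
  shows "integrable M (\<lambda>x. f x * g x)"
proof (rule Bochner_Integration.integrable_bound[where f = "\<lambda>x. (f x)\<^sup>2 + (g x)\<^sup>2"])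
  have "\<bar>a * b\<bar> \<le> a\<^sup>2 + b\<^sup>2" for a b :: real
  proof -
    have "2 * (\<bar>a\<bar> * \<bar>b\<bar>) \<le> a\<^sup>2 + b\<^sup>2" using sum_squares_bound[of "\<bar>a\<bar>" "\<bar>b\<bar>"] by simp
    moreover have "0 \<le> \<bar>a\<bar> * \<bar>b\<bar>" by simp
    ultimately show ?thesis unfolding abs_mult by linarith
  qed
  then show "AE x in M. norm (f x * g x) \<le> norm ((f x)\<^sup>2 + (g x)\<^sup>2)" by simp
qed (use assms in \<open>auto simp: L2_def\<close>)

lemma L2_cmult: "L2 M f \<Longrightarrow> L2 M (\<lambda>x. c * f x)"
  by (auto simp: L2_def power_mult_distrib)

lemma L2_add:
  assumes "L2 M f" "L2 M g"
  shows "L2 M (\<lambda>x. f x + g x)"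
  using assms L2_mult_integrable[OF assms]
  by (auto simp: L2_def power2_sum mult.assoc)

lemma L2_diff: "L2 M f \<Longrightarrow> L2 M g \<Longrightarrow> L2 M (\<lambda>x. f x - g x)"
  using L2_add[OF _ L2_cmult[of M g "-1"], of f] by simp

lemma L2_bound:
  assumes "L2 M g" "f \<in> borel_measurable M" "AE x in M. \<bar>f x\<bar> \<le> \<bar>g x\<bar>"
  shows "L2 M f"
proof -
  have "integrable M (\<lambda>x. (f x)\<^sup>2)"
    by (rule Bochner_Integration.integrable_bound[where f = "\<lambda>x. (g x)\<^sup>2"])
      (use assms in \<open>auto simp: L2_def abs_le_square_iff elim!: eventually_mono\<close>)
  then show ?thesis using assms(2) by (simp add: L2_def)
qed

lemma L2_const: "finite_measure M \<Longrightarrow> L2 M (\<lambda>x. c)"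
  by (simp add: L2_def finite_measure.integrable_const)

lemma L2_integrable:
  assumes "finite_measure M" "L2 M f"
  shows "integrable M f"
  using L2_mult_integrable[OF assms(2) L2_const[OF assms(1), of 1]] by simp

lemma L2_abs: "L2 M f \<Longrightarrow> L2 M (\<lambda>x. \<bar>f x\<bar>)"
  by (auto simp: L2_def)

lemma n2_nonneg [simp]: "0 \<le> n2 M f" by (simp add: n2_def)

lemma n2_sq: "(n2 M f)\<^sup>2 = (LINT x|M. (f x)\<^sup>2)"
  by (simp add: n2_def)

lemma n2_abs [simp]: "n2 M (\<lambda>x. \<bar>f x\<bar>) = n2 M f" by (simp add: n2_def)

lemma n2_cmult: "n2 M (\<lambda>x. c * f x) = \<bar>c\<bar> * n2 M f"
  by (simp add: n2_def power_mult_distrib real_sqrt_mult)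

text \<open>Minimise the nonnegative quadratic \<open>t \<mapsto> \<integral> (f - t g)\<^sup>2\<close>.\<close>

lemma L2_cauchy_schwarz:
  assumes f: "L2 M f" and g: "L2 M g"
  shows "\<bar>LINT x|M. f x * g x\<bar> \<le> n2 M f * n2 M g"
proof -
  define A where "A = (LINT x|M. (f x)\<^sup>2)"
  define B where "B = (LINT x|M. f x * g x)"
  define C where "C = (LINT x|M. (g x)\<^sup>2)"
  note int = L2_mult_integrable[OF f g]
  have fi: "integrable M (\<lambda>x. (f x)\<^sup>2)" and gi: "integrable M (\<lambda>x. (g x)\<^sup>2)" using f g by (auto simp: L2_def)
  have q: "0 \<le> A - 2 * t * B + t\<^sup>2 * C" for t
  proof -
    have "0 \<le> (LINT x|M. (f x - t * g x)\<^sup>2)" by simp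
    also have "\<dots> = (LINT x|M. (f x)\<^sup>2 - 2 * t * (f x * g x) + t\<^sup>2 * (g x)\<^sup>2)"
      by (intro Bochner_Integration.integral_cong) (auto simp: power2_eq_square algebra_simps)
    also have "\<dots> = A - 2 * t * B + t\<^sup>2 * C"
      using int fi gi by (simp add: A_def B_def C_def)
    finally show ?thesis .
  qed
  have "C \<ge> 0" "A \<ge> 0" by (simp_all add: C_def A_def)
  have "B\<^sup>2 \<le> A * C"
  proof (cases "C = 0")
    case True
    have "B = 0"
    proof (rule ccontr)
      assume "B \<noteq> 0"
      then show False using q[of "(A + 1) / (2 * B)"] True by (simp add: field_simps)
    qed
    then show ?thesis using True by simp
  next
    case False
    then have "C > 0" using \<open>C \<ge> 0\<close> by simp
    then show ?thesis using q[of "B / C"] by (simp add: field_simps power2_eq_square)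
  qed
  then have "sqrt (B\<^sup>2) \<le> sqrt (A * C)" by (rule real_sqrt_le_mono)
  then show ?thesis by (simp add: n2_def A_def B_def C_def real_sqrt_mult)
qed

lemma L2_cauchy_schwarz_abs:
  assumes f: "L2 M f" and g: "L2 M g"
  shows "(LINT x|M. \<bar>f x * g x\<bar>) \<le> n2 M f * n2 M g"
  using L2_cauchy_schwarz[OF L2_abs[OF f] L2_abs[OF g]] by (simp add: abs_mult)

lemma n2_triangle:
  assumes f: "L2 M f" and g: "L2 M g"
  shows "n2 M (\<lambda>x. f x + g x) \<le> n2 M f + n2 M g"
proof (rule power2_le_imp_le)
  have fi: "integrable M (\<lambda>x. (f x)\<^sup>2)" and gi: "integrable M (\<lambda>x. (g x)\<^sup>2)" using f g by (auto simp: L2_def)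
  have "(n2 M (\<lambda>x. f x + g x))\<^sup>2 = (n2 M f)\<^sup>2 + (n2 M g)\<^sup>2 + 2 * (LINT x|M. f x * g x)"
    using fi gi L2_mult_integrable[OF f g] by (simp add: n2_sq power2_sum mult.assoc)
  also have "\<dots> \<le> (n2 M f)\<^sup>2 + (n2 M g)\<^sup>2 + 2 * (n2 M f * n2 M g)"
    using L2_cauchy_schwarz[OF f g] by simp
  finally show "(n2 M (\<lambda>x. f x + g x))\<^sup>2 \<le> (n2 M f + n2 M g)\<^sup>2" by (simp add: power2_sum)
qed simp

lemma n2_minus_commute: "n2 M (\<lambda>x. f x - g x) = n2 M (\<lambda>x. g x - f x)"
  by (simp add: n2_def power2_commute)

lemma n2_diff_ge:
  assumes f: "L2 M f" and g: "L2 M g"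
  shows "n2 M f \<le> n2 M g + n2 M (\<lambda>x. f x - g x)"
  using n2_triangle[OF g L2_diff[OF f g]] by simp

lemma n2_mono:
  assumes "L2 M g" "f \<in> borel_measurable M" "AE x in M. \<bar>f x\<bar> \<le> \<bar>g x\<bar>"
  shows "n2 M f \<le> n2 M g"
  unfolding n2_def using assms L2_bound[OF assms]
  by (intro real_sqrt_le_mono integral_mono_AE) (auto simp: L2_def abs_le_square_iff elim!: eventually_mono)

lemma Lq_norm_2:
  assumes "L2 (lebesgue_on \<Omega>) f"
  shows "Lq_norm \<Omega> 2 f = ennreal (n2 (lebesgue_on \<Omega>) f)"
proof -
  have "(\<integral>\<^sup>+ x. ennreal (\<bar>f x\<bar> powr 2) \<partial>lebesgue_on \<Omega>) = (\<integral>\<^sup>+ x. ennreal ((f x)\<^sup>2) \<partial>lebesgue_on \<Omega>)"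
    by simp
  also have "\<dots> = ennreal (LINT x|lebesgue_on \<Omega>. (f x)\<^sup>2)"
    by (rule nn_integral_eq_integral) (use assms in \<open>auto simp: L2_def\<close>)
  finally have "(\<integral>\<^sup>+ x. ennreal (\<bar>f x\<bar> powr 2) \<partial>lebesgue_on \<Omega>) = ennreal (LINT x|lebesgue_on \<Omega>. (f x)\<^sup>2)" .
  then show ?thesis
    by (simp add: Lq_norm_def ennreal_root_def n2_def powr_half_sqrt)
qed

lemma Lq_space_2: "f \<in> Lq_space \<Omega> 2 \<longleftrightarrow> L2 (lebesgue_on \<Omega>) f"
proof
  assume f: "f \<in> Lq_space \<Omega> 2"
  then have "(\<integral>\<^sup>+ x. ennreal ((f x)\<^sup>2) \<partial>lebesgue_on \<Omega>) < \<infinity>"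
    by (auto simp: Lq_space_def Lq_norm_def ennreal_root_def less_top split: if_splits)
  with f show "L2 (lebesgue_on \<Omega>) f"
    by (auto simp: L2_def Lq_space_def intro!: integrableI_bounded)
next
  assume f: "L2 (lebesgue_on \<Omega>) f"
  then show "f \<in> Lq_space \<Omega> 2" by (simp add: Lq_space_def Lq_norm_2 L2_def)
qed

lemma Lq_norm_1: "integrable (lebesgue_on \<Omega>) f \<Longrightarrow> Lq_norm \<Omega> 1 f = ennreal (LINT x|lebesgue_on \<Omega>. \<bar>f x\<bar>)"
  by (simp add: Lq_norm_def ennreal_root_def nn_integral_eq_integral)

lemma Lq_space_1: "f \<in> Lq_space \<Omega> 1 \<longleftrightarrow> integrable (lebesgue_on \<Omega>) f"
proof
  assume f: "f \<in> Lq_space \<Omega> 1"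
  then have "(\<integral>\<^sup>+ x. ennreal \<bar>f x\<bar> \<partial>lebesgue_on \<Omega>) < \<infinity>"
    by (auto simp: Lq_space_def Lq_norm_def ennreal_root_def less_top split: if_splits)
  with f show "integrable (lebesgue_on \<Omega>) f"
    by (auto simp: Lq_space_def intro!: integrableI_bounded)
next
  assume f: "integrable (lebesgue_on \<Omega>) f"
  then show "f \<in> Lq_space \<Omega> 1" by (auto simp: Lq_space_def Lq_norm_1)
qed

subsection \<open>Curves in the space of square integrable functions\<close>

definition l2_curve :: "'b measure \<Rightarrow> (real \<Rightarrow> 'b \<Rightarrow> real) \<Rightarrow> bool" where
  "l2_curve M z \<longleftrightarrow> (\<forall>t>0. L2 M (z t)) \<and>
    (\<forall>a b. 0 < a \<longrightarrow> a \<le> b \<longrightarrow> (\<forall>\<epsilon>>0. \<exists>\<delta>>0. \<forall>n \<alpha> \<beta>. interval_family a b n \<alpha> \<beta> \<longrightarrow>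
       (\<Sum>i<n. \<beta> i - \<alpha> i) < \<delta> \<longrightarrow> (\<Sum>i<n. n2 M (\<lambda>x. z (\<beta> i) x - z (\<alpha> i) x)) < \<epsilon>))"

definition l2_deriv :: "'b measure \<Rightarrow> (real \<Rightarrow> 'b \<Rightarrow> real) \<Rightarrow> ('b \<Rightarrow> real) \<Rightarrow> real \<Rightarrow> bool" where
  "l2_deriv M z g t \<longleftrightarrow> L2 M g \<and> ((\<lambda>h. n2 M (\<lambda>x. (z (t + h) x - z t x) / h - g x)) \<longlongrightarrow> 0) (at 0)"

lemma l2_curve_L2: "l2_curve M z \<Longrightarrow> t > 0 \<Longrightarrow> L2 M (z t)"
  by (simp add: l2_curve_def)

lemma l2_curve_ac: "l2_curve M z \<Longrightarrow> 0 < a \<Longrightarrow> a \<le> b \<Longrightarrow> 0 < \<epsilon> \<Longrightarrow>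
    \<exists>\<delta>>0. \<forall>n \<alpha> \<beta>. interval_family a b n \<alpha> \<beta> \<longrightarrow>
       (\<Sum>i<n. \<beta> i - \<alpha> i) < \<delta> \<longrightarrow> (\<Sum>i<n. n2 M (\<lambda>x. z (\<beta> i) x - z (\<alpha> i) x)) < \<epsilon>"
  unfolding l2_curve_def by simp

lemma interval_familyD: "interval_family a b n \<alpha> \<beta> \<Longrightarrow> i < n \<Longrightarrow> a \<le> \<alpha> i \<and> \<alpha> i \<le> \<beta> i \<and> \<beta> i \<le> b"
  by (simp add: interval_family_def)

lemma abs_cont_of_l2_curve:
  assumes z: "l2_curve M z" and "0 < a" "a \<le> b"
    and le: "\<And>s t. a \<le> s \<Longrightarrow> s \<le> t \<Longrightarrow> t \<le> b \<Longrightarrow> \<bar>g t - g s\<bar> \<le> C * n2 M (\<lambda>x. z t x - z s x)"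
  shows "abs_cont a b g"
proof (rule abs_contI)
  fix \<epsilon> :: real assume "\<epsilon> > 0"
  then have "\<epsilon> / (\<bar>C\<bar> + 1) > 0" by simp
  then obtain \<delta> where \<delta>: "\<delta> > 0" "\<forall>n \<alpha> \<beta>. interval_family a b n \<alpha> \<beta> \<longrightarrow>
       (\<Sum>i<n. \<beta> i - \<alpha> i) < \<delta> \<longrightarrow> (\<Sum>i<n. n2 M (\<lambda>x. z (\<beta> i) x - z (\<alpha> i) x)) < \<epsilon> / (\<bar>C\<bar> + 1)"
    using l2_curve_ac[OF z \<open>0 < a\<close> \<open>a \<le> b\<close>] by blast
  show "\<exists>\<delta>>0. \<forall>n \<alpha> \<beta>. interval_family a b n \<alpha> \<beta> \<longrightarrow> (\<Sum>i<n. \<beta> i - \<alpha> i) < \<delta>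
     \<longrightarrow> (\<Sum>i<n. \<bar>g (\<beta> i) - g (\<alpha> i)\<bar>) < \<epsilon>"
  proof (intro exI[of _ \<delta>] conjI allI impI \<delta>(1))
    fix n \<alpha> \<beta> assume I: "interval_family a b n \<alpha> \<beta>" "(\<Sum>i<n. \<beta> i - \<alpha> i) < \<delta>"
    have "(\<Sum>i<n. \<bar>g (\<beta> i) - g (\<alpha> i)\<bar>) \<le> (\<Sum>i<n. (\<bar>C\<bar> + 1) * n2 M (\<lambda>x. z (\<beta> i) x - z (\<alpha> i) x))"
    proof (rule sum_mono)
      fix i assume "i \<in> {..<n}"
      then have "\<bar>g (\<beta> i) - g (\<alpha> i)\<bar> \<le> C * n2 M (\<lambda>x. z (\<beta> i) x - z (\<alpha> i) x)"
        using interval_familyD[OF I(1), of i] by (intro le) auto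
      also have "\<dots> \<le> (\<bar>C\<bar> + 1) * n2 M (\<lambda>x. z (\<beta> i) x - z (\<alpha> i) x)"
        by (intro mult_right_mono) auto
      finally show "\<bar>g (\<beta> i) - g (\<alpha> i)\<bar> \<le> (\<bar>C\<bar> + 1) * n2 M (\<lambda>x. z (\<beta> i) x - z (\<alpha> i) x)" .
    qed
    also have "\<dots> = (\<bar>C\<bar> + 1) * (\<Sum>i<n. n2 M (\<lambda>x. z (\<beta> i) x - z (\<alpha> i) x))" by (simp add: sum_distrib_left)
    also have "\<dots> < (\<bar>C\<bar> + 1) * (\<epsilon> / (\<bar>C\<bar> + 1))"
      using \<delta>(2) I by (intro mult_strict_left_mono) auto
    finally show "(\<Sum>i<n. \<bar>g (\<beta> i) - g (\<alpha> i)\<bar>) < \<epsilon>" by simp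
  qed
qed

lemma abs_cont_bounded:
  assumes "abs_cont a b g"
  shows "\<exists>C. \<forall>t\<in>{a..b}. \<bar>g t\<bar> \<le> C"
proof -
  have "continuous_on {a..b} g"
    unfolding continuous_on_iff
  proof (intro ballI allI impI)
    fix t e :: real assume t: "t \<in> {a..b}" and "e > 0"
    obtain \<delta> where \<delta>: "\<delta> > 0" "\<forall>n \<alpha> \<beta>. interval_family a b n \<alpha> \<beta> \<longrightarrow>
       (\<Sum>i<n. \<beta> i - \<alpha> i) < \<delta> \<longrightarrow> (\<Sum>i<n. \<bar>g (\<beta> i) - g (\<alpha> i)\<bar>) < e"
      using abs_contD[OF assms \<open>e > 0\<close>] by blast
    have *: "\<bar>g r - g q\<bar> < e" if "q \<in> {a..b}" "r \<in> {a..b}" "q \<le> r" "r - q < \<delta>" for q r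
      using \<delta>(2)[rule_format, of 1 "\<lambda>_. q" "\<lambda>_. r"] that by (auto simp: interval_family_def)
    have "dist (g x) (g t) < e" if "x \<in> {a..b}" "dist x t < \<delta>" for x
      using *[of x t] *[of t x] that t unfolding dist_real_def by linarith
    then show "\<exists>d>0. \<forall>x'\<in>{a..b}. dist x' t < d \<longrightarrow> dist (g x') (g t) < e" using \<delta>(1) by blast
  qed
  then have "bounded (g ` {a..b})" by (intro compact_imp_bounded compact_continuous_image) auto
  then show ?thesis by (auto simp: bounded_iff)
qed

lemma l2_curve_bounded:
  assumes z: "l2_curve M z" and "0 < a" "a \<le> b"
  shows "\<exists>C. \<forall>t\<in>{a..b}. n2 M (z t) \<le> C"
proof -
  have "abs_cont a b (\<lambda>t. n2 M (z t))"
  proof (rule abs_cont_of_l2_curve[OF assms, where C = 1])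
    fix s t assume st: "a \<le> s" "s \<le> t" "t \<le> b"
    then have L: "L2 M (z s)" "L2 M (z t)" using z \<open>0 < a\<close> by (auto intro: l2_curve_L2)
    show "\<bar>n2 M (z t) - n2 M (z s)\<bar> \<le> 1 * n2 M (\<lambda>x. z t x - z s x)"
      using n2_diff_ge[OF L] n2_diff_ge[OF L(2,1)] n2_minus_commute[of M "z s" "z t"] by linarith
  qed
  then show ?thesis using abs_cont_bounded by fastforce
qed

lemma l2_curve_diff:
  assumes z: "l2_curve M z" and y: "l2_curve M y"
  shows "l2_curve M (\<lambda>t x. z t x - y t x)"
  unfolding l2_curve_def
proof (intro conjI allI impI)
  show "L2 M (\<lambda>x. z t x - y t x)" if "t > 0" for t using that assms by (intro L2_diff l2_curve_L2)
  fix a b \<epsilon> :: real assume ab: "0 < a" "a \<le> b" and "\<epsilon> > 0"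
  then have e: "\<epsilon> / 2 > 0" by simp
  obtain d1 where d1: "d1 > 0" "\<forall>n \<alpha> \<beta>. interval_family a b n \<alpha> \<beta> \<longrightarrow>
       (\<Sum>i<n. \<beta> i - \<alpha> i) < d1 \<longrightarrow> (\<Sum>i<n. n2 M (\<lambda>x. z (\<beta> i) x - z (\<alpha> i) x)) < \<epsilon> / 2"
    using l2_curve_ac[OF z ab e] by blast
  obtain d2 where d2: "d2 > 0" "\<forall>n \<alpha> \<beta>. interval_family a b n \<alpha> \<beta> \<longrightarrow>
       (\<Sum>i<n. \<beta> i - \<alpha> i) < d2 \<longrightarrow> (\<Sum>i<n. n2 M (\<lambda>x. y (\<beta> i) x - y (\<alpha> i) x)) < \<epsilon> / 2"
    using l2_curve_ac[OF y ab e] by blast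
  show "\<exists>\<delta>>0. \<forall>n \<alpha> \<beta>. interval_family a b n \<alpha> \<beta> \<longrightarrow> (\<Sum>i<n. \<beta> i - \<alpha> i) < \<delta>
     \<longrightarrow> (\<Sum>i<n. n2 M (\<lambda>x. (z (\<beta> i) x - y (\<beta> i) x) - (z (\<alpha> i) x - y (\<alpha> i) x))) < \<epsilon>"
  proof (intro exI[of _ "min d1 d2"] conjI allI impI)
    fix n \<alpha> \<beta> assume I: "interval_family a b n \<alpha> \<beta>" "(\<Sum>i<n. \<beta> i - \<alpha> i) < min d1 d2"
    have "(\<Sum>i<n. n2 M (\<lambda>x. (z (\<beta> i) x - y (\<beta> i) x) - (z (\<alpha> i) x - y (\<alpha> i) x)))
      \<le> (\<Sum>i<n. n2 M (\<lambda>x. z (\<beta> i) x - z (\<alpha> i) x) + n2 M (\<lambda>x. y (\<beta> i) x - y (\<alpha> i) x))"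
    proof (rule sum_mono)
      fix i assume "i \<in> {..<n}"
      then have "\<alpha> i > 0" "\<beta> i > 0" using interval_familyD[OF I(1), of i] ab by auto
      then have L: "L2 M (\<lambda>x. z (\<beta> i) x - z (\<alpha> i) x)" "L2 M (\<lambda>x. y (\<alpha> i) x - y (\<beta> i) x)"
        using l2_curve_L2[OF z] l2_curve_L2[OF y] by (auto intro!: L2_diff)
      have "n2 M (\<lambda>x. (z (\<beta> i) x - y (\<beta> i) x) - (z (\<alpha> i) x - y (\<alpha> i) x)) =
        n2 M (\<lambda>x. (z (\<beta> i) x - z (\<alpha> i) x) + (y (\<alpha> i) x - y (\<beta> i) x))" by (simp add: algebra_simps)
      also have "\<dots> \<le> n2 M (\<lambda>x. z (\<beta> i) x - z (\<alpha> i) x) + n2 M (\<lambda>x. y (\<alpha> i) x - y (\<beta> i) x)"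
        by (rule n2_triangle[OF L])
      finally show "n2 M (\<lambda>x. (z (\<beta> i) x - y (\<beta> i) x) - (z (\<alpha> i) x - y (\<alpha> i) x))
        \<le> n2 M (\<lambda>x. z (\<beta> i) x - z (\<alpha> i) x) + n2 M (\<lambda>x. y (\<beta> i) x - y (\<alpha> i) x)"
        by (subst (3) n2_minus_commute)
    qed
    also have "\<dots> = (\<Sum>i<n. n2 M (\<lambda>x. z (\<beta> i) x - z (\<alpha> i) x)) + (\<Sum>i<n. n2 M (\<lambda>x. y (\<beta> i) x - y (\<alpha> i) x))"
      by (rule sum.distrib)
    also have "\<dots> < \<epsilon> / 2 + \<epsilon> / 2" using I d1(2) d2(2) by (intro add_strict_mono) auto
    finally show "(\<Sum>i<n. n2 M (\<lambda>x. (z (\<beta> i) x - y (\<beta> i) x) - (z (\<alpha> i) x - y (\<alpha> i) x))) < \<epsilon>" by simp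
  qed (use d1 d2 in auto)
qed

lemma l2_curve_scalar:
  assumes f: "L2 M f" and lip: "\<And>a b. 0 < a \<Longrightarrow> a \<le> b \<Longrightarrow> \<exists>L. \<forall>s\<in>{a..b}. \<forall>t\<in>{a..b}. \<bar>c t - c s\<bar> \<le> L * \<bar>t - s\<bar>"
  shows "l2_curve M (\<lambda>t x. c t * f x)"
  unfolding l2_curve_def
proof (intro conjI allI impI)
  show "L2 M (\<lambda>x. c t * f x)" for t by (rule L2_cmult[OF f])
  fix a b \<epsilon> :: real assume ab: "0 < a" "a \<le> b" and "\<epsilon> > 0"
  obtain L where L: "\<And>s t. s \<in> {a..b} \<Longrightarrow> t \<in> {a..b} \<Longrightarrow> \<bar>c t - c s\<bar> \<le> L * \<bar>t - s\<bar>" using lip[OF ab] by blast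
  define K where "K = (\<bar>L\<bar> + 1) * (n2 M f + 1)"
  have K: "K > 0" by (simp add: K_def add_nonneg_pos)
  show "\<exists>\<delta>>0. \<forall>n \<alpha> \<beta>. interval_family a b n \<alpha> \<beta> \<longrightarrow> (\<Sum>i<n. \<beta> i - \<alpha> i) < \<delta>
     \<longrightarrow> (\<Sum>i<n. n2 M (\<lambda>x. c (\<beta> i) * f x - c (\<alpha> i) * f x)) < \<epsilon>"
  proof (intro exI[of _ "\<epsilon> / K"] conjI allI impI)
    fix n \<alpha> \<beta> assume I: "interval_family a b n \<alpha> \<beta>" "(\<Sum>i<n. \<beta> i - \<alpha> i) < \<epsilon> / K"
    have "(\<Sum>i<n. n2 M (\<lambda>x. c (\<beta> i) * f x - c (\<alpha> i) * f x)) \<le> (\<Sum>i<n. K * (\<beta> i - \<alpha> i))"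
    proof (rule sum_mono)
      fix i assume "i \<in> {..<n}"
      then have i: "a \<le> \<alpha> i" "\<alpha> i \<le> \<beta> i" "\<beta> i \<le> b" using interval_familyD[OF I(1), of i] by auto
      have "n2 M (\<lambda>x. c (\<beta> i) * f x - c (\<alpha> i) * f x) = \<bar>c (\<beta> i) - c (\<alpha> i)\<bar> * n2 M f"
        by (simp add: n2_cmult flip: left_diff_distrib)
      also have "\<dots> \<le> ((\<bar>L\<bar> + 1) * (\<beta> i - \<alpha> i)) * (n2 M f + 1)"
      proof (rule mult_mono)
        have "\<bar>c (\<beta> i) - c (\<alpha> i)\<bar> \<le> L * \<bar>\<beta> i - \<alpha> i\<bar>" using i by (intro L) auto
        also have "\<dots> \<le> (\<bar>L\<bar> + 1) * \<bar>\<beta> i - \<alpha> i\<bar>" by (intro mult_right_mono) auto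
        finally show "\<bar>c (\<beta> i) - c (\<alpha> i)\<bar> \<le> (\<bar>L\<bar> + 1) * (\<beta> i - \<alpha> i)" using i by simp
      qed (use i in auto)
      finally show "n2 M (\<lambda>x. c (\<beta> i) * f x - c (\<alpha> i) * f x) \<le> K * (\<beta> i - \<alpha> i)"
        by (simp add: K_def mult_ac)
    qed
    also have "\<dots> = K * (\<Sum>i<n. \<beta> i - \<alpha> i)" by (simp add: sum_distrib_left)
    also have "\<dots> < \<epsilon>" using I(2) K by (simp add: field_simps)
    finally show "(\<Sum>i<n. n2 M (\<lambda>x. c (\<beta> i) * f x - c (\<alpha> i) * f x)) < \<epsilon>" .
  qed (use K \<open>\<epsilon> > 0\<close> in auto)
qed

lemma eventually_at_0_pos_shift: "t > (0::real) \<Longrightarrow> \<forall>\<^sub>F h in at 0. t + h > 0 \<and> h \<noteq> 0"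
  unfolding eventually_at by (intro exI[of _ t]) (auto simp: dist_real_def)

lemma l2_deriv_diff:
  assumes z: "l2_curve M z" and y: "l2_curve M y" and "t > 0"
    and dz: "l2_deriv M z g t" and dy: "l2_deriv M y k t"
  shows "l2_deriv M (\<lambda>t x. z t x - y t x) (\<lambda>x. g x - k x) t"
  unfolding l2_deriv_def
proof
  show "L2 M (\<lambda>x. g x - k x)" using dz dy by (auto simp: l2_deriv_def intro: L2_diff)
  let ?e = "\<lambda>h. n2 M (\<lambda>x. (z (t + h) x - z t x) / h - g x) + n2 M (\<lambda>x. (y (t + h) x - y t x) / h - k x)"
  have lim: "(?e \<longlongrightarrow> 0) (at 0)"
    using tendsto_add[of _ 0 "at 0" _ 0] dz dy by (auto simp: l2_deriv_def)
  have le: "\<forall>\<^sub>F h in at 0. norm (n2 M (\<lambda>x. ((z (t + h) x - y (t + h) x) - (z t x - y t x)) / h - (g x - k x))) \<le> ?e h"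
    using eventually_at_0_pos_shift[OF \<open>t > 0\<close>]
  proof eventually_elim
    case (elim h)
    have "L2 M g" "L2 M k" using dz dy by (auto simp: l2_deriv_def)
    then have L: "L2 M (\<lambda>x. (1 / h) * (z (t + h) x - z t x) - g x)" "L2 M (\<lambda>x. k x - (1 / h) * (y (t + h) x - y t x))"
      using elim \<open>t > 0\<close> by (intro L2_diff L2_cmult l2_curve_L2[OF z] l2_curve_L2[OF y]; simp)+
    have "n2 M (\<lambda>x. ((z (t + h) x - y (t + h) x) - (z t x - y t x)) / h - (g x - k x))
      = n2 M (\<lambda>x. ((1 / h) * (z (t + h) x - z t x) - g x) + (k x - (1 / h) * (y (t + h) x - y t x)))"
      by (simp add: diff_divide_distrib add_divide_distrib algebra_simps)
    also have "\<dots> \<le> n2 M (\<lambda>x. (1 / h) * (z (t + h) x - z t x) - g x) + n2 M (\<lambda>x. k x - (1 / h) * (y (t + h) x - y t x))"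
      by (rule n2_triangle[OF L])
    also have "n2 M (\<lambda>x. k x - (1 / h) * (y (t + h) x - y t x)) = n2 M (\<lambda>x. (1 / h) * (y (t + h) x - y t x) - k x)"
      by (rule n2_minus_commute)
    finally show ?case by simp
  qed
  show "((\<lambda>h. n2 M (\<lambda>x. ((z (t + h) x - y (t + h) x) - (z t x - y t x)) / h - (g x - k x))) \<longlongrightarrow> 0) (at 0)"
    by (rule Lim_null_comparison[OF le lim])
qed

lemma l2_deriv_scalar:
  assumes f: "L2 M f" and c: "(c has_real_derivative c') (at t)"
  shows "l2_deriv M (\<lambda>t x. c t * f x) (\<lambda>x. c' * f x) t"
  unfolding l2_deriv_def
proof
  show "L2 M (\<lambda>x. c' * f x)" by (rule L2_cmult[OF f])
  have "n2 M (\<lambda>x. (c (t + h) * f x - c t * f x) / h - c' * f x) = \<bar>(c (t + h) - c t) / h - c'\<bar> * n2 M f" for h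
    unfolding n2_cmult[symmetric] by (simp add: algebra_simps diff_divide_distrib)
  moreover have "((\<lambda>h. \<bar>(c (t + h) - c t) / h - c'\<bar> * n2 M f) \<longlongrightarrow> 0 * n2 M f) (at 0)"
    using c by (intro tendsto_mult tendsto_const tendsto_rabs_zero) (simp add: DERIV_def LIM_zero_iff)
  ultimately show "((\<lambda>h. n2 M (\<lambda>x. (c (t + h) * f x - c t * f x) / h - c' * f x)) \<longlongrightarrow> 0) (at 0)" by simp
qed

definition pos_energy :: "'b measure \<Rightarrow> ('b \<Rightarrow> real) \<Rightarrow> real" where
  "pos_energy M f = (LINT x|M. (pos (f x))\<^sup>2 / 2)"

lemma abs_pos_le: "\<bar>pos a\<bar> \<le> \<bar>a\<bar>" by (simp add: pos_def)

lemma pos_le_abs: "pos a \<le> \<bar>a\<bar>" by (simp add: pos_def)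

lemma L2_pos: "L2 M f \<Longrightarrow> L2 M (\<lambda>x. pos (f x))"
  by (rule L2_bound[of M f]) (auto simp: pos_le_abs)

lemma pos_energy_integrable: "L2 M f \<Longrightarrow> integrable M (\<lambda>x. (pos (f x))\<^sup>2 / 2)"
  using L2_pos[of M f] by (simp add: L2_def)

lemma pos_energy_nonneg: "0 \<le> pos_energy M f"
  by (simp add: pos_energy_def)

lemma half_pos_sq_lipschitz: "\<bar>(pos a)\<^sup>2 / 2 - (pos b)\<^sup>2 / 2\<bar> \<le> \<bar>a - b\<bar> * (\<bar>a\<bar> + \<bar>b\<bar>) / 2"
proof -
  have "\<bar>(pos a)\<^sup>2 - (pos b)\<^sup>2\<bar> = \<bar>pos a - pos b\<bar> * (pos a + pos b)"
    by (simp add: power2_eq_square square_diff_square_factored abs_mult mult.commute)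
  also have "\<dots> \<le> \<bar>a - b\<bar> * (\<bar>a\<bar> + \<bar>b\<bar>)"
    using pos_lipschitz[of a b] abs_pos_le[of a] abs_pos_le[of b] by (intro mult_mono) auto
  finally show ?thesis by (simp add: diff_divide_distrib[symmetric])
qed

lemma half_pos_sq_taylor: "\<bar>(pos b)\<^sup>2 / 2 - (pos a)\<^sup>2 / 2 - pos a * (b - a)\<bar> \<le> (b - a)\<^sup>2 / 2"
proof -
  have "0 \<le> (pos b)\<^sup>2 / 2 - (pos a)\<^sup>2 / 2 - pos a * (b - a)"
  proof -
    have "(pos b)\<^sup>2 / 2 - (pos a)\<^sup>2 / 2 - pos a * (b - a) = (pos b - pos a)\<^sup>2 / 2 + pos a * (pos b - b)
      + pos a * (a - pos a)" by (simp add: power2_eq_square algebra_simps diff_divide_distrib add_divide_distrib)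
    moreover have "pos a * (a - pos a) = 0" "pos b - b \<ge> 0" by (auto simp: pos_def max_def)
    ultimately show ?thesis by simp
  qed
  moreover have "(pos b)\<^sup>2 / 2 - (pos a)\<^sup>2 / 2 - pos a * (b - a) \<le> (b - a)\<^sup>2 / 2"
  proof (cases "a \<le> 0")
    case True
    then show ?thesis by (cases "b \<le> 0") (auto simp: pos_def max_def power2_eq_square intro!: mult_mono)
  next
    case False
    then show ?thesis
      by (cases "b \<le> 0") (auto simp: pos_def max_def power2_eq_square algebra_simps diff_divide_distrib add_divide_distrib)
  qed
  ultimately show ?thesis by linarith
qed

lemma pos_energy_abs_cont:
  assumes z: "l2_curve M z" and "0 < a" "a \<le> b"
  shows "abs_cont a b (\<lambda>t. pos_energy M (z t))"
proof -
  obtain C where C: "\<And>t. t \<in> {a..b} \<Longrightarrow> n2 M (z t) \<le> C" using l2_curve_bounded[OF assms] by blast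
  show ?thesis
  proof (rule abs_cont_of_l2_curve[OF assms, where C = C])
    fix s t assume st: "a \<le> s" "s \<le> t" "t \<le> b"
    then have L: "L2 M (z s)" "L2 M (z t)" using z \<open>0 < a\<close> by (auto intro: l2_curve_L2)
    have D: "L2 M (\<lambda>x. z t x - z s x)" and S: "L2 M (\<lambda>x. \<bar>z t x\<bar> + \<bar>z s x\<bar>)"
      using L by (auto intro!: L2_diff L2_add L2_abs)
    have int: "integrable M (\<lambda>x. \<bar>(z t x - z s x) * (\<bar>z t x\<bar> + \<bar>z s x\<bar>)\<bar> / 2)"
      using L2_mult_integrable[OF D S] by (intro integrable_divide integrable_abs)
    have "\<bar>pos_energy M (z t) - pos_energy M (z s)\<bar> = \<bar>LINT x|M. (pos (z t x))\<^sup>2 / 2 - (pos (z s x))\<^sup>2 / 2\<bar>"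
      unfolding pos_energy_def using L by (subst Bochner_Integration.integral_diff) (auto intro: pos_energy_integrable)
    also have "\<dots> \<le> (LINT x|M. \<bar>(pos (z t x))\<^sup>2 / 2 - (pos (z s x))\<^sup>2 / 2\<bar>)"
      by (rule integral_abs_bound)
    also have "\<dots> \<le> (LINT x|M. \<bar>(z t x - z s x) * (\<bar>z t x\<bar> + \<bar>z s x\<bar>)\<bar> / 2)"
    proof (rule integral_mono)
      show "integrable M (\<lambda>x. \<bar>(pos (z t x))\<^sup>2 / 2 - (pos (z s x))\<^sup>2 / 2\<bar>)"
        using L by (intro integrable_abs Bochner_Integration.integrable_diff pos_energy_integrable)
      show "\<bar>(pos (z t x))\<^sup>2 / 2 - (pos (z s x))\<^sup>2 / 2\<bar> \<le> \<bar>(z t x - z s x) * (\<bar>z t x\<bar> + \<bar>z s x\<bar>)\<bar> / 2" for x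
        using half_pos_sq_lipschitz[of "z t x" "z s x"] unfolding abs_mult by simp
    qed (rule int)
    also have "\<dots> \<le> n2 M (\<lambda>x. z t x - z s x) * n2 M (\<lambda>x. \<bar>z t x\<bar> + \<bar>z s x\<bar>) / 2"
      using L2_cauchy_schwarz_abs[OF D S] by simp
    also have "\<dots> \<le> n2 M (\<lambda>x. z t x - z s x) * (C + C) / 2"
    proof -
      have "n2 M (\<lambda>x. \<bar>z t x\<bar> + \<bar>z s x\<bar>) \<le> C + C"
        using n2_triangle[OF L2_abs[OF L(2)] L2_abs[OF L(1)]] C[of s] C[of t] st by simp
      then show ?thesis by (intro divide_right_mono mult_left_mono) auto
    qed
    finally show "\<bar>pos_energy M (z t) - pos_energy M (z s)\<bar> \<le> C * n2 M (\<lambda>x. z t x - z s x)" by (simp add: mult.commute)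
  qed
qed

lemma pos_energy_deriv:
  assumes z: "l2_curve M z" and "t > 0" and d: "l2_deriv M z g t"
  shows "((\<lambda>t. pos_energy M (z t)) has_real_derivative (LINT x|M. pos (z t x) * g x)) (at t)"
proof -
  have g: "L2 M g" and zt: "L2 M (z t)" and P: "L2 M (\<lambda>x. pos (z t x))"
    using d z \<open>t > 0\<close> by (auto simp: l2_deriv_def intro: l2_curve_L2 L2_pos)
  define e where "e h = n2 M (\<lambda>x. (z (t + h) x - z t x) / h - g x)" for h
  have e: "(e \<longlongrightarrow> 0) (at 0)" using d unfolding e_def l2_deriv_def by simp
  let ?E = "\<lambda>h. n2 M (\<lambda>x. pos (z t x)) * e h + \<bar>h\<bar> / 2 * (e h + n2 M g)\<^sup>2"
  have lim: "(?E \<longlongrightarrow> n2 M (\<lambda>x. pos (z t x)) * 0 + \<bar>0\<bar> / 2 * (0 + n2 M g)\<^sup>2) (at 0)"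
    by (intro tendsto_intros e) simp
  then have lim: "(?E \<longlongrightarrow> 0) (at 0)" by simp
  have le: "\<forall>\<^sub>F h in at 0. norm ((pos_energy M (z (t + h)) - pos_energy M (z t)) / h - (LINT x|M. pos (z t x) * g x)) \<le> ?E h"
    using eventually_at_0_pos_shift[OF \<open>t > 0\<close>]
  proof eventually_elim
    case (elim h)
    then have h: "h \<noteq> 0" and zh: "L2 M (z (t + h))" using z by (auto intro: l2_curve_L2)
    define q where "q x = (1 / h) * (z (t + h) x - z t x)" for x
    have q: "L2 M q" unfolding q_def by (intro L2_cmult L2_diff zh zt)
    have zq: "z (t + h) x - z t x = h * q x" for x using h by (simp add: q_def)
    have eh: "e h = n2 M (\<lambda>x. q x - g x)" by (simp add: e_def q_def)
    have nq: "n2 M q \<le> e h + n2 M g" using n2_diff_ge[OF q g] eh by simp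
    let ?R = "\<lambda>x. (pos (z (t + h) x))\<^sup>2 / 2 - (pos (z t x))\<^sup>2 / 2 - pos (z t x) * (z (t + h) x - z t x)"
    have iD: "integrable M (\<lambda>x. pos (z t x) * (z (t + h) x - z t x))"
      by (intro L2_mult_integrable P L2_diff zh zt)
    have iR: "integrable M ?R"
      by (intro Bochner_Integration.integrable_diff pos_energy_integrable zh zt iD)
    have R: "\<bar>LINT x|M. ?R x\<bar> \<le> h\<^sup>2 / 2 * (n2 M q)\<^sup>2"
    proof -
      have "\<bar>LINT x|M. ?R x\<bar> \<le> (LINT x|M. \<bar>?R x\<bar>)" by (rule integral_abs_bound)
      also have "\<dots> \<le> (LINT x|M. h\<^sup>2 / 2 * (q x)\<^sup>2)"
      proof (rule integral_mono[OF integrable_abs[OF iR]])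
        show "integrable M (\<lambda>x. h\<^sup>2 / 2 * (q x)\<^sup>2)" using q by (simp add: L2_def)
        show "\<bar>?R x\<bar> \<le> h\<^sup>2 / 2 * (q x)\<^sup>2" for x
          using half_pos_sq_taylor[of "z (t + h) x" "z t x"] by (simp add: zq power_mult_distrib)
      qed
      also have "\<dots> = h\<^sup>2 / 2 * (n2 M q)\<^sup>2" by (simp add: n2_sq)
      finally show ?thesis .
    qed
    have split: "pos_energy M (z (t + h)) - pos_energy M (z t) = (LINT x|M. ?R x) + h * (LINT x|M. pos (z t x) * q x)"
    proof -
      have "(LINT x|M. ?R x) = pos_energy M (z (t + h)) - pos_energy M (z t) - (LINT x|M. pos (z t x) * (z (t + h) x - z t x))"
        unfolding pos_energy_def using iD zh zt by (simp add: pos_energy_integrable)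
      also have "(LINT x|M. pos (z t x) * (z (t + h) x - z t x)) = (LINT x|M. h * (pos (z t x) * q x))"
        by (simp add: zq mult.left_commute)
      finally show ?thesis by simp
    qed
    have "(pos_energy M (z (t + h)) - pos_energy M (z t)) / h - (LINT x|M. pos (z t x) * g x)
      = (LINT x|M. ?R x) / h + ((LINT x|M. pos (z t x) * q x) - (LINT x|M. pos (z t x) * g x))"
      unfolding split using h by (simp add: add_divide_distrib)
    also have "(LINT x|M. pos (z t x) * q x) - (LINT x|M. pos (z t x) * g x) = (LINT x|M. pos (z t x) * (q x - g x))"
      using L2_mult_integrable[OF P q] L2_mult_integrable[OF P g] by (simp add: right_diff_distrib)
    finally have eq: "(pos_energy M (z (t + h)) - pos_energy M (z t)) / h - (LINT x|M. pos (z t x) * g x)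
      = (LINT x|M. ?R x) / h + (LINT x|M. pos (z t x) * (q x - g x))" .
    have "\<bar>LINT x|M. pos (z t x) * (q x - g x)\<bar> \<le> n2 M (\<lambda>x. pos (z t x)) * e h"
      unfolding eh by (intro L2_cauchy_schwarz P L2_diff q g)
    moreover have "\<bar>(LINT x|M. ?R x) / h\<bar> \<le> \<bar>h\<bar> / 2 * (e h + n2 M g)\<^sup>2"
    proof -
      have "\<bar>(LINT x|M. ?R x) / h\<bar> \<le> (h\<^sup>2 / 2 * (n2 M q)\<^sup>2) / \<bar>h\<bar>"
        unfolding abs_divide using R by (intro divide_right_mono) auto
      also have "\<dots> = \<bar>h\<bar> / 2 * (n2 M q)\<^sup>2"
        using h by (cases "h > 0") (auto simp: power2_eq_square)
      also have "\<dots> \<le> \<bar>h\<bar> / 2 * (e h + n2 M g)\<^sup>2"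
        using nq by (intro mult_left_mono power_mono) auto
      finally show ?thesis .
    qed
    ultimately show ?case unfolding eq real_norm_def by linarith
  qed
  have "((\<lambda>h. (pos_energy M (z (t + h)) - pos_energy M (z t)) / h - (LINT x|M. pos (z t x) * g x)) \<longlongrightarrow> 0) (at 0)"
    by (rule Lim_null_comparison[OF le lim])
  then show ?thesis by (simp add: DERIV_def LIM_zero_iff)
qed

subsection \<open>Strong solutions and contraction in the mean\<close>

lemma l2_curve_minus_const:
  assumes "l2_curve M z" "L2 M f"
  shows "l2_curve M (\<lambda>t x. z t x - f x)"
proof -
  have "l2_curve M (\<lambda>t x. 1 * f x)"
    by (rule l2_curve_scalar[OF assms(2)]) (auto intro: exI[of _ 0])
  from l2_curve_diff[OF assms(1) this] show ?thesis by simp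
qed

lemma l2_deriv_minus_const:
  assumes "l2_deriv M z g t"
  shows "l2_deriv M (\<lambda>t x. z t x - f x) g t"
  using assms by (simp add: l2_deriv_def)

lemma psi_mult: "psi p (a * b) = psi p a * psi p b"
  by (simp add: psi_def abs_mult powr_mult)

lemma dif_cmult: "dif (\<lambda>x. c * u x) z = c * dif u z"
  by (simp add: dif_def algebra_simps)
lemma frac_plaplacian_cmult:
  assumes p: "p > 1" and L: "frac_plaplacian p s \<Omega> u w"
  shows "frac_plaplacian p s \<Omega> (\<lambda>x. c * u x) (\<lambda>x. psi p c * w x)"
  unfolding frac_plaplacian_iff
proof (intro conjI ballI)
  show "(\<lambda>x. c * u x) \<in> frac_sobolev0 p s \<Omega>"
    by (rule frac_sobolev0_cmult[OF p frac_plaplacianD(1)[OF L]])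
  show "(\<lambda>x. psi p c * w x) \<in> Lq_space \<Omega> 2"
    using frac_plaplacianD(2)[OF L] by (simp add: Lq_space_2 L2_cmult)
  fix \<phi> assume \<phi>: "\<phi> \<in> frac_sobolev0 p s \<Omega>"
  show "form p s (\<lambda>x. c * u x) \<phi> = (LINT x|lebesgue_on \<Omega>. psi p c * w x * \<phi> x)"
    using frac_plaplacianD(3)[OF L \<phi>] by (simp add: form_def dif_cmult psi_mult mult.assoc)
qed

lemma form_mono:
  assumes p: "p \<ge> 2" and W: "u \<in> frac_sobolev0 p s \<Omega>" "v \<in> frac_sobolev0 p s \<Omega>" "\<phi> \<in> frac_sobolev0 p s \<Omega>"
    and "\<And>z. dif v z \<le> dif u z \<Longrightarrow> 0 \<le> dif \<phi> z" "\<And>z. dif u z \<le> dif v z \<Longrightarrow> dif \<phi> z \<le> 0"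
  shows "form p s v \<phi> \<le> form p s u \<phi>"
  unfolding form_def
proof (rule integral_mono)
  have p1: "p > 1" using p by simp
  show "integrable (gmeasure p s) (\<lambda>z. psi p (dif v z) * dif \<phi> z)" "integrable (gmeasure p s) (\<lambda>z. psi p (dif u z) * dif \<phi> z)"
    by (rule form_integrable[OF p1 W(2,3)] form_integrable[OF p1 W(1,3)])+
  show "psi p (dif v z) * dif \<phi> z \<le> psi p (dif u z) * dif \<phi> z" for z
    using psi_diff_mult_nonneg[OF p, of "dif v z" "dif u z" "dif \<phi> z"] assms(5,6)[of z] by (simp add: left_diff_distrib)
qed

locale dirichlet_problem =
  fixes p s :: real and \<Omega> :: "'a::euclidean_space set"
  assumes p: "2 < p" and s: "0 < s" and open_dom: "open \<Omega>" and bounded_dom: "bounded \<Omega>"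
begin

abbreviation M :: "'a measure" where "M \<equiv> lebesgue_on \<Omega>"
abbreviation W0 :: "('a \<Rightarrow> real) set" where "W0 \<equiv> frac_sobolev0 p s \<Omega>"
abbreviation \<gamma> :: real where "\<gamma> \<equiv> 1 / (p - 2)"

lemma p1: "p > 1" and p2: "p \<ge> 2" and p0: "p > 0" and sp: "s * p > 0"
  using p s by auto

lemma dom_lmeasurable: "\<Omega> \<in> lmeasurable"
  using open_dom bounded_dom by (simp add: bounded_set_imp_lmeasurable)

lemma dom_sets [measurable]: "\<Omega> \<in> sets lebesgue"
  using dom_lmeasurable by (rule fmeasurableD)

lemma finite_measure_M: "finite_measure M"
  using dom_lmeasurable
  by (intro finite_measureI) (simp add: emeasure_restrict_space fmeasurable_def del: emeasure_completion)

sublocale finM: finite_measure M by (rule finite_measure_M)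

definition vol :: real where "vol = measure lebesgue \<Omega>"

lemma vol_nonneg: "vol \<ge> 0" by (simp add: vol_def)

lemma integral_const_M: "(LINT x|M. c) = c * vol"
  by (simp add: vol_def measure_restrict_space mult.commute)

lemma AE_M_iff: "(AE x in M. P x) \<longleftrightarrow> (AE x in lebesgue. x \<in> \<Omega> \<longrightarrow> P x)"
  by (simp add: AE_restrict_space_iff)

lemma L1_le_n2:
  assumes "L2 M f" shows "(LINT x|M. \<bar>f x\<bar>) \<le> n2 M f * sqrt vol"
  using L2_cauchy_schwarz_abs[OF assms L2_const[OF finite_measure_M, of 1]]
  by (simp add: n2_def vol_def measure_restrict_space)

lemma W0_zero: "u \<in> W0 \<Longrightarrow> AE x in lebesgue. x \<notin> \<Omega> \<longrightarrow> u x = 0"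
  by (rule frac_sobolev0_AE_zero[OF p1]) auto

lemma W0_measurable_M: "u \<in> W0 \<Longrightarrow> u \<in> borel_measurable M"
  using frac_sobolev0_measurable[OF p1] by (auto intro: measurable_restrict_space1)

definition strong_curve :: "(real \<Rightarrow> 'a \<Rightarrow> real) \<Rightarrow> bool" where
  "strong_curve v \<longleftrightarrow> l2_curve M v \<and>
    (\<exists>N. negligible N \<and> (\<forall>t>0. t \<notin> N \<longrightarrow> (\<exists>w. frac_plaplacian p s \<Omega> (v t) w \<and> l2_deriv M v (\<lambda>x. - w x) t)))"

definition initial :: "(real \<Rightarrow> 'a \<Rightarrow> real) \<Rightarrow> ('a \<Rightarrow> real) \<Rightarrow> bool" where
  "initial v v0 \<longleftrightarrow> L2 M v0 \<and> ((\<lambda>t. n2 M (\<lambda>x. v t x - v0 x)) \<longlongrightarrow> 0) (at_right 0)"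

lemma strong_curve_L2: "strong_curve v \<Longrightarrow> t > 0 \<Longrightarrow> L2 M (v t)"
  by (auto simp: strong_curve_def intro: l2_curve_L2)

lemma strong_solution_imp:
  assumes v: "strong_solution p s \<Omega> v0 v"
  shows "strong_curve v" "initial v v0"
proof -
  have L: "L2 M (v t)" if "t \<ge> 0" for t using v that by (simp add: strong_solution_def Lq_space_2)
  have L0: "L2 M v0" using v by (simp add: strong_solution_def Lq_space_2)
  have D: "Lq_norm \<Omega> 2 (\<lambda>x. v t x - v r x) = ennreal (n2 M (\<lambda>x. v t x - v r x))" if "t \<ge> 0" "r \<ge> 0" for t r
    using that by (intro Lq_norm_2 L2_diff L)
  have ac: "locally_AC_L2 \<Omega> v" using v by (simp add: strong_solution_def)
  have curve: "l2_curve M v"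
    unfolding l2_curve_def
  proof (intro conjI allI impI)
    show "L2 M (v t)" if "t > 0" for t using L that by simp
    fix a b \<epsilon> :: real assume ab: "0 < a" "a \<le> b" and e: "\<epsilon> > 0"
    have "\<forall>\<epsilon>>0. \<exists>\<delta>>0. \<forall>n (\<alpha> :: nat \<Rightarrow> real) \<beta>.
        (\<forall>i<n. a \<le> \<alpha> i \<and> \<alpha> i \<le> \<beta> i \<and> \<beta> i \<le> b) \<and>
        (\<forall>i<n. \<forall>j<n. i \<noteq> j \<longrightarrow> {\<alpha> i<..<\<beta> i} \<inter> {\<alpha> j<..<\<beta> j} = {}) \<and>
        (\<Sum>i<n. \<beta> i - \<alpha> i) < \<delta>
        \<longrightarrow> (\<Sum>i<n. Lq_norm \<Omega> 2 (\<lambda>x. v (\<beta> i) x - v (\<alpha> i) x)) < \<epsilon>"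
      using ac ab unfolding locally_AC_L2_def by blast
    moreover have "ennreal \<epsilon> > 0" using e by simp
    ultimately obtain \<delta> where \<delta>: "\<delta> > 0" "\<forall>n (\<alpha> :: nat \<Rightarrow> real) \<beta>.
        (\<forall>i<n. a \<le> \<alpha> i \<and> \<alpha> i \<le> \<beta> i \<and> \<beta> i \<le> b) \<and>
        (\<forall>i<n. \<forall>j<n. i \<noteq> j \<longrightarrow> {\<alpha> i<..<\<beta> i} \<inter> {\<alpha> j<..<\<beta> j} = {}) \<and>
        (\<Sum>i<n. \<beta> i - \<alpha> i) < \<delta>
        \<longrightarrow> (\<Sum>i<n. Lq_norm \<Omega> 2 (\<lambda>x. v (\<beta> i) x - v (\<alpha> i) x)) < ennreal \<epsilon>" by blast
    show "\<exists>\<delta>>0. \<forall>n \<alpha> \<beta>. interval_family a b n \<alpha> \<beta> \<longrightarrow>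
       (\<Sum>i<n. \<beta> i - \<alpha> i) < \<delta> \<longrightarrow> (\<Sum>i<n. n2 M (\<lambda>x. v (\<beta> i) x - v (\<alpha> i) x)) < \<epsilon>"
    proof (intro exI[of _ \<delta>] conjI allI impI \<delta>(1))
      fix n \<alpha> \<beta> assume I: "interval_family a b n \<alpha> \<beta>" "(\<Sum>i<n. \<beta> i - \<alpha> i) < \<delta>"
      then have "(\<Sum>i<n. Lq_norm \<Omega> 2 (\<lambda>x. v (\<beta> i) x - v (\<alpha> i) x)) < ennreal \<epsilon>"
        using \<delta>(2) unfolding interval_family_def by blast
      also have "(\<Sum>i<n. Lq_norm \<Omega> 2 (\<lambda>x. v (\<beta> i) x - v (\<alpha> i) x)) = (\<Sum>i<n. ennreal (n2 M (\<lambda>x. v (\<beta> i) x - v (\<alpha> i) x)))"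
      proof (intro sum.cong refl D)
        fix i assume "i \<in> {..<n}"
        then show "0 \<le> \<beta> i" "0 \<le> \<alpha> i" using interval_familyD[OF I(1), of i] ab by auto
      qed
      also have "\<dots> = ennreal (\<Sum>i<n. n2 M (\<lambda>x. v (\<beta> i) x - v (\<alpha> i) x))" by (simp add: sum_ennreal)
      finally show "(\<Sum>i<n. n2 M (\<lambda>x. v (\<beta> i) x - v (\<alpha> i) x)) < \<epsilon>"
        by (simp add: ennreal_less_iff sum_nonneg)
    qed
  qed
  have der: "l2_deriv M v g t" if "t > 0" "has_L2_derivative \<Omega> v g t" for g t
    unfolding l2_deriv_def
  proof
    show g: "L2 M g" using that by (simp add: has_L2_derivative_def Lq_space_2)
    have lim: "((\<lambda>h. Lq_norm \<Omega> 2 (\<lambda>x. (v (t + h) x - v t x) / h - g x)) \<longlongrightarrow> ennreal 0) (at 0)"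
      using that by (simp add: has_L2_derivative_def)
    have "\<forall>\<^sub>F h in at 0. Lq_norm \<Omega> 2 (\<lambda>x. (v (t + h) x - v t x) / h - g x) = ennreal (n2 M (\<lambda>x. (v (t + h) x - v t x) / h - g x))"
      using eventually_at_0_pos_shift[OF \<open>t > 0\<close>]
    proof eventually_elim
      case (elim h)
      have "L2 M (\<lambda>x. (1 / h) * (v (t + h) x - v t x) - g x)"
        using elim \<open>t > 0\<close> by (intro L2_diff L2_cmult L g) auto
      then show ?case by (intro Lq_norm_2) simp
    qed
    then have "((\<lambda>h. ennreal (n2 M (\<lambda>x. (v (t + h) x - v t x) / h - g x))) \<longlongrightarrow> ennreal 0) (at 0)"
      using lim by (rule Lim_transform_eventually[rotated])
    then show "((\<lambda>h. n2 M (\<lambda>x. (v (t + h) x - v t x) / h - g x)) \<longlongrightarrow> 0) (at 0)"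
      by (subst (asm) tendsto_ennreal_iff) auto
  qed
  have "AE t in lebesgue_on {0<..}. \<exists>w. frac_plaplacian p s \<Omega> (v t) w \<and> has_L2_derivative \<Omega> v (\<lambda>x. - w x) t"
    using v by (simp add: strong_solution_def)
  then have "AE t in lebesgue. t \<in> {0<..} \<longrightarrow> (\<exists>w. frac_plaplacian p s \<Omega> (v t) w \<and> has_L2_derivative \<Omega> v (\<lambda>x. - w x) t)"
    by (simp add: AE_restrict_space_iff)
  then obtain N where N: "N \<in> null_sets lebesgue"
    "\<And>t. t \<notin> N \<Longrightarrow> t > 0 \<Longrightarrow> \<exists>w. frac_plaplacian p s \<Omega> (v t) w \<and> has_L2_derivative \<Omega> v (\<lambda>x. - w x) t"
    by (auto simp: eventually_ae_filter) blast
  show "strong_curve v"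
    unfolding strong_curve_def
    using curve N der by (intro conjI exI[of _ N]) (auto simp: negligible_iff_null_sets, blast)
  show "initial v v0"
    unfolding initial_def
  proof (intro conjI L0)
    have "((\<lambda>\<tau>. Lq_norm \<Omega> 2 (\<lambda>x. v \<tau> x - v 0 x)) \<longlongrightarrow> 0) (at 0 within {0..})"
      using v by (simp add: strong_solution_def)
    then have lim: "((\<lambda>\<tau>. Lq_norm \<Omega> 2 (\<lambda>x. v \<tau> x - v 0 x)) \<longlongrightarrow> ennreal 0) (at_right 0)"
      by (auto intro: tendsto_within_subset)
    have ae: "AE x in M. v 0 x = v0 x" using v by (simp add: strong_solution_def)
    have "n2 M (\<lambda>x. v t x - v 0 x) = n2 M (\<lambda>x. v t x - v0 x)" if "t > 0" for t
    proof (rule antisym; rule n2_mono)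
      show "AE x in M. \<bar>v t x - v 0 x\<bar> \<le> \<bar>v t x - v0 x\<bar>" "AE x in M. \<bar>v t x - v0 x\<bar> \<le> \<bar>v t x - v 0 x\<bar>"
        using ae by (eventually_elim, simp)+
    qed (use that L L0 in \<open>auto intro!: L2_diff L2_measurable[OF L2_diff]\<close>)
    then have "\<forall>\<^sub>F t in at_right 0. Lq_norm \<Omega> 2 (\<lambda>x. v t x - v 0 x) = ennreal (n2 M (\<lambda>x. v t x - v0 x))"
      using D by (auto simp: eventually_at_right_field intro!: exI[of _ 1])
    then have "((\<lambda>t. ennreal (n2 M (\<lambda>x. v t x - v0 x))) \<longlongrightarrow> ennreal 0) (at_right 0)"
      using lim by (rule Lim_transform_eventually[rotated])
    then show "((\<lambda>t. n2 M (\<lambda>x. v t x - v0 x)) \<longlongrightarrow> 0) (at_right 0)"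
      by (subst (asm) tendsto_ennreal_iff) auto
  qed
qed

lemma integrable_pos: "L2 M f \<Longrightarrow> integrable M (\<lambda>x. pos (f x))"
  by (rule L2_integrable[OF finite_measure_M L2_pos])

text \<open>The convex function \<open>(pos(a)\<^sup>2 - pos(a - \<delta>)\<^sup>2) / (2 \<delta>)\<close> approximates \<open>pos a\<close>, and its
  derivative maps differences of solutions to admissible test functions.\<close>

lemma contraction_pos:
  assumes v: "strong_curve v" and w: "strong_curve w" and t: "0 < t1" "t1 \<le> t2"
  shows "(LINT x|M. pos (v t2 x - w t2 x)) \<le> (LINT x|M. pos (v t1 x - w t1 x))"
proof -
  define z where "z = (\<lambda>t x. v t x - w t x)"
  have cv: "l2_curve M v" and cw: "l2_curve M w" using v w by (auto simp: strong_curve_def)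
  then have cz: "l2_curve M z" unfolding z_def by (rule l2_curve_diff)
  have zL: "L2 M (z t)" if "t > 0" for t using cz that by (rule l2_curve_L2)
  have main: "(LINT x|M. pos (z t2 x)) \<le> (LINT x|M. pos (z t1 x)) + \<delta> * vol" if \<delta>: "\<delta> > 0" for \<delta>
  proof -
    have cd: "l2_curve M (\<lambda>t x. z t x - \<delta>)"
      by (rule l2_curve_minus_const[OF cz L2_const[OF finite_measure_M]])
    define G where "G t = pos_energy M (z t) + (- 1) * pos_energy M (\<lambda>x. z t x - \<delta>)" for t
    obtain N1 N2 where N: "negligible N1" "negligible N2"
      "\<And>t. t > 0 \<Longrightarrow> t \<notin> N1 \<Longrightarrow> \<exists>f. frac_plaplacian p s \<Omega> (v t) f \<and> l2_deriv M v (\<lambda>x. - f x) t"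
      "\<And>t. t > 0 \<Longrightarrow> t \<notin> N2 \<Longrightarrow> \<exists>f. frac_plaplacian p s \<Omega> (w t) f \<and> l2_deriv M w (\<lambda>x. - f x) t"
      using v w unfolding strong_curve_def by metis
    have "G t2 \<le> G t1"
    proof (rule abs_cont_increment_nonpos[where N = "N1 \<union> N2" and g = G and a = t1 and b = t2])
      show "abs_cont t1 t2 G"
        unfolding G_def using t by (intro abs_cont_add abs_cont_cmult pos_energy_abs_cont cz cd) auto
      show "negligible (N1 \<union> N2)" using N by (simp add: negligible_Un)
      fix r assume r: "r \<in> {t1..t2} - (N1 \<union> N2)"
      then have r0: "r > 0" using t by auto
      obtain f where f: "frac_plaplacian p s \<Omega> (v r) f" "l2_deriv M v (\<lambda>x. - f x) r" using N(3) r r0 by blast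
      obtain g where g: "frac_plaplacian p s \<Omega> (w r) g" "l2_deriv M w (\<lambda>x. - g x) r" using N(4) r r0 by blast
      note fW = frac_plaplacianD(1)[OF f(1)] and gW = frac_plaplacianD(1)[OF g(1)]
      have fL: "L2 M f" and gL: "L2 M g"
        using frac_plaplacianD(2)[OF f(1)] frac_plaplacianD(2)[OF g(1)] by (simp_all add: Lq_space_2)
      define \<phi> where "\<phi> x = pos (z r x) - pos (z r x - \<delta>)" for x
      have zW: "z r \<in> W0" unfolding z_def by (rule frac_sobolev0_diff[OF p1 fW gW])
      have \<phi>W: "\<phi> \<in> W0"
        unfolding \<phi>_def using frac_sobolev0_truncate[OF p1 zW, of 0] frac_sobolev0_truncate[OF p1 zW, of \<delta>] \<delta>
        by (intro frac_sobolev0_diff[OF p1]) auto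
      have dz: "l2_deriv M z (\<lambda>x. - f x - - g x) r"
        unfolding z_def by (rule l2_deriv_diff[OF cv cw r0 f(2) g(2)])
      have D: "(G has_real_derivative ((LINT x|M. pos (z r x) * (- f x - - g x)) + (- 1) * (LINT x|M. pos (z r x - \<delta>) * (- f x - - g x)))) (at r)"
        unfolding G_def
        by (intro DERIV_add DERIV_cmult pos_energy_deriv cz cd dz l2_deriv_minus_const r0)
      have fgL: "L2 M (\<lambda>x. - f x - - g x)" using L2_diff[OF gL fL] by simp
      have i: "integrable M (\<lambda>x. pos (z r x) * (- f x - - g x))" "integrable M (\<lambda>x. pos (z r x - \<delta>) * (- f x - - g x))"
        "integrable M (\<lambda>x. f x * \<phi> x)" "integrable M (\<lambda>x. g x * \<phi> x)"
        unfolding \<phi>_def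
        using zL[OF r0] L2_diff[OF zL[OF r0] L2_const[OF finite_measure_M, of \<delta>]]
        by (auto intro!: L2_mult_integrable fgL fL gL L2_pos L2_diff)
      have "((LINT x|M. pos (z r x) * (- f x - - g x)) + (- 1) * (LINT x|M. pos (z r x - \<delta>) * (- f x - - g x)))
        = (LINT x|M. pos (z r x) * (- f x - - g x) - pos (z r x - \<delta>) * (- f x - - g x))"
        using i(1,2) by simp
      also have "\<dots> = (LINT x|M. g x * \<phi> x - f x * \<phi> x)"
        by (intro Bochner_Integration.integral_cong) (auto simp: \<phi>_def algebra_simps)
      also have "\<dots> = form p s (w r) \<phi> - form p s (v r) \<phi>"
        using i frac_plaplacianD(3)[OF f(1) \<phi>W] frac_plaplacianD(3)[OF g(1) \<phi>W] by simp
      also have "\<dots> \<le> 0"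
      proof -
        have mono: "pos a - pos (a - \<delta>) \<le> pos b - pos (b - \<delta>)" if "a \<le> b" for a b
          using that \<delta> by (auto simp: pos_def max_def)
        have "form p s (w r) \<phi> \<le> form p s (v r) \<phi>"
        proof (rule form_mono[OF p2 fW gW \<phi>W])
          fix y
          show "0 \<le> dif \<phi> y" if "dif (w r) y \<le> dif (v r) y"
            using that mono[of "z r (snd y)" "z r (fst y)"] by (simp add: dif_def \<phi>_def z_def)
          show "dif \<phi> y \<le> 0" if "dif (v r) y \<le> dif (w r) y"
            using that mono[of "z r (fst y)" "z r (snd y)"] by (simp add: dif_def \<phi>_def z_def)
        qed
        then show ?thesis by simp
      qed
      finally show "\<exists>D\<le>0. (G has_real_derivative D) (at r)" using D by blast
    qed (use t in auto)
    have G: "G t = (LINT x|M. (pos (z t x))\<^sup>2 / 2 - (pos (z t x - \<delta>))\<^sup>2 / 2)"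
      "integrable M (\<lambda>x. (pos (z t x))\<^sup>2 / 2 - (pos (z t x - \<delta>))\<^sup>2 / 2)" if "t > 0" for t
    proof -
      have i: "integrable M (\<lambda>x. (pos (z t x))\<^sup>2 / 2)" "integrable M (\<lambda>x. (pos (z t x - \<delta>))\<^sup>2 / 2)"
        using zL[OF that] L2_diff[OF zL[OF that] L2_const[OF finite_measure_M, of \<delta>]] by (auto intro: pos_energy_integrable)
      show "integrable M (\<lambda>x. (pos (z t x))\<^sup>2 / 2 - (pos (z t x - \<delta>))\<^sup>2 / 2)"
        using i by (rule Bochner_Integration.integrable_diff)
      show "G t = (LINT x|M. (pos (z t x))\<^sup>2 / 2 - (pos (z t x - \<delta>))\<^sup>2 / 2)"
        unfolding Bochner_Integration.integral_diff[OF i] G_def pos_energy_def by simp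
    qed
    have up: "(pos a)\<^sup>2 / 2 - (pos (a - \<delta>))\<^sup>2 / 2 \<le> \<delta> * pos a" for a
    proof -
      have "(pos a)\<^sup>2 / 2 - (pos (a - \<delta>))\<^sup>2 / 2 = (pos a - pos (a - \<delta>)) * (pos a + pos (a - \<delta>)) / 2"
        by (simp add: power2_eq_square algebra_simps diff_divide_distrib)
      also have "\<dots> \<le> \<delta> * (pos a + pos a) / 2"
        using \<delta> by (intro divide_right_mono mult_mono) (auto simp: pos_def)
      finally show ?thesis by simp
    qed
    have lo: "\<delta> * pos a - \<delta>\<^sup>2 \<le> (pos a)\<^sup>2 / 2 - (pos (a - \<delta>))\<^sup>2 / 2" for a
    proof (cases "a \<le> \<delta>")
      case True
      then have "pos a \<le> \<delta>" "pos (a - \<delta>) = 0" using \<delta> by (auto simp: pos_def)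
      moreover have "\<delta> * pos a \<le> \<delta> * \<delta>" using calculation \<delta> by (intro mult_left_mono) auto
      ultimately show ?thesis by (simp add: power2_eq_square) (smt (verit) zero_le_square)
    next
      case False
      then have "pos a = a" "pos (a - \<delta>) = a - \<delta>" using \<delta> by (auto simp: pos_def)
      moreover have "\<delta> * a - \<delta>\<^sup>2 \<le> a\<^sup>2 / 2 - (a - \<delta>)\<^sup>2 / 2" by (simp add: power2_diff field_simps)
      ultimately show ?thesis by (simp only:)
    qed
    have "t2 > 0" using t by simp
    have "\<delta> * (LINT x|M. pos (z t2 x)) - \<delta>\<^sup>2 * vol = (LINT x|M. \<delta> * pos (z t2 x) - \<delta>\<^sup>2)"
      using integrable_pos[OF zL[OF \<open>t2 > 0\<close>]] by (simp add: vol_def measure_restrict_space)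
    also have "\<dots> \<le> G t2"
      unfolding G(1)[OF \<open>t2 > 0\<close>] using integrable_pos[OF zL[OF \<open>t2 > 0\<close>]] G(2)[OF \<open>t2 > 0\<close>] lo
      by (intro integral_mono) auto
    also have "\<dots> \<le> G t1" by fact
    also have "\<dots> \<le> (LINT x|M. \<delta> * pos (z t1 x))"
      unfolding G(1)[OF t(1)] using integrable_pos[OF zL[OF t(1)]] G(2)[OF t(1)] up by (intro integral_mono) auto
    finally have "\<delta> * (LINT x|M. pos (z t2 x)) \<le> \<delta> * ((LINT x|M. pos (z t1 x)) + \<delta> * vol)"
      by (simp add: power2_eq_square algebra_simps)
    then show ?thesis using \<delta> by simp
  qed
  have "(LINT x|M. pos (z t2 x)) \<le> (LINT x|M. pos (z t1 x)) + e" if "e > 0" for e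
  proof -
    have "(e / (vol + 1)) > 0" using that vol_nonneg by simp
    from main[OF this] have "(LINT x|M. pos (z t2 x)) \<le> (LINT x|M. pos (z t1 x)) + e / (vol + 1) * vol" .
    moreover have "e / (vol + 1) * vol \<le> e"
      using that vol_nonneg by (simp add: field_simps)
    ultimately show ?thesis by linarith
  qed
  then show ?thesis unfolding z_def by (rule field_le_epsilon)
qed

lemma contraction_pos_initial:
  assumes v: "strong_curve v" "initial v v0" and w: "strong_curve w" "initial w w0" and "t > 0"
  shows "(LINT x|M. pos (v t x - w t x)) \<le> (LINT x|M. pos (v0 x - w0 x))"
proof -
  have L0: "L2 M v0" "L2 M w0" using v w by (auto simp: initial_def)
  let ?b = "\<lambda>r. (LINT x|M. pos (v0 x - w0 x)) + (n2 M (\<lambda>x. v r x - v0 x) * sqrt vol + n2 M (\<lambda>x. w r x - w0 x) * sqrt vol)"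
  have lim: "(?b \<longlongrightarrow> (LINT x|M. pos (v0 x - w0 x)) + (0 * sqrt vol + 0 * sqrt vol)) (at_right 0)"
    using v w by (intro tendsto_intros) (auto simp: initial_def)
  have ev: "\<forall>\<^sub>F r in at_right 0. (LINT x|M. pos (v t x - w t x)) \<le> ?b r"
    unfolding eventually_at_right_field
  proof (intro exI[of _ t] conjI allI impI \<open>t > 0\<close>)
    fix r :: real assume r: "r > 0" "r < t"
    have L: "L2 M (v r)" "L2 M (w r)" using strong_curve_L2 v w r by auto
    have LD: "L2 M (\<lambda>x. v r x - v0 x)" "L2 M (\<lambda>x. w r x - w0 x)" using L L0 by (auto intro: L2_diff)
    have "(LINT x|M. pos (v t x - w t x)) \<le> (LINT x|M. pos (v r x - w r x))"
      using contraction_pos[OF v(1) w(1)] r by simp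
    also have "\<dots> \<le> (LINT x|M. pos (v0 x - w0 x) + (\<bar>v r x - v0 x\<bar> + \<bar>w r x - w0 x\<bar>))"
    proof (rule integral_mono)
      show "pos (v r x - w r x) \<le> pos (v0 x - w0 x) + (\<bar>v r x - v0 x\<bar> + \<bar>w r x - w0 x\<bar>)" for x
        by (auto simp: pos_def)
      show "integrable M (\<lambda>x. pos (v r x - w r x))" using L by (intro integrable_pos L2_diff)
      show "integrable M (\<lambda>x. pos (v0 x - w0 x) + (\<bar>v r x - v0 x\<bar> + \<bar>w r x - w0 x\<bar>))"
        using L L0 LD by (intro Bochner_Integration.integrable_add integrable_pos L2_diff integrable_abs L2_integrable[OF finite_measure_M])
    qed
    also have "\<dots> = (LINT x|M. pos (v0 x - w0 x)) + ((LINT x|M. \<bar>v r x - v0 x\<bar>) + (LINT x|M. \<bar>w r x - w0 x\<bar>))"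
      using L2_integrable[OF finite_measure_M LD(1)] L2_integrable[OF finite_measure_M LD(2)] integrable_pos[OF L2_diff[OF L0]]
      by (simp add: integrable_abs)
    also have "\<dots> \<le> ?b r" using LD by (intro add_mono L1_le_n2) auto
    finally show "(LINT x|M. pos (v t x - w t x)) \<le> ?b r" .
  qed
  have "(LINT x|M. pos (v t x - w t x)) \<le> (LINT x|M. pos (v0 x - w0 x)) + (0 * sqrt vol + 0 * sqrt vol)"
    by (rule tendsto_lowerbound[OF lim ev]) simp
  then show ?thesis by simp
qed

end

subsection \<open>The profile and the universal bound\<close>

lemma LIMSEQ_integral_pos_diff:
  fixes f g :: "'b \<Rightarrow> real"
  assumes f: "integrable M f" and g: "g \<in> borel_measurable M" "AE x in M. 0 \<le> g x"
    and k: "filterlim k at_top sequentially" "\<And>n. k n \<ge> 0"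
  shows "(\<lambda>n. LINT x|M. pos (f x - k n * g x)) \<longlonglongrightarrow> (LINT x|M. (if g x > 0 then 0 else pos (f x)))"
proof (rule integral_dominated_convergence[where w = "\<lambda>x. \<bar>f x\<bar>"])
  note [measurable] = borel_measurable_integrable[OF f] g(1)
  show "(\<lambda>x. if g x > 0 then 0 else pos (f x)) \<in> borel_measurable M" by measurable
  show "(\<lambda>x. pos (f x - k n * g x)) \<in> borel_measurable M" for n by measurable
  show "integrable M (\<lambda>x. \<bar>f x\<bar>)" using f by (rule integrable_abs)
  show "AE x in M. (\<lambda>n. pos (f x - k n * g x)) \<longlonglongrightarrow> (if g x > 0 then 0 else pos (f x))"
    using g(2)
  proof eventually_elim
    case (elim x)
    show ?case
    proof (cases "g x > 0")
      case True
      have "\<forall>\<^sub>F n in sequentially. k n \<ge> f x / g x" using k(1) by (simp add: filterlim_at_top)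
      then have "\<forall>\<^sub>F n in sequentially. pos (f x - k n * g x) = 0"
        by eventually_elim (use True in \<open>auto simp: pos_def field_simps\<close>)
      then show ?thesis using True by (simp add: tendsto_eventually)
    next
      case False
      then have "g x = 0" using elim by simp
      then show ?thesis by simp
    qed
  qed
  show "AE x in M. norm (pos (f x - k n * g x)) \<le> \<bar>f x\<bar>" for n
    using g(2)
  proof eventually_elim
    case (elim x)
    then have "k n * g x \<ge> 0" using k(2) by simp
    then show ?case by (auto simp: pos_def)
  qed
qed

locale profile_problem = dirichlet_problem +
  fixes F :: "'a \<Rightarrow> real"
  assumes profile: "positive_profile p s \<Omega> F"
begin

lemma F_lapl: "frac_plaplacian p s \<Omega> F (\<lambda>x. \<gamma> * F x)"
  and F_pos: "x \<in> \<Omega> \<Longrightarrow> F x > 0" and F_zero: "x \<notin> \<Omega> \<Longrightarrow> F x = 0"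
  using profile by (auto simp: positive_profile_def)

lemma F_nonneg: "F x \<ge> 0"
  using F_pos[of x] F_zero[of x] by (cases "x \<in> \<Omega>") auto

lemma F_W0: "F \<in> W0" by (rule frac_plaplacianD(1)[OF F_lapl])

lemma F_measurable [measurable]: "F \<in> borel_measurable lebesgue" "F \<in> borel_measurable M"
  using frac_sobolev0_measurable[OF p1 F_W0] W0_measurable_M[OF F_W0] by auto

lemma \<gamma>_pos: "\<gamma> > 0" using p by simp

lemma F_L2: "L2 M F"
proof -
  have "L2 M (\<lambda>x. (p - 2) * (\<gamma> * F x))"
    using frac_plaplacianD(2)[OF F_lapl] unfolding Lq_space_2 by (rule L2_cmult)
  then show ?thesis using p by simp
qed

lemma F_integrable: "integrable M F"
  by (rule L2_integrable[OF finite_measure_M F_L2])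

lemma nn_integral_M_le: "(\<integral>\<^sup>+ x. f x \<partial>M) \<le> (\<integral>\<^sup>+ x. f x \<partial>lebesgue)"
  by (subst nn_integral_restrict_space) (auto intro!: nn_integral_mono simp: indicator_def)

text \<open>Pairs with one point outside \<open>\<Omega>\<close> act as an absorption of order \<open>F\<^bsup>p-1\<^esup>\<close>, which beats the
  linear right-hand side where \<open>F\<close> is large.\<close>

lemma F_AE_bounded: "\<exists>B>0. AE x in M. F x \<le> B"
proof -
  define \<omega> where "\<omega> = unit_ball_vol (real DIM('a)) / 2"
  have \<omega>: "\<omega> > 0" by (simp add: \<omega>_def)
  define r where "r = max 1 (vol / \<omega>)"
  have r: "r > 0" "r \<ge> 1" by (auto simp: r_def)
  have "vol \<le> \<omega> * r" using \<omega> by (simp add: r_def max_def field_simps)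
  also have "\<dots> \<le> \<omega> * r ^ DIM('a)" using \<omega> r self_le_power[of r "DIM('a)"] by simp
  finally have vr: "vol \<le> \<omega> * r ^ DIM('a)" .
  have em: "emeasure lebesgue \<Omega> = ennreal vol"
    using dom_lmeasurable by (simp add: vol_def emeasure_eq_measure2)
  have S: "emeasure lebesgue \<Omega> \<le> ennreal (unit_ball_vol (real DIM('a)) / 2 * r ^ DIM('a))"
    unfolding em using vr by (intro ennreal_leI) (simp add: \<omega>_def)
  define \<kappa> where "\<kappa> = killing_rate TYPE('a) p s r"
  have \<kappa>: "\<kappa> > 0" unfolding \<kappa>_def by (rule killing_rate_pos[OF r(1)])
  define X where "X = \<gamma> + 1"
  have X: "X > \<gamma>" "X > 0" using \<gamma>_pos unfolding X_def by linarith+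
  define B where "B = (X / \<kappa>) powr \<gamma>"
  have B: "B > 0" using \<kappa> X by (simp add: B_def)
  have \<kappa>B: "\<kappa> * B powr (p - 2) = X" using \<kappa> X p by (simp add: B_def powr_powr)
  define \<phi> where "\<phi> x = pos (F x - B)" for x
  have \<phi>W: "\<phi> \<in> W0" unfolding \<phi>_def using B by (intro frac_sobolev0_truncate[OF p1 F_W0]) simp
  have [measurable]: "\<phi> \<in> borel_measurable lebesgue" by (rule frac_sobolev0_measurable[OF p1 \<phi>W])
  have \<phi>0: "\<phi> x \<ge> 0" for x by (simp add: \<phi>_def)
  have \<phi>L: "L2 M \<phi>" unfolding \<phi>_def by (intro L2_pos L2_diff F_L2 L2_const finite_measure_M)
  define I where "I = (LINT x|M. F x * \<phi> x)"
  have iI: "integrable M (\<lambda>x. F x * \<phi> x)" by (rule L2_mult_integrable[OF F_L2 \<phi>L])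
  have "ennreal \<kappa> * (\<integral>\<^sup>+ x. ennreal (F x powr (p - 1) * \<phi> x) \<partial>lebesgue) \<le> ennreal (LINT z|gmeasure p s. psi p (dif F z) * dif \<phi> z)"
    unfolding \<kappa>_def
  proof (rule integral_ge_killing[OF dom_sets r(1) sp S form_integrable[OF p1 F_W0 \<phi>W]])
    show "0 \<le> psi p (dif F z) * dif \<phi> z" for z
    proof -
      have "0 \<le> (psi p (dif F z) - psi p 0) * dif \<phi> z"
        by (rule psi_diff_mult_nonneg[OF p2]) (auto simp: dif_def \<phi>_def pos_def)
      then show ?thesis by simp
    qed
    have "snd z \<notin> \<Omega> \<longrightarrow> F (fst z) powr (p - 1) * \<phi> (fst z) \<le> psi p (dif F z) * dif \<phi> z" for z
      using B F_nonneg[of "fst z"] by (auto simp: dif_def F_zero \<phi>_def pos_def psi_nonneg_eq)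
    then show "AE z in lebesgue \<Otimes>\<^sub>M lebesgue. snd z \<notin> \<Omega> \<longrightarrow> F (fst z) powr (p - 1) * \<phi> (fst z) \<le> psi p (dif F z) * dif \<phi> z"
      by simp
  qed measurable
  also have "(LINT z|gmeasure p s. psi p (dif F z) * dif \<phi> z) = \<gamma> * I"
    using frac_plaplacianD(3)[OF F_lapl \<phi>W] by (simp add: form_def I_def mult.assoc)
  finally have 1: "ennreal \<kappa> * (\<integral>\<^sup>+ x. ennreal (F x powr (p - 1) * \<phi> x) \<partial>lebesgue) \<le> ennreal (\<gamma> * I)" .
  have I0: "I \<ge> 0" unfolding I_def using F_nonneg \<phi>0 by (intro integral_nonneg_AE) auto
  have "ennreal (B powr (p - 2) * I) = (\<integral>\<^sup>+ x. ennreal (B powr (p - 2) * (F x * \<phi> x)) \<partial>M)"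
    unfolding I_def using iI F_nonneg \<phi>0 by (subst nn_integral_eq_integral) auto
  also have "\<dots> \<le> (\<integral>\<^sup>+ x. ennreal (F x powr (p - 1) * \<phi> x) \<partial>M)"
  proof (intro nn_integral_mono ennreal_leI)
    fix x
    show "B powr (p - 2) * (F x * \<phi> x) \<le> F x powr (p - 1) * \<phi> x"
    proof (cases "F x \<le> B")
      case False
      then have "B powr (p - 2) \<le> F x powr (p - 2)" using B p by (intro powr_mono2) auto
      then have "B powr (p - 2) * (F x * \<phi> x) \<le> F x powr (p - 2) * (F x * \<phi> x)"
        using F_nonneg \<phi>0 by (intro mult_right_mono) auto
      also have "\<dots> = (F x powr (p - 2) * F x powr 1) * \<phi> x" using F_nonneg by simp
      also have "F x powr (p - 2) * F x powr 1 = F x powr (p - 1)" unfolding powr_add[symmetric] by simp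
      finally show ?thesis .
    qed (simp add: \<phi>_def pos_def)
  qed
  also have "\<dots> \<le> (\<integral>\<^sup>+ x. ennreal (F x powr (p - 1) * \<phi> x) \<partial>lebesgue)" by (rule nn_integral_M_le)
  finally have "ennreal \<kappa> * ennreal (B powr (p - 2) * I) \<le> ennreal (\<gamma> * I)"
    using 1 by (meson mult_left_mono order_trans zero_le)
  then have "\<kappa> * (B powr (p - 2) * I) \<le> \<gamma> * I"
    using I0 \<gamma>_pos \<kappa> by (simp flip: ennreal_mult' add: ennreal_le_iff)
  then have "X * I \<le> \<gamma> * I" unfolding \<kappa>B[symmetric] by (simp add: mult.assoc)
  then have "I = 0" using I0 X(1) by (metis antisym_conv3 leD mult_strict_right_mono not_le order_le_less)
  then have "AE x in M. F x * \<phi> x = 0"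
    unfolding I_def using iI F_nonneg \<phi>0 by (subst (asm) integral_nonneg_eq_0_iff_AE) auto
  then have "AE x in M. F x \<le> B"
    by eventually_elim (use B in \<open>auto simp: \<phi>_def pos_def max_def split: if_splits\<close>)
  then show ?thesis using B by blast
qed

lemma sep_coeff_deriv:
  assumes "t + \<tau> > 0"
  shows "((\<lambda>t. \<sigma> * (t + \<tau>) powr (- \<gamma>)) has_real_derivative (- \<sigma> * \<gamma> * (t + \<tau>) powr (- \<gamma> - 1))) (at t)"
  using assms by (auto intro!: derivative_eq_intros simp: powr_diff)

lemma sep_strong:
  assumes \<sigma>: "\<sigma> = 1 \<or> \<sigma> = -1" and \<tau>: "\<tau> \<ge> 0"
  shows "strong_curve (\<lambda>t x. \<sigma> * (t + \<tau>) powr (- \<gamma>) * F x)"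
  unfolding strong_curve_def
proof (intro conjI exI[of _ "{}"] allI impI)
  define c where "c t = \<sigma> * (t + \<tau>) powr (- \<gamma>)" for t
  define c' where "c' t = - \<sigma> * \<gamma> * (t + \<tau>) powr (- \<gamma> - 1)" for t
  have D: "(c has_real_derivative c' t) (at t)" if "t > 0" for t
    unfolding c_def c'_def using that \<tau> by (intro sep_coeff_deriv) simp
  show "l2_curve M (\<lambda>t x. \<sigma> * (t + \<tau>) powr (- \<gamma>) * F x)"
    unfolding c_def[symmetric]
  proof (rule l2_curve_scalar[OF F_L2])
    fix a b :: real assume ab: "0 < a" "a \<le> b"
    show "\<exists>L. \<forall>s\<in>{a..b}. \<forall>t\<in>{a..b}. \<bar>c t - c s\<bar> \<le> L * \<bar>t - s\<bar>"
    proof (intro exI[of _ "\<gamma> * a powr (- \<gamma> - 1)"] ballI)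
      fix q t assume qt: "q \<in> {a..b}" "t \<in> {a..b}"
      have "norm (c t - c q) \<le> \<gamma> * a powr (- \<gamma> - 1) * norm (t - q)"
      proof (rule field_differentiable_bound[of "{a..b}" c c'])
        show "(c has_field_derivative c' z) (at z within {a..b})" if "z \<in> {a..b}" for z
          using D[of z] that ab by (auto intro: has_field_derivative_at_within)
        show "norm (c' z) \<le> \<gamma> * a powr (- \<gamma> - 1)" if "z \<in> {a..b}" for z
        proof -
          have "(z + \<tau>) powr (- \<gamma> - 1) \<le> a powr (- \<gamma> - 1)"
          proof (rule powr_mono2')
            show "- \<gamma> - 1 \<le> 0" using \<gamma>_pos by linarith
          qed (use that ab \<tau> in auto)
          then show ?thesis using \<sigma> \<gamma>_pos by (auto simp: c'_def abs_mult intro!: mult_left_mono divide_right_mono)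
        qed
      qed (use qt in auto)
      then show "\<bar>c t - c q\<bar> \<le> \<gamma> * a powr (- \<gamma> - 1) * \<bar>t - q\<bar>" by simp
    qed
  qed
  fix t :: real assume t: "t > 0"
  have tau: "t + \<tau> > 0" using t \<tau> by simp
  have "psi p (c t) = \<sigma> * ((t + \<tau>) powr (- \<gamma>)) powr (p - 1)"
    using \<sigma> psi_nonneg_eq[of "(t + \<tau>) powr (- \<gamma>)" p] psi_minus[of p "(t + \<tau>) powr (- \<gamma>)"]
    by (auto simp: c_def)
  also have "((t + \<tau>) powr (- \<gamma>)) powr (p - 1) = (t + \<tau>) powr (- \<gamma> - 1)"
  proof -
    have "- \<gamma> * (p - 1) = - \<gamma> - 1" using p by (simp add: field_simps)
    then show ?thesis by (simp only: powr_powr)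
  qed
  finally have psi: "psi p (c t) = \<sigma> * (t + \<tau>) powr (- \<gamma> - 1)" .
  have "frac_plaplacian p s \<Omega> (\<lambda>x. c t * F x) (\<lambda>x. psi p (c t) * (\<gamma> * F x))"
    by (rule frac_plaplacian_cmult[OF p1 F_lapl])
  moreover have "(\<lambda>x. - (psi p (c t) * (\<gamma> * F x))) = (\<lambda>x. c' t * F x)"
    by (auto simp: psi c'_def)
  then have "l2_deriv M (\<lambda>t x. c t * F x) (\<lambda>x. - (psi p (c t) * (\<gamma> * F x))) t"
    using l2_deriv_scalar[OF F_L2 D[OF t]] by simp
  ultimately show "\<exists>w. frac_plaplacian p s \<Omega> (\<lambda>x. \<sigma> * (t + \<tau>) powr (- \<gamma>) * F x) w \<and>
      l2_deriv M (\<lambda>t x. \<sigma> * (t + \<tau>) powr (- \<gamma>) * F x) (\<lambda>x. - w x) t"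
    unfolding c_def by blast
qed simp

lemma sep_initial:
  assumes \<tau>: "\<tau> > 0"
  shows "initial (\<lambda>t x. \<sigma> * (t + \<tau>) powr (- \<gamma>) * F x) (\<lambda>x. \<sigma> * \<tau> powr (- \<gamma>) * F x)"
  unfolding initial_def
proof
  show "L2 M (\<lambda>x. \<sigma> * \<tau> powr (- \<gamma>) * F x)" by (intro L2_cmult F_L2)
  have "n2 M (\<lambda>x. \<sigma> * (t + \<tau>) powr (- \<gamma>) * F x - \<sigma> * \<tau> powr (- \<gamma>) * F x) = \<bar>\<sigma> * (t + \<tau>) powr (- \<gamma>) - \<sigma> * \<tau> powr (- \<gamma>)\<bar> * n2 M F" for t
    unfolding n2_cmult[symmetric] by (simp add: left_diff_distrib)
  moreover have "((\<lambda>t. \<bar>\<sigma> * (t + \<tau>) powr (- \<gamma>) - \<sigma> * \<tau> powr (- \<gamma>)\<bar> * n2 M F) \<longlongrightarrow> \<bar>\<sigma> * (0 + \<tau>) powr (- \<gamma>) - \<sigma> * \<tau> powr (- \<gamma>)\<bar> * n2 M F) (at_right 0)"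
    using \<tau> by (intro tendsto_intros) auto
  ultimately show "((\<lambda>t. n2 M (\<lambda>x. \<sigma> * (t + \<tau>) powr (- \<gamma>) * F x - \<sigma> * \<tau> powr (- \<gamma>) * F x)) \<longlongrightarrow> 0) (at_right 0)"
    by simp
qed

lemma filterlim_inverse_powr: "filterlim (\<lambda>n. (1 / real (Suc n)) powr (- \<gamma>)) at_top sequentially"
proof -
  have "(1 / real (Suc n)) powr (- \<gamma>) = real (Suc n) powr \<gamma>" for n
    by (simp add: powr_minus_divide powr_divide)
  moreover have "filterlim (\<lambda>n. real (Suc n) powr \<gamma>) at_top sequentially"
  proof -
    have "filterlim (\<lambda>n. exp (\<gamma> * ln (real (Suc n)))) at_top sequentially"
      by (intro filterlim_compose[OF exp_at_top] filterlim_tendsto_pos_mult_at_top[OF tendsto_const \<gamma>_pos]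
          filterlim_compose[OF ln_at_top] filterlim_compose[OF filterlim_real_sequentially filterlim_Suc])
    then show ?thesis by (simp add: powr_def)
  qed
  ultimately show ?thesis by simp
qed

text \<open>Comparison with \<open>U(\<cdot> + \<tau>)\<close>: as \<open>\<tau> \<rightarrow> 0\<close>, its initial datum \<open>\<tau>\<^bsup>-\<gamma>\<^esup>F\<close> exceeds any given datum in
  \<open>L\<^sup>1\<close>, because \<open>F\<close> is positive in \<open>\<Omega>\<close>.\<close>

lemma universal_bound:
  assumes v: "strong_curve v" "initial v v0" and t: "t > 0"
  shows "AE x in M. \<bar>v t x\<bar> \<le> t powr (- \<gamma>) * F x"
proof -
  have v0: "integrable M v0" using v by (auto simp: initial_def intro: L2_integrable[OF finite_measure_M])
  have vt: "L2 M (v t)" using strong_curve_L2[OF v(1) t] .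
  have lim: "(\<lambda>n. LINT x|M. pos (f x - (1 / real (Suc n)) powr (- \<gamma>) * F x)) \<longlonglongrightarrow> 0" if "integrable M f" for f
  proof -
    have "(\<lambda>n. LINT x|M. pos (f x - (1 / real (Suc n)) powr (- \<gamma>) * F x)) \<longlonglongrightarrow> (LINT x|M. (if F x > 0 then 0 else pos (f x)))"
      using F_nonneg by (intro LIMSEQ_integral_pos_diff that filterlim_inverse_powr) auto
    also have "(LINT x|M. (if F x > 0 then 0 else pos (f x))) = (LINT x|M. 0)"
      by (intro Bochner_Integration.integral_cong) (auto simp: F_pos)
    finally show ?thesis by simp
  qed
  have zero: "AE x in M. f x \<le> t powr (- \<gamma>) * F x"
    if f: "L2 M f" and f0: "integrable M f0"
      and comp: "\<And>\<tau>. \<tau> > 0 \<Longrightarrow> (LINT x|M. pos (f x - (t + \<tau>) powr (- \<gamma>) * F x)) \<le> (LINT x|M. pos (f0 x - \<tau> powr (- \<gamma>) * F x))"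
    for f f0
  proof -
    have L: "L2 M (\<lambda>x. f x - c * F x)" for c by (intro L2_diff L2_cmult F_L2 f)
    have "(LINT x|M. pos (f x - t powr (- \<gamma>) * F x)) \<le> (LINT x|M. pos (f0 x - (1 / real (Suc n)) powr (- \<gamma>) * F x))" for n
    proof -
      have "(t + 1 / real (Suc n)) powr (- \<gamma>) \<le> t powr (- \<gamma>)" using t \<gamma>_pos by (intro powr_mono2') auto
      then have "(LINT x|M. pos (f x - t powr (- \<gamma>) * F x)) \<le> (LINT x|M. pos (f x - (t + 1 / real (Suc n)) powr (- \<gamma>) * F x))"
        using F_nonneg by (intro integral_mono integrable_pos L pos_mono diff_left_mono mult_right_mono) auto
      also have "\<dots> \<le> (LINT x|M. pos (f0 x - (1 / real (Suc n)) powr (- \<gamma>) * F x))" by (rule comp) simp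
      finally show ?thesis .
    qed
    then have "(LINT x|M. pos (f x - t powr (- \<gamma>) * F x)) \<le> 0"
      by (intro LIMSEQ_le_const[OF lim[OF f0]]) auto
    moreover have "(LINT x|M. pos (f x - t powr (- \<gamma>) * F x)) \<ge> 0" by simp
    ultimately have "(LINT x|M. pos (f x - t powr (- \<gamma>) * F x)) = 0" by simp
    then have "AE x in M. pos (f x - t powr (- \<gamma>) * F x) = 0"
      using integrable_pos[OF L] by (subst (asm) integral_nonneg_eq_0_iff_AE) auto
    then show ?thesis by eventually_elim (auto simp: pos_def max_def split: if_splits)
  qed
  have "AE x in M. v t x \<le> t powr (- \<gamma>) * F x"
  proof (rule zero[OF vt v0])
    fix \<tau> :: real assume \<tau>: "\<tau> > 0"
    show "(LINT x|M. pos (v t x - (t + \<tau>) powr (- \<gamma>) * F x)) \<le> (LINT x|M. pos (v0 x - \<tau> powr (- \<gamma>) * F x))"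
      using contraction_pos_initial[OF v sep_strong[of 1 \<tau>] sep_initial[OF \<tau>, of 1] t] \<tau> by simp
  qed
  moreover have "AE x in M. - v t x \<le> t powr (- \<gamma>) * F x"
  proof (rule zero[of "\<lambda>x. - v t x" "\<lambda>x. - v0 x"])
    fix \<tau> :: real assume \<tau>: "\<tau> > 0"
    have "(LINT x|M. pos (- ((t + \<tau>) powr (- \<gamma>) * F x) - v t x)) \<le> (LINT x|M. pos (- (\<tau> powr (- \<gamma>) * F x) - v0 x))"
      using contraction_pos_initial[OF sep_strong[of "-1" \<tau>] sep_initial[OF \<tau>, of "-1"] v t] \<tau> by simp
    then show "(LINT x|M. pos (- v t x - (t + \<tau>) powr (- \<gamma>) * F x)) \<le> (LINT x|M. pos (- v0 x - \<tau> powr (- \<gamma>) * F x))"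
      by (simp only: minus_diff_commute)
  qed (use vt v0 L2_cmult[OF vt, of "-1"] in auto)
  ultimately show ?thesis by eventually_elim auto
qed

end

subsection \<open>Semigroup solutions\<close>

lemma abs_eq_pos: "\<bar>a\<bar> = pos a + pos (- a)"
  by (simp add: pos_def max_def)

lemma pos_step_pointwise:
  fixes a b A B :: real
  assumes p: "p > 2" and AB: "0 \<le> A" "A \<le> Bd" "0 \<le> B" "B \<le> Bd" and k: "k > 0" and \<theta>: "\<theta> > 0"
    and c: "c = Bd / k" and c0: "c0 \<ge> 4 * c"
  shows "psi p (a - b) * (pos (A - k * a) - pos (B - k * b))
      + (if a \<ge> c0 / 2 then (c0 / 4) powr (p - 1) * pos (B - k * b) else 0)
    \<le> (1 / \<theta>) * (psi p (a - b) * ((a - pos (a - c)) - (b - pos (b - c)))) + \<theta> powr (p - 1) * \<bar>A - B\<bar> powr p"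
proof -
  have kc: "k * c = Bd" and c_nonneg: "c \<ge> 0" using k c AB by auto
  have rhs: "0 \<le> psi p (a - b) * ((a - pos (a - c)) - (b - pos (b - c)))" for a b
  proof -
    have "0 \<le> (psi p (a - b) - psi p 0) * ((a - pos (a - c)) - (b - pos (b - c)))"
      using p by (intro psi_diff_mult_nonneg) (auto simp: pos_def max_def)
    then show ?thesis by simp
  qed
  have rhs2: "0 \<le> (1 / \<theta>) * (psi p (a - b) * ((a - pos (a - c)) - (b - pos (b - c)))) + \<theta> powr (p - 1) * \<bar>A - B\<bar> powr p" for a b A B :: real
    by (rule add_nonneg_nonneg, rule mult_nonneg_nonneg[OF _ rhs]) (use \<theta> in auto)
  have van: "pos (A - k * a) = 0" if "a \<ge> c" "A \<le> Bd" for a A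
  proof -
    have "k * c \<le> k * a" using that k by (intro mult_left_mono) auto
    then show ?thesis using kc that by (simp add: pos_def)
  qed
  have main: "psi p (a - b) * (pos (A - k * a) - pos (B - k * b))
    \<le> (1 / \<theta>) * (psi p (a - b) * ((a - pos (a - c)) - (b - pos (b - c)))) + \<theta> powr (p - 1) * \<bar>A - B\<bar> powr p"
    if "b \<le> a" "A \<le> Bd" "B \<le> Bd" for a b A B
  proof (cases "a < c")
    case True
    then have T: "(a - pos (a - c)) - (b - pos (b - c)) = a - b" using \<open>b \<le> a\<close> by (simp add: pos_def)
    have "k * b \<le> k * a" using k \<open>b \<le> a\<close> by simp
    then have "pos (A - k * a) - pos (B - k * b) \<le> \<bar>A - B\<bar>" by (auto simp: pos_def)
    then have "psi p (a - b) * (pos (A - k * a) - pos (B - k * b)) \<le> psi p (a - b) * \<bar>A - B\<bar>"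
      using \<open>b \<le> a\<close> by (intro mult_left_mono) (auto simp: psi_nonneg_eq)
    also have "\<dots> = (a - b) powr (p - 1) * \<bar>A - B\<bar>" using \<open>b \<le> a\<close> by (simp add: psi_nonneg_eq)
    also have "\<dots> \<le> (1 / \<theta>) * (a - b) powr p + \<theta> powr (p - 1) * \<bar>A - B\<bar> powr p"
      using \<open>b \<le> a\<close> \<theta> p by (intro powr_young) auto
    also have "(a - b) powr p = psi p (a - b) * (a - b)" using \<open>b \<le> a\<close> by (simp add: psi_mult_self)
    finally show ?thesis unfolding T .
  next
    case False
    then have "psi p (a - b) * (pos (A - k * a) - pos (B - k * b)) = - (psi p (a - b) * pos (B - k * b))"
      using van[of a A] that by simp
    also have "\<dots> \<le> 0" using \<open>b \<le> a\<close> by (simp add: psi_nonneg_eq)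
    also have "0 \<le> (1 / \<theta>) * (psi p (a - b) * ((a - pos (a - c)) - (b - pos (b - c)))) + \<theta> powr (p - 1) * \<bar>A - B\<bar> powr p"
      by (rule rhs2)
    finally show ?thesis .
  qed
  consider "b \<le> a" "a \<ge> c0 / 2" | "b \<le> a" "a < c0 / 2" | "a < b" by linarith
  then show ?thesis
  proof cases
    case 1
    then have ac: "a \<ge> c" using c0 c_nonneg by linarith
    have "(c0 / 4) powr (p - 1) * pos (B - k * b) \<le> psi p (a - b) * pos (B - k * b)"
    proof (cases "b \<ge> c")
      case True
      then show ?thesis using van[of b B] AB by simp
    next
      case False
      then have "c0 / 4 \<le> a - b" using 1 c0 by linarith
      then have "(c0 / 4) powr (p - 1) \<le> (a - b) powr (p - 1)"
        using p c0 c_nonneg by (intro powr_mono2) auto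
      then show ?thesis using 1 by (intro mult_right_mono) (auto simp: psi_nonneg_eq)
    qed
    moreover have "psi p (a - b) * (pos (A - k * a) - pos (B - k * b)) = - (psi p (a - b) * pos (B - k * b))"
      using van[OF ac] AB by simp
    moreover have "0 \<le> (1 / \<theta>) * (psi p (a - b) * ((a - pos (a - c)) - (b - pos (b - c)))) + \<theta> powr (p - 1) * \<bar>A - B\<bar> powr p"
      by (rule rhs2)
    ultimately show ?thesis using 1 by simp
  next
    case 2
    then show ?thesis using main[of b a A B] AB by simp
  next
    case 3
    have z: "(if a \<ge> c0 / 2 then (c0 / 4) powr (p - 1) * pos (B - k * b) else 0) = 0"
      using van[of b B] 3 AB c0 c_nonneg by auto
    have "psi p (a - b) = - psi p (b - a)" using psi_minus[of p "b - a"] by simp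
    then show ?thesis using main[of a b B A] 3 AB unfolding z by (simp add: abs_minus_commute algebra_simps)
  qed
qed

locale semigroup_problem = profile_problem +
  fixes u0 :: "'a \<Rightarrow> real" and u :: "real \<Rightarrow> 'a \<Rightarrow> real"
    and v0 :: "nat \<Rightarrow> 'a \<Rightarrow> real" and v :: "nat \<Rightarrow> real \<Rightarrow> 'a \<Rightarrow> real"
  assumes v_strong: "strong_solution p s \<Omega> (v0 n) (v n)"
    and u0_int: "integrable M u0" and u_int: "t > 0 \<Longrightarrow> integrable M (u t)"
    and v0_lim: "(\<lambda>n. LINT x|M. \<bar>v0 n x - u0 x\<bar>) \<longlonglongrightarrow> 0"
    and v_lim: "t > 0 \<Longrightarrow> (\<lambda>n. LINT x|M. \<bar>v n t x - u t x\<bar>) \<longlonglongrightarrow> 0"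
    and u0_nonneg: "AE x in M. u0 x \<ge> 0" and u0_nonzero: "\<not> (AE x in M. u0 x = 0)"
    and u_nonneg: "t > 0 \<Longrightarrow> AE x in M. u t x \<ge> 0"
begin

lemma v_curve: "strong_curve (v n)" and v_init: "initial (v n) (v0 n)"
  using strong_solution_imp[OF v_strong] by auto

lemma v_L2: "t > 0 \<Longrightarrow> L2 M (v n t)"
  using strong_curve_L2[OF v_curve] .

lemma v_int: "t > 0 \<Longrightarrow> integrable M (v n t)"
  by (rule L2_integrable[OF finite_measure_M v_L2])

lemma v0_int: "integrable M (v0 n)"
  using v_init[of n] by (auto simp: initial_def intro: L2_integrable[OF finite_measure_M])

definition err :: "nat \<Rightarrow> real" where "err n = (LINT x|M. \<bar>v0 n x - u0 x\<bar>)"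

lemma err_lim: "err \<longlonglongrightarrow> 0" unfolding err_def by (rule v0_lim)

lemma integral_abs_triangle:
  fixes f g h :: "'a \<Rightarrow> real"
  assumes "integrable M f" "integrable M g" "integrable M h"
  shows "(LINT x|M. \<bar>f x - h x\<bar>) \<le> (LINT x|M. \<bar>f x - g x\<bar>) + (LINT x|M. \<bar>g x - h x\<bar>)"
proof -
  have "(LINT x|M. \<bar>f x - h x\<bar>) \<le> (LINT x|M. \<bar>f x - g x\<bar> + \<bar>g x - h x\<bar>)"
    using assms by (intro integral_mono) auto
  then show ?thesis using assms by simp
qed

lemma integral_abs_commute:
  fixes f g :: "'a \<Rightarrow> real"
  shows "(LINT x|M. \<bar>f x - g x\<bar>) = (LINT x|M. \<bar>g x - f x\<bar>)"
  by (simp add: abs_minus_commute)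

lemma v_contraction:
  assumes t: "t > 0"
  shows "(LINT x|M. \<bar>v n t x - v m t x\<bar>) \<le> err n + err m"
proof -
  have L: "L2 M (\<lambda>x. v n t x - v m t x)" "L2 M (\<lambda>x. v m t x - v n t x)" using t by (auto intro: L2_diff v_L2)
  have L0: "L2 M (\<lambda>x. v0 n x - v0 m x)" "L2 M (\<lambda>x. v0 m x - v0 n x)"
    using v_init by (auto simp: initial_def intro: L2_diff)
  have "(LINT x|M. \<bar>v n t x - v m t x\<bar>) = (LINT x|M. pos (v n t x - v m t x)) + (LINT x|M. pos (v m t x - v n t x))"
    using integrable_pos[OF L(1)] integrable_pos[OF L(2)] by (simp add: abs_eq_pos)
  also have "\<dots> \<le> (LINT x|M. pos (v0 n x - v0 m x)) + (LINT x|M. pos (v0 m x - v0 n x))"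
    by (intro add_mono contraction_pos_initial v_curve v_init t)
  also have "\<dots> = (LINT x|M. \<bar>v0 n x - v0 m x\<bar>)"
    using integrable_pos[OF L0(1)] integrable_pos[OF L0(2)] by (simp add: abs_eq_pos)
  also have "\<dots> \<le> err n + err m"
    using integral_abs_triangle[OF v0_int u0_int v0_int, of n m] by (simp add: err_def integral_abs_commute[of u0])
  finally show ?thesis .
qed

lemma v_close:
  assumes t: "t > 0"
  shows "(LINT x|M. \<bar>v n t x - u t x\<bar>) \<le> err n"
proof -
  have "(LINT x|M. \<bar>v n t x - u t x\<bar>) \<le> err n + err m + (LINT x|M. \<bar>v m t x - u t x\<bar>)" for m
    using integral_abs_triangle[OF v_int[OF t] v_int[OF t] u_int[OF t], of n m] v_contraction[OF t, of n m] by linarith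
  moreover have "(\<lambda>m. err n + err m + (LINT x|M. \<bar>v m t x - u t x\<bar>)) \<longlonglongrightarrow> err n + 0 + 0"
    by (intro tendsto_add tendsto_const err_lim v_lim t)
  ultimately have "(LINT x|M. \<bar>v n t x - u t x\<bar>) \<le> err n + 0 + 0"
    by (intro LIMSEQ_le_const[of _ "err n + 0 + 0"]) auto
  then show ?thesis by simp
qed

lemma v_bound: "t > 0 \<Longrightarrow> AE x in M. \<bar>v n t x\<bar> \<le> t powr (- \<gamma>) * F x"
  by (rule universal_bound[OF v_curve v_init])

lemma u_le:
  assumes t: "t > 0"
  shows "AE x in M. u t x \<le> t powr (- \<gamma>) * F x"
proof -
  have i: "integrable M (\<lambda>x. pos (u t x - t powr (- \<gamma>) * F x))"
  proof (rule Bochner_Integration.integrable_bound)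
    show "integrable M (\<lambda>x. u t x - t powr (- \<gamma>) * F x)" using u_int[OF t] F_integrable by simp
    then show "(\<lambda>x. pos (u t x - t powr (- \<gamma>) * F x)) \<in> borel_measurable M"
      by (intro measurable_compose[OF _ borel_measurable_pos]) simp
  qed (auto simp: pos_le_abs)
  have "(LINT x|M. pos (u t x - t powr (- \<gamma>) * F x)) \<le> (LINT x|M. \<bar>v n t x - u t x\<bar>)" for n
  proof (rule integral_mono_AE[OF i])
    show "integrable M (\<lambda>x. \<bar>v n t x - u t x\<bar>)" using u_int[OF t] v_int[OF t] by simp
    show "AE x in M. pos (u t x - t powr (- \<gamma>) * F x) \<le> \<bar>v n t x - u t x\<bar>"
      using v_bound[OF t, of n] by eventually_elim (auto simp: pos_def)
  qed
  then have "(LINT x|M. pos (u t x - t powr (- \<gamma>) * F x)) \<le> 0"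
    by (intro LIMSEQ_le_const[OF v_lim[OF t]]) auto
  moreover have "(LINT x|M. pos (u t x - t powr (- \<gamma>) * F x)) \<ge> 0" by simp
  ultimately have "(LINT x|M. pos (u t x - t powr (- \<gamma>) * F x)) = 0" by simp
  then have "AE x in M. pos (u t x - t powr (- \<gamma>) * F x) = 0"
    using i by (subst (asm) integral_nonneg_eq_0_iff_AE) auto
  then show ?thesis by eventually_elim (auto simp: pos_def max_def split: if_splits)
qed

lemma u_mass: "\<exists>\<mu>>0. \<exists>T>0. \<forall>t. 0 < t \<and> t < T \<longrightarrow> \<mu> \<le> (LINT x|M. u t x)"
proof -
  define \<mu> where "\<mu> = (LINT x|M. u0 x) / 2"
  have "(LINT x|M. u0 x) \<noteq> 0"
    using u0_nonzero u0_nonneg u0_int by (auto simp: integral_nonneg_eq_0_iff_AE)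
  moreover have "(LINT x|M. u0 x) \<ge> 0" using u0_nonneg by (rule integral_nonneg_AE)
  ultimately have \<mu>: "\<mu> > 0" by (simp add: \<mu>_def)
  have "\<forall>\<^sub>F n in sequentially. err n < \<mu> / 4" using err_lim \<mu> by (intro order_tendstoD) auto
  then obtain n where n: "err n < \<mu> / 4" by (auto simp: eventually_sequentially)
  have L0: "L2 M (v0 n)" using v_init by (simp add: initial_def)
  have "((\<lambda>t. n2 M (\<lambda>x. v n t x - v0 n x) * sqrt vol) \<longlongrightarrow> 0 * sqrt vol) (at_right 0)"
    using v_init by (intro tendsto_mult tendsto_const) (auto simp: initial_def)
  then have "\<forall>\<^sub>F t in at_right 0. n2 M (\<lambda>x. v n t x - v0 n x) * sqrt vol < \<mu> / 4"
    using \<mu> by (intro order_tendstoD) auto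
  then obtain T where T: "T > 0" "\<And>t. 0 < t \<Longrightarrow> t < T \<Longrightarrow> n2 M (\<lambda>x. v n t x - v0 n x) * sqrt vol < \<mu> / 4"
    by (auto simp: eventually_at_right_field)
  have "\<mu> \<le> (LINT x|M. u t x)" if t: "0 < t" "t < T" for t
  proof -
    have "(LINT x|M. \<bar>v n t x - v0 n x\<bar>) \<le> n2 M (\<lambda>x. v n t x - v0 n x) * sqrt vol"
      using t by (intro L1_le_n2 L2_diff v_L2 L0)
    then have 1: "(LINT x|M. \<bar>v n t x - v0 n x\<bar>) < \<mu> / 4" using T(2)[OF t] by linarith
    have 2: "(LINT x|M. \<bar>v n t x - u t x\<bar>) < \<mu> / 4" using v_close[of t n] t n by linarith
    have 3: "(LINT x|M. \<bar>v0 n x - u0 x\<bar>) < \<mu> / 4" using n by (simp add: err_def)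
    have "(LINT x|M. u0 x) \<le> (LINT x|M. u t x + (\<bar>v n t x - u t x\<bar> + (\<bar>v n t x - v0 n x\<bar> + \<bar>v0 n x - u0 x\<bar>)))"
      using u0_int u_int v_int v0_int t by (intro integral_mono) auto
    also have "\<dots> = (LINT x|M. u t x) + ((LINT x|M. \<bar>v n t x - u t x\<bar>) + ((LINT x|M. \<bar>v n t x - v0 n x\<bar>) + (LINT x|M. \<bar>v0 n x - u0 x\<bar>)))"
      using u0_int u_int v_int v0_int t by simp
    finally show ?thesis using 1 2 3 \<mu> by (simp add: \<mu>_def)
  qed
  then show ?thesis using \<mu> T(1) by blast
qed

lemma measure_level_ge:
  assumes f: "integrable M f" and le: "AE x in M. f x \<le> K" and c: "c \<ge> 0" and K: "K \<ge> 0"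
  shows "(LINT x|M. f x) \<le> c * vol + K * measure M {x \<in> space M. f x \<ge> c}"
proof -
  have [measurable]: "f \<in> borel_measurable M" using f by simp
  define E where "E = {x \<in> space M. f x \<ge> c}"
  have [measurable]: "E \<in> sets M" unfolding E_def by measurable
  have i: "integrable M (\<lambda>x. K * indicator E x)"
    by (intro integrable_mult_right integrable_real_indicator) (auto simp: finM.emeasure_eq_measure)
  have "(LINT x|M. f x) \<le> (LINT x|M. c + K * indicator E x)"
  proof (rule integral_mono_AE[OF f])
    show "integrable M (\<lambda>x. c + K * indicator E x)"
      using i by (intro Bochner_Integration.integrable_add finM.integrable_const)
    show "AE x in M. f x \<le> c + K * indicator E x"
      using le AE_space by eventually_elim (use c K in \<open>auto simp: indicator_def E_def\<close>)
  qed
  also have "\<dots> = (LINT x|M. c) + (LINT x|M. K * indicator E x)"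
    using i by (intro Bochner_Integration.integral_add finM.integrable_const)
  also have "\<dots> = c * vol + K * measure M E"
  proof -
    have "E \<inter> \<Omega> = E" by (auto simp: E_def)
    then show ?thesis unfolding integral_const_M by simp
  qed
  finally show ?thesis unfolding E_def .
qed

end

subsection \<open>Positivity\<close>

context profile_problem
begin

lemma F_AE_bounded_lebesgue: "AE x in M. F x \<le> Bd \<Longrightarrow> Bd \<ge> 0 \<Longrightarrow> AE x in lebesgue. F x \<le> Bd"
  unfolding AE_M_iff by (elim eventually_mono) (use F_zero in force)

lemma pos_step:
  assumes f: "frac_plaplacian p s \<Omega> f w"
    and Bd: "AE x in M. F x \<le> Bd" "Bd > 0" and k: "k > 0" and \<theta>: "\<theta> > 0" and c: "c = Bd / k"
    and c0: "c0 \<ge> 4 * c" and D: "D > 0" "\<And>x y. x \<in> \<Omega> \<Longrightarrow> y \<in> \<Omega> \<Longrightarrow> norm (x - y) \<le> D"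
  shows "(LINT x|M. w x * pos (F x - k * f x)) - (1 / \<theta>) * (LINT x|M. w x * (f x - pos (f x - c)))
    \<le> \<theta> powr (p - 1) * (LINT z|gmeasure p s. \<bar>dif F z\<bar> powr p)
      - (c0 / 4) powr (p - 1) / D powr (real DIM('a) + s * p)
        * measure M {x \<in> space M. f x \<ge> c0 / 2} * (LINT x|M. pos (F x - k * f x))"
proof -
  define \<phi> where "\<phi> x = pos (F x - k * f x)" for x
  define Tf where "Tf x = f x - pos (f x - c)" for x
  define a where "a = (c0 / 4) powr (p - 1)"
  define d where "d = 1 / D powr (real DIM('a) + s * p)"
  define B where "B = {x \<in> space M. f x \<ge> c0 / 2}"
  note fW = frac_plaplacianD(1)[OF f]
  have c_nonneg: "c \<ge> 0" using c k Bd by simp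
  have \<phi>W: "\<phi> \<in> W0"
    unfolding \<phi>_def
    using frac_sobolev0_truncate[OF p1 frac_sobolev0_diff[OF p1 F_W0 frac_sobolev0_cmult[OF p1 fW, of k]], of 0] by simp
  have TW: "Tf \<in> W0"
    unfolding Tf_def by (intro frac_sobolev0_diff[OF p1] fW frac_sobolev0_truncate[OF p1] c_nonneg)
  note [measurable] = frac_sobolev0_measurable[OF p1 fW] frac_sobolev0_measurable[OF p1 \<phi>W]
    W0_measurable_M[OF fW] W0_measurable_M[OF \<phi>W]
  have BM: "B \<in> sets M" unfolding B_def by measurable
  then have [measurable]: "B \<in> sets lebesgue" and B\<Omega>: "B \<subseteq> \<Omega>" by (auto simp: sets_restrict_space B_def)
  define h where "h z = (1 / \<theta>) * (psi p (dif f z) * dif Tf z) + \<theta> powr (p - 1) * \<bar>dif F z\<bar> powr p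
    - psi p (dif f z) * dif \<phi> z" for z
  note i1 = form_integrable[OF p1 fW TW] and i2 = frac_sobolev0_energy(1)[OF p1 F_W0]
    and i3 = form_integrable[OF p1 fW \<phi>W]
  have hi: "integrable (gmeasure p s) h"
    unfolding h_def using i1 i2 i3 by simp
  have hI: "(LINT z|gmeasure p s. h z) = (1 / \<theta>) * form p s f Tf + \<theta> powr (p - 1) * (LINT z|gmeasure p s. \<bar>dif F z\<bar> powr p) - form p s f \<phi>"
    unfolding h_def form_def using i1 i2 i3 by simp
  define G where "G z = (a * indicator B (fst z)) * (indicator \<Omega> (snd z) * \<phi> (snd z))" for z
  have G0: "0 \<le> G z" for z by (simp add: G_def a_def \<phi>_def)
  have le: "AE z in lebesgue \<Otimes>\<^sub>M (lebesgue :: 'a measure). G z \<le> h z"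
    using AE_lebesgue_pair[OF F_AE_bounded_lebesgue[OF Bd(1) less_imp_le[OF Bd(2)]]]
  proof (elim eventually_mono)
    fix z assume "F (fst z) \<le> Bd \<and> F (snd z) \<le> Bd"
    then have "psi p (f (fst z) - f (snd z)) * (pos (F (fst z) - k * f (fst z)) - pos (F (snd z) - k * f (snd z)))
      + (if f (fst z) \<ge> c0 / 2 then (c0 / 4) powr (p - 1) * pos (F (snd z) - k * f (snd z)) else 0)
    \<le> (1 / \<theta>) * (psi p (f (fst z) - f (snd z)) * ((f (fst z) - pos (f (fst z) - c)) - (f (snd z) - pos (f (snd z) - c))))
      + \<theta> powr (p - 1) * \<bar>F (fst z) - F (snd z)\<bar> powr p"
      by (intro pos_step_pointwise[OF p F_nonneg _ F_nonneg _ k \<theta> c c0]) auto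
    moreover have "G z \<le> (if f (fst z) \<ge> c0 / 2 then (c0 / 4) powr (p - 1) * pos (F (snd z) - k * f (snd z)) else 0)"
      by (auto simp: G_def a_def \<phi>_def B_def indicator_def)
    ultimately show "G z \<le> h z"
      unfolding h_def dif_def \<phi>_def Tf_def by linarith
  qed
  have hn: "AE z in gmeasure p s. 0 \<le> h z"
    using AE_gmeasure[OF le] by eventually_elim (use G0 in \<open>meson order_trans\<close>)
  have \<phi>i: "integrable M \<phi>"
  proof -
    have "integrable M (\<lambda>x. \<bar>\<phi> x\<bar> powr p + 1)"
      using integrable_restrict_space[of \<Omega> lebesgue "\<lambda>x. \<bar>\<phi> x\<bar> powr p"] integrable_mult_indicator[OF dom_sets frac_sobolev0_energy(2)[OF p1 \<phi>W]]
      by (intro Bochner_Integration.integrable_add finM.integrable_const) auto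
    then show ?thesis
    proof (rule Bochner_Integration.integrable_bound)
      have "\<bar>r\<bar> \<le> \<bar>r\<bar> powr p + 1" for r :: real
      proof (cases "\<bar>r\<bar> \<le> 1")
        case False
        then have "\<bar>r\<bar> powr 1 \<le> \<bar>r\<bar> powr p" using p by (intro powr_mono) auto
        then show ?thesis by simp
      qed (simp add: add_increasing)
      then show "AE x in M. norm (\<phi> x) \<le> norm (\<bar>\<phi> x\<bar> powr p + 1)" by (auto intro: order_trans)
    qed measurable
  qed
  have "ennreal (d * (a * measure M B) * (LINT x|M. \<phi> x)) = ennreal d * ((ennreal a * emeasure lebesgue B) * (\<integral>\<^sup>+ y. ennreal (\<phi> y) \<partial>M))"
  proof -
    have "emeasure lebesgue B = emeasure M B" using B\<Omega> by (simp add: emeasure_restrict_space)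
    also have "\<dots> = ennreal (measure M B)" by (rule finM.emeasure_eq_measure)
    finally have "emeasure lebesgue B = ennreal (measure M B)" .
    moreover have "(\<integral>\<^sup>+ y. ennreal (\<phi> y) \<partial>M) = ennreal (LINT x|M. \<phi> x)"
      by (rule nn_integral_eq_integral[OF \<phi>i]) (auto simp: \<phi>_def)
    moreover have "(LINT x|M. \<phi> x) \<ge> 0" by (intro integral_nonneg_AE) (auto simp: \<phi>_def)
    moreover have "a \<ge> 0" "d \<ge> 0" by (simp_all add: a_def d_def)
    ultimately show ?thesis by (simp add: ennreal_mult' mult.assoc del: emeasure_completion)
  qed
  also have "\<dots> = (\<integral>\<^sup>+ x. \<integral>\<^sup>+ y. ennreal d * ennreal (G (x, y)) \<partial>lebesgue \<partial>lebesgue)"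
  proof -
    have "(\<integral>\<^sup>+ y. ennreal d * ennreal (G (x, y)) \<partial>lebesgue) = (ennreal d * (\<integral>\<^sup>+ y. ennreal (\<phi> y) \<partial>M)) * (ennreal a * indicator B x)" for x
    proof -
      have "(\<integral>\<^sup>+ y. ennreal d * ennreal (G (x, y)) \<partial>lebesgue) = (\<integral>\<^sup>+ y. (ennreal d * (ennreal a * indicator B x)) * (ennreal (\<phi> y) * indicator \<Omega> y) \<partial>lebesgue)"
        by (intro nn_integral_cong) (auto simp: G_def indicator_def a_def ennreal_mult' mult.assoc)
      also have "\<dots> = (ennreal d * (ennreal a * indicator B x)) * (\<integral>\<^sup>+ y. ennreal (\<phi> y) * indicator \<Omega> y \<partial>lebesgue)"
        by (intro nn_integral_cmult) measurable
      also have "(\<integral>\<^sup>+ y. ennreal (\<phi> y) * indicator \<Omega> y \<partial>lebesgue) = (\<integral>\<^sup>+ y. ennreal (\<phi> y) \<partial>M)"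
        by (subst nn_integral_restrict_space) auto
      finally show ?thesis by (simp add: mult_ac)
    qed
    then have "(\<integral>\<^sup>+ x. \<integral>\<^sup>+ y. ennreal d * ennreal (G (x, y)) \<partial>lebesgue \<partial>lebesgue)
      = (\<integral>\<^sup>+ x. (ennreal d * (\<integral>\<^sup>+ y. ennreal (\<phi> y) \<partial>M) * ennreal a) * indicator B x \<partial>lebesgue)"
      by (simp only: mult.assoc)
    also have "\<dots> = (ennreal d * (\<integral>\<^sup>+ y. ennreal (\<phi> y) \<partial>M) * ennreal a) * emeasure lebesgue B"
      by (intro nn_integral_cmult_indicator) measurable
    finally show ?thesis by (simp only: mult_ac)
  qed
  also have "\<dots> \<le> (\<integral>\<^sup>+ x. \<integral>\<^sup>+ y. ennreal (1 / norm (x - y) powr (real DIM('a) + s * p)) * ennreal (G (x, y)) \<partial>lebesgue \<partial>lebesgue)"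
  proof (rule nn_integral_mono, rule nn_integral_mono_AE)
    fix x :: 'a
    have "AE y in lebesgue. y \<noteq> x" using AE_not_in[of "{x}" lebesgue] by simp
    then show "AE y in lebesgue. ennreal d * ennreal (G (x, y)) \<le> ennreal (1 / norm (x - y) powr (real DIM('a) + s * p)) * ennreal (G (x, y))"
    proof eventually_elim
      case (elim y)
      show ?case
      proof (cases "x \<in> B \<and> y \<in> \<Omega>")
        case True
        then have "norm (x - y) powr (real DIM('a) + s * p) \<le> D powr (real DIM('a) + s * p)"
          using D(2) B\<Omega> sp by (intro powr_mono2) auto
        then have "d \<le> 1 / norm (x - y) powr (real DIM('a) + s * p)"
          unfolding d_def using elim D by (intro divide_left_mono mult_pos_pos) auto
        then show ?thesis by (intro mult_right_mono ennreal_leI) auto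
      next
        case False
        then have "G (x, y) = 0" by (auto simp: G_def)
        then show ?thesis by simp
      qed
    qed
  qed
  also have "\<dots> = (\<integral>\<^sup>+ z. ennreal (G z) \<partial>gmeasure p s)"
    by (subst nn_integral_gmeasure) (auto simp: G_def)
  also have "\<dots> \<le> (\<integral>\<^sup>+ z. ennreal (h z) \<partial>gmeasure p s)"
    using AE_gmeasure[OF le, of p s] by (intro nn_integral_mono_AE, elim eventually_mono) (rule ennreal_leI)
  also have "\<dots> = ennreal (LINT z|gmeasure p s. h z)"
    using hi hn by (rule nn_integral_eq_integral)
  finally have "d * (a * measure M B) * (LINT x|M. \<phi> x) \<le> (LINT z|gmeasure p s. h z)"
    using integral_nonneg_AE[OF hn] by (simp add: ennreal_le_iff)
  moreover have "form p s f \<phi> = (LINT x|M. w x * \<phi> x)" "form p s f Tf = (LINT x|M. w x * Tf x)"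
    using frac_plaplacianD(3)[OF f] \<phi>W TW by auto
  ultimately show ?thesis
    unfolding hI by (simp add: a_def d_def B_def \<phi>_def Tf_def mult_ac)
qed

end

lemma pos_step_initial_bounds:
  fixes r f y :: real
  assumes "\<bar>r\<bar> \<le> K" "0 \<le> f" "f \<le> Bd" "0 \<le> y" "k > 0" "c \<ge> 0"
  shows "k * ((pos (f / k - r))\<^sup>2 / 2) \<le> Bd\<^sup>2 / k + k * K * \<bar>r - y\<bar>"
    and "(pos r)\<^sup>2 / 2 + (pos (- r))\<^sup>2 / 2 - (pos (r - c))\<^sup>2 / 2 \<le> c * K + K * \<bar>r - y\<bar>"
proof -
  have K: "K \<ge> 0" using assms(1) by simp
  have neg: "pos (- r) \<le> \<bar>r - y\<bar>" "pos (- r) \<le> K" using assms by (auto simp: pos_def)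
  then have sq: "(pos (- r))\<^sup>2 \<le> K * \<bar>r - y\<bar>" unfolding power2_eq_square by (intro mult_mono) (use K in auto)
  have "pos (f / k - r) \<le> f / k + pos (- r)" using assms by (auto simp: pos_def)
  then have "(pos (f / k - r))\<^sup>2 \<le> (f / k + pos (- r))\<^sup>2" by (intro power_mono) auto
  also have "\<dots> \<le> 2 * (f / k)\<^sup>2 + 2 * (pos (- r))\<^sup>2"
    using sum_squares_bound[of "f / k" "pos (- r)"] by (simp add: power2_sum)
  also have "\<dots> \<le> 2 * (Bd / k)\<^sup>2 + 2 * (K * \<bar>r - y\<bar>)"
    using assms sq by (intro add_mono mult_left_mono power_mono divide_right_mono) auto
  finally have "k * ((pos (f / k - r))\<^sup>2 / 2) \<le> k * ((Bd / k)\<^sup>2 + K * \<bar>r - y\<bar>)"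
    using \<open>k > 0\<close> by (intro mult_left_mono) auto
  also have "\<dots> = Bd\<^sup>2 / k + k * K * \<bar>r - y\<bar>" using \<open>k > 0\<close> by (simp add: power2_eq_square field_simps)
  finally show "k * ((pos (f / k - r))\<^sup>2 / 2) \<le> Bd\<^sup>2 / k + k * K * \<bar>r - y\<bar>" .
  have cK: "c * K \<ge> 0" using K assms by simp
  show "(pos r)\<^sup>2 / 2 + (pos (- r))\<^sup>2 / 2 - (pos (r - c))\<^sup>2 / 2 \<le> c * K + K * \<bar>r - y\<bar>"
  proof (cases "r \<le> 0")
    case True
    then have "(pos r)\<^sup>2 = 0" by (simp add: pos_def)
    moreover have "(pos (- r))\<^sup>2 / 2 \<le> (pos (- r))\<^sup>2" "0 \<le> (pos (r - c))\<^sup>2 / 2" by simp_all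
    ultimately show ?thesis using sq cK by linarith
  next
    case False
    then have r: "pos r = r" "pos (- r) = 0" by (auto simp: pos_def)
    have "r\<^sup>2 / 2 - (pos (r - c))\<^sup>2 / 2 \<le> c * r"
    proof (cases "r \<le> c")
      case True
      then have "r * r \<le> c * r" using False by (intro mult_right_mono) auto
      moreover have "pos (r - c) = 0" using True by (simp add: pos_def)
      moreover have "0 \<le> c * r" using False assms by simp
      ultimately show ?thesis by (simp add: power2_eq_square)
    next
      case False
      then have "pos (r - c) = r - c" by (simp add: pos_def)
      moreover have "r\<^sup>2 / 2 - (r - c)\<^sup>2 / 2 = c * r - c\<^sup>2 / 2" by (simp add: power2_eq_square field_simps)
      ultimately show ?thesis by simp
    qed
    also have "\<dots> \<le> c * K" using assms by (intro mult_left_mono) auto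
    finally show ?thesis using r K by (simp add: add_increasing2)
  qed
qed

context semigroup_problem
begin

text \<open>If \<open>u\<close> vanished on a set of positive measure, the long-range interaction with the region where
  \<open>u\<close> is large would push \<open>\<integral> pos(F - k v)\<^sup>2\<close> down at a rate independent of \<open>k\<close>, although this
  functional is of order \<open>1/k\<close>. The truncated energy of \<open>v\<close> absorbs the local terms.\<close>

lemma positivity:
  assumes "\<epsilon> > 0"
  shows "\<exists>t>0. (LINT x|M. (if u t x > 0 then 0 else F x)) < \<epsilon>"
proof (rule ccontr)
  assume "\<not> ?thesis"
  then have contra: "\<epsilon> \<le> (LINT x|M. (if u t x > 0 then 0 else F x))" if "t > 0" for t using that by force
  obtain \<mu> T where \<mu>: "\<mu> > 0" "T > 0" "\<And>t. 0 < t \<Longrightarrow> t < T \<Longrightarrow> \<mu> \<le> (LINT x|M. u t x)" using u_mass by blast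
  define t1 where "t1 = T / 3"
  define t2 where "t2 = 2 * T / 3"
  have t: "0 < t1" "t1 < t2" "t2 < T" using \<mu> by (auto simp: t1_def t2_def)
  obtain Bd where Bd: "Bd > 0" "AE x in M. F x \<le> Bd" using F_AE_bounded by blast
  define K where "K = t1 powr (- \<gamma>) * Bd"
  have K: "K > 0" using t Bd by (simp add: K_def)
  have FK: "AE x in M. t powr (- \<gamma>) * F x \<le> K" if "t \<ge> t1" for t
    using Bd(2)
  proof eventually_elim
    case (elim x)
    have "t powr (- \<gamma>) \<le> t1 powr (- \<gamma>)"
    proof (rule powr_mono2')
      show "- \<gamma> \<le> 0" using \<gamma>_pos by linarith
    qed (use t that in auto)
    then show ?case unfolding K_def using elim F_nonneg[of x] by (intro mult_mono) auto
  qed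
  define c0 where "c0 = \<mu> / (vol + 1)"
  have c0: "c0 > 0" using \<mu> vol_nonneg by (simp add: c0_def)
  have c0vol: "c0 / 2 * vol \<le> \<mu> / 2"
  proof -
    have "c0 * vol \<le> c0 * (vol + 1)" using c0 by (intro mult_left_mono) auto
    also have "\<dots> = \<mu>" using vol_nonneg by (simp add: c0_def)
    finally show ?thesis by simp
  qed
  define b0 where "b0 = \<mu> / (4 * K)"
  have b0: "b0 > 0" using \<mu> K by (simp add: b0_def)
  obtain D where D: "D > 0" "\<And>x y. x \<in> \<Omega> \<Longrightarrow> y \<in> \<Omega> \<Longrightarrow> norm (x - y) \<le> D"
  proof -
    obtain R where R: "\<And>x. x \<in> \<Omega> \<Longrightarrow> norm x \<le> R" using bounded_dom by (auto simp: bounded_iff)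
    have "norm (x - y) \<le> \<bar>R\<bar> + \<bar>R\<bar> + 1" if "x \<in> \<Omega>" "y \<in> \<Omega>" for x y
      using norm_triangle_ineq4[of x y] R[OF that(1)] R[OF that(2)] by linarith
    then show ?thesis using that[of "\<bar>R\<bar> + \<bar>R\<bar> + 1"] by fastforce
  qed
  define EF where "EF = (LINT z|gmeasure p s. \<bar>dif F z\<bar> powr p)"
  have EF: "EF \<ge> 0" unfolding EF_def by (intro integral_nonneg_AE) auto
  define \<kappa> where "\<kappa> = (c0 / 4) powr (p - 1) / D powr (real DIM('a) + s * p)"
  have \<kappa>: "\<kappa> > 0" using c0 D by (simp add: \<kappa>_def)
  define q where "q = \<kappa> * b0 * (\<epsilon> / 2)"
  have q: "q > 0" using \<kappa> b0 \<open>\<epsilon> > 0\<close> by (simp add: q_def)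
  define \<theta> where "\<theta> = (q / (2 * (EF + 1))) powr (1 / (p - 1))"
  have \<theta>: "\<theta> > 0" using q EF by (simp add: \<theta>_def)
  have \<theta>EF: "\<theta> powr (p - 1) * EF \<le> q / 2"
  proof -
    have "\<theta> powr (p - 1) = q / (2 * (EF + 1))" using q EF p by (simp add: \<theta>_def powr_powr)
    then have "\<theta> powr (p - 1) * EF = q / 2 * (EF / (EF + 1))" by simp
    also have "\<dots> \<le> q / 2 * 1" using q EF by (intro mult_left_mono) auto
    finally show ?thesis by simp
  qed
  define m where "m = q / 2 * (t2 - t1)"
  have m: "m > 0" using q t by (simp add: m_def)
  define C1 where "C1 = vol * (Bd\<^sup>2 + Bd * K / \<theta>)"
  have C1: "C1 \<ge> 0" using vol_nonneg Bd K \<theta> by (simp add: C1_def)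
  define k where "k = max (4 * Bd / c0) (2 * (C1 + 1) / m)"
  have k: "k > 0" using Bd c0 by (simp add: k_def less_max_iff_disj)
  have "4 * Bd / c0 \<le> k" by (simp add: k_def)
  define c where "c = Bd / k"
  have c: "c \<ge> 0" "4 * c \<le> c0"
    using Bd k c0 \<open>4 * Bd / c0 \<le> k\<close> by (auto simp: c_def field_simps)
  have C1k: "C1 / k < m / 2"
  proof -
    have "2 * (C1 + 1) / m \<le> k" by (simp add: k_def)
    then have "2 * (C1 + 1) \<le> k * m" using m by (simp add: field_simps)
    then show ?thesis using k C1 by (simp add: field_simps)
  qed
  define C2 where "C2 = k * K + K / \<theta>"
  have C2: "C2 > 0" using k K \<theta> by (simp add: C2_def add_pos_pos)
  have "\<forall>\<^sub>F n in sequentially. err n < min (\<mu> / 4) (min (\<epsilon> / (2 * k)) (m / (2 * C2)))"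
    using \<mu> k m C2 \<open>\<epsilon> > 0\<close> by (intro order_tendstoD(2)[OF err_lim]) simp
  then obtain n where n: "err n < \<mu> / 4" "err n < \<epsilon> / (2 * k)" "err n < m / (2 * C2)"
    by (auto simp: eventually_sequentially)
  have n2: "k * err n \<le> \<epsilon> / 2" using n(2) k by (simp add: field_simps)
  have n3: "C2 * err n < m / 2" using n(3) C2 by (simp add: field_simps)
  define Y where "Y = (\<lambda>t x. 0 - (v n t x - (1 / k) * F x))"
  have cv: "l2_curve M (v n)" using v_curve by (simp add: strong_curve_def)
  have c_zero: "l2_curve M (\<lambda>t x. 0 * F x)" by (rule l2_curve_scalar[OF F_L2]) (auto intro: exI[of _ 0])
  have d_zero: "l2_deriv M (\<lambda>t x. 0 * F x) (\<lambda>x. 0 * F x) r" for r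
    by (rule l2_deriv_scalar[OF F_L2]) simp
  have ckF: "l2_curve M (\<lambda>t x. v n t x - (1 / k) * F x)"
    by (rule l2_curve_minus_const[OF cv L2_cmult[OF F_L2]])
  have cY: "l2_curve M Y" using l2_curve_diff[OF c_zero ckF] by (simp add: Y_def)
  have cN: "l2_curve M (\<lambda>t x. 0 * F x - v n t x)" by (rule l2_curve_diff[OF c_zero cv])
  have cC: "l2_curve M (\<lambda>t x. v n t x - c)" by (rule l2_curve_minus_const[OF cv L2_const[OF finite_measure_M]])
  define g where "g t = k * pos_energy M (Y t) + (1 / \<theta>) * ((pos_energy M (v n t) + pos_energy M (\<lambda>x. 0 * F x - v n t x))
    + (- 1) * pos_energy M (\<lambda>x. v n t x - c))" for t
  obtain N where N: "negligible N"
    "\<And>t. t > 0 \<Longrightarrow> t \<notin> N \<Longrightarrow> \<exists>f. frac_plaplacian p s \<Omega> (v n t) f \<and> l2_deriv M (v n) (\<lambda>x. - f x) t"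
    using v_curve unfolding strong_curve_def by blast
  have dec: "g t2 - g t1 \<le> (- (q / 2)) * (t2 - t1)"
  proof (rule abs_cont_increment_le[where N = N])
    show "abs_cont t1 t2 g"
      unfolding g_def using t
      by (intro abs_cont_add abs_cont_cmult pos_energy_abs_cont cY cv cN cC) auto
    fix r assume r: "r \<in> {t1..t2} - N"
    then have r0: "r > 0" "r \<ge> t1" "r < T" using t by auto
    obtain w where w: "frac_plaplacian p s \<Omega> (v n r) w" "l2_deriv M (v n) (\<lambda>x. - w x) r" using N(2) r r0 by blast
    have wL: "L2 M w" using frac_plaplacianD(2)[OF w(1)] by (simp add: Lq_space_2)
    note vL = v_L2[OF r0(1), of n]
    have dY: "l2_deriv M Y w r"
      using l2_deriv_diff[OF c_zero ckF r0(1) d_zero l2_deriv_minus_const[OF w(2)]] by (simp add: Y_def)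
    have dN: "l2_deriv M (\<lambda>t x. 0 * F x - v n t x) w r"
      using l2_deriv_diff[OF c_zero cv r0(1) d_zero w(2)] by simp
    have dC: "l2_deriv M (\<lambda>t x. v n t x - c) (\<lambda>x. - w x) r" by (rule l2_deriv_minus_const[OF w(2)])
    define Dg where "Dg = k * (LINT x|M. pos (Y r x) * w x) + (1 / \<theta>) * (((LINT x|M. pos (v n r x) * - w x) + (LINT x|M. pos (0 * F x - v n r x) * w x))
      + (- 1) * (LINT x|M. pos (v n r x - c) * - w x))"
    have Dg: "(g has_real_derivative Dg) (at r)"
      unfolding g_def Dg_def
      by (intro DERIV_add DERIV_cmult pos_energy_deriv cY cv cN cC dY dN dC w(2) r0(1))
    have "k * (LINT x|M. pos (Y r x) * w x) = (LINT x|M. w x * pos (F x - k * v n r x))"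
    proof -
      have "k * pos (Y r x) = pos (F x - k * v n r x)" for x
      proof -
        have "k * pos a = pos (k * a)" for a using k by (auto simp: pos_def max_def zero_le_mult_iff mult_le_0_iff)
        then show ?thesis using k by (simp add: Y_def right_diff_distrib)
      qed
      then have eq: "k * (pos (Y r x) * w x) = w x * pos (F x - k * v n r x)" for x
        by (simp add: mult.assoc[symmetric] mult.commute)
      have "k * (LINT x|M. pos (Y r x) * w x) = (LINT x|M. k * (pos (Y r x) * w x))" by simp
      also have "\<dots> = (LINT x|M. w x * pos (F x - k * v n r x))"
        by (intro Bochner_Integration.integral_cong refl eq)
      finally show ?thesis .
    qed
    moreover have "((LINT x|M. pos (v n r x) * - w x) + (LINT x|M. pos (0 * F x - v n r x) * w x))
      + (- 1) * (LINT x|M. pos (v n r x - c) * - w x) = - (LINT x|M. w x * (v n r x - pos (v n r x - c)))"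
    proof -
      have nw: "L2 M (\<lambda>x. - w x)" using L2_cmult[OF wL, of "-1"] by simp
      have i: "integrable M (\<lambda>x. pos (v n r x) * - w x)" "integrable M (\<lambda>x. pos (0 * F x - v n r x) * w x)"
        "integrable M (\<lambda>x. pos (v n r x - c) * - w x)"
        by (intro L2_mult_integrable L2_pos L2_diff L2_cmult vL wL nw F_L2 L2_const finite_measure_M)+
      have "((LINT x|M. pos (v n r x) * - w x) + (LINT x|M. pos (0 * F x - v n r x) * w x))
        + (- 1) * (LINT x|M. pos (v n r x - c) * - w x)
        = (LINT x|M. (pos (v n r x) * - w x + pos (0 * F x - v n r x) * w x) - pos (v n r x - c) * - w x)"
        unfolding Bochner_Integration.integral_diff[OF Bochner_Integration.integrable_add[OF i(1,2)] i(3)]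
          Bochner_Integration.integral_add[OF i(1,2)] by simp
      also have "\<dots> = (LINT x|M. - (w x * (v n r x - pos (v n r x - c))))"
      proof (intro Bochner_Integration.integral_cong refl)
        fix x
        have "pos (v n r x) - pos (0 * F x - v n r x) = v n r x" by (simp add: pos_def)
        then show "(pos (v n r x) * - w x + pos (0 * F x - v n r x) * w x) - pos (v n r x - c) * - w x
          = - (w x * (v n r x - pos (v n r x - c)))" by (metis (no_types, opaque_lifting) add.commute left_diff_distrib minus_diff_eq mult.commute mult_minus_right uminus_add_conv_diff)
      qed
      finally show ?thesis by simp
    qed
    ultimately have "Dg = (LINT x|M. w x * pos (F x - k * v n r x)) - (1 / \<theta>) * (LINT x|M. w x * (v n r x - pos (v n r x - c)))"
      unfolding Dg_def by simp
    also have "\<dots> \<le> \<theta> powr (p - 1) * EF - \<kappa> * measure M {x \<in> space M. v n r x \<ge> c0 / 2} * (LINT x|M. pos (F x - k * v n r x))"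
      unfolding EF_def \<kappa>_def by (rule pos_step[OF w(1) Bd(2,1) k \<theta> c_def c(2) D])
    also have "\<dots> \<le> \<theta> powr (p - 1) * EF - \<kappa> * b0 * (\<epsilon> / 2)"
    proof -
      have close: "(LINT x|M. \<bar>v n r x - u r x\<bar>) \<le> err n" by (rule v_close[OF r0(1)])
      have "b0 \<le> measure M {x \<in> space M. v n r x \<ge> c0 / 2}"
      proof -
        have "\<mu> \<le> (LINT x|M. u r x)" using \<mu>(3) r0 by simp
        also have "\<dots> \<le> (LINT x|M. v n r x + \<bar>v n r x - u r x\<bar>)"
          using u_int v_int r0 by (intro integral_mono) auto
        also have "\<dots> = (LINT x|M. v n r x) + (LINT x|M. \<bar>v n r x - u r x\<bar>)"
          using u_int v_int r0 by simp
        finally have "3 * \<mu> / 4 \<le> (LINT x|M. v n r x)" using close n(1) by linarith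
        moreover have "(LINT x|M. v n r x) \<le> c0 / 2 * vol + K * measure M {x \<in> space M. v n r x \<ge> c0 / 2}"
        proof (rule measure_level_ge[OF v_int[OF r0(1)]])
          show "AE x in M. v n r x \<le> K"
            using v_bound[OF r0(1), of n] FK[OF r0(2)] by eventually_elim linarith
        qed (use c0 K in auto)
        ultimately have "\<mu> / 4 \<le> K * measure M {x \<in> space M. v n r x \<ge> c0 / 2}" using c0vol by linarith
        then show ?thesis using K by (simp add: b0_def field_simps)
      qed
      moreover have "\<epsilon> / 2 \<le> (LINT x|M. pos (F x - k * v n r x))"
      proof -
        have ip: "integrable M (\<lambda>x. pos (F x - k * v n r x))" by (intro integrable_pos L2_diff L2_cmult F_L2 vL)
        have iu: "integrable M (\<lambda>x. \<bar>v n r x - u r x\<bar>)" using u_int v_int r0 by simp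
        have "\<epsilon> \<le> (LINT x|M. (if u r x > 0 then 0 else F x))" using contra r0 by simp
        also have "\<dots> \<le> (LINT x|M. pos (F x - k * v n r x) + k * \<bar>v n r x - u r x\<bar>)"
        proof (rule integral_mono_AE)
          note [measurable] = borel_measurable_integrable[OF u_int[OF r0(1)]]
          show "integrable M (\<lambda>x. if u r x > 0 then 0 else F x)"
            by (rule Bochner_Integration.integrable_bound[OF F_integrable]) (auto simp: F_nonneg)
          show "integrable M (\<lambda>x. pos (F x - k * v n r x) + k * \<bar>v n r x - u r x\<bar>)"
            using ip iu by simp
          show "AE x in M. (if u r x > 0 then 0 else F x) \<le> pos (F x - k * v n r x) + k * \<bar>v n r x - u r x\<bar>"
            using u_nonneg[OF r0(1)]
          proof eventually_elim
            case (elim x)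
            show ?case
            proof (cases "u r x > 0")
              case False
              then have "u r x = 0" using elim by simp
              moreover have "k * v n r x \<le> k * \<bar>v n r x\<bar>" using k by simp
              ultimately show ?thesis by (auto simp: pos_def)
            qed (use k in simp)
          qed
        qed
        also have "\<dots> = (LINT x|M. pos (F x - k * v n r x)) + k * (LINT x|M. \<bar>v n r x - u r x\<bar>)"
          using ip iu by simp
        also have "\<dots> \<le> (LINT x|M. pos (F x - k * v n r x)) + k * err n"
          using close k by (intro add_left_mono mult_left_mono) auto
        finally show ?thesis using n2 by linarith
      qed
      ultimately have "b0 * (\<epsilon> / 2) \<le> measure M {x \<in> space M. v n r x \<ge> c0 / 2} * (LINT x|M. pos (F x - k * v n r x))"
        using b0 \<open>\<epsilon> > 0\<close> by (intro mult_mono) auto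
      then have "\<kappa> * (b0 * (\<epsilon> / 2)) \<le> \<kappa> * (measure M {x \<in> space M. v n r x \<ge> c0 / 2} * (LINT x|M. pos (F x - k * v n r x)))"
        using \<kappa> by (intro mult_left_mono) auto
      then show ?thesis by (simp add: mult.assoc)
    qed
    also have "\<dots> \<le> - (q / 2)" using \<theta>EF by (simp add: q_def)
    finally show "\<exists>D\<le>- (q / 2). (g has_real_derivative D) (at r)" using Dg by blast
  qed (use t N in auto)
  have g2: "g t2 \<ge> 0"
  proof -
    have t20: "t2 > 0" using t by simp
    have "pos_energy M (\<lambda>x. v n t2 x - c) \<le> pos_energy M (v n t2)"
      unfolding pos_energy_def using c
      by (intro integral_mono pos_energy_integrable L2_diff v_L2 t20 L2_const finite_measure_M divide_right_mono power_mono pos_mono) auto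
    then show ?thesis
      using k \<theta> pos_energy_nonneg[of M] by (simp add: g_def add_nonneg_nonneg add_increasing2)
  qed
  have g1: "g t1 \<le> C1 / k + C2 * err n"
  proof -
    note vL = v_L2[OF t(1), of n]
    have i: "integrable M (\<lambda>x. (pos (Y t1 x))\<^sup>2 / 2)" "integrable M (\<lambda>x. (pos (v n t1 x))\<^sup>2 / 2)"
      "integrable M (\<lambda>x. (pos (0 * F x - v n t1 x))\<^sup>2 / 2)" "integrable M (\<lambda>x. (pos (v n t1 x - c))\<^sup>2 / 2)"
      by (intro pos_energy_integrable l2_curve_L2[OF cY t(1)] vL l2_curve_L2[OF cN t(1)] l2_curve_L2[OF cC t(1)])+
    have iu: "integrable M (\<lambda>x. \<bar>v n t1 x - u t1 x\<bar>)" using u_int v_int t by simp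
    have "g t1 = (LINT x|M. k * ((pos (Y t1 x))\<^sup>2 / 2) + (1 / \<theta>) * ((pos (v n t1 x))\<^sup>2 / 2 + (pos (0 * F x - v n t1 x))\<^sup>2 / 2 - (pos (v n t1 x - c))\<^sup>2 / 2))"
    proof -
      have lin: "k * integral\<^sup>L M e1 + (1 / \<theta>) * ((integral\<^sup>L M e2 + integral\<^sup>L M e3) + (- 1) * integral\<^sup>L M e4)
        = (LINT x|M. k * e1 x + (1 / \<theta>) * (e2 x + e3 x - e4 x))"
        if "integrable M e1" "integrable M e2" "integrable M e3" "integrable M e4" for e1 e2 e3 e4
        using that by simp
      show ?thesis unfolding g_def pos_energy_def by (rule lin[OF i])
    qed
    also have "\<dots> \<le> (LINT x|M. (Bd\<^sup>2 / k + (1 / \<theta>) * (c * K)) + C2 * \<bar>v n t1 x - u t1 x\<bar>)"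
    proof (rule integral_mono_AE)
      show "integrable M (\<lambda>x. k * ((pos (Y t1 x))\<^sup>2 / 2) + (1 / \<theta>) * ((pos (v n t1 x))\<^sup>2 / 2 + (pos (0 * F x - v n t1 x))\<^sup>2 / 2 - (pos (v n t1 x - c))\<^sup>2 / 2))"
        using i by (intro Bochner_Integration.integrable_add Bochner_Integration.integrable_diff integrable_mult_right)
      show "integrable M (\<lambda>x. (Bd\<^sup>2 / k + (1 / \<theta>) * (c * K)) + C2 * \<bar>v n t1 x - u t1 x\<bar>)"
        using iu by (intro Bochner_Integration.integrable_add finM.integrable_const integrable_mult_right)
      show "AE x in M. k * ((pos (Y t1 x))\<^sup>2 / 2) + (1 / \<theta>) * ((pos (v n t1 x))\<^sup>2 / 2 + (pos (0 * F x - v n t1 x))\<^sup>2 / 2 - (pos (v n t1 x - c))\<^sup>2 / 2)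
        \<le> (Bd\<^sup>2 / k + (1 / \<theta>) * (c * K)) + C2 * \<bar>v n t1 x - u t1 x\<bar>"
        using v_bound[OF t(1), of n] FK[OF order_refl] Bd(2) u_nonneg[OF t(1)]
      proof eventually_elim
        case (elim x)
        then have vK: "\<bar>v n t1 x\<bar> \<le> K" by linarith
        note b = pos_step_initial_bounds[OF vK F_nonneg[of x] elim(3) elim(4) k c(1)]
        have "(1 / \<theta>) * ((pos (v n t1 x))\<^sup>2 / 2 + (pos (0 * F x - v n t1 x))\<^sup>2 / 2 - (pos (v n t1 x - c))\<^sup>2 / 2)
          \<le> (1 / \<theta>) * (c * K + K * \<bar>v n t1 x - u t1 x\<bar>)"
          using b(2) \<theta> by (intro mult_left_mono) auto
        moreover have "k * ((pos (Y t1 x))\<^sup>2 / 2) \<le> Bd\<^sup>2 / k + k * K * \<bar>v n t1 x - u t1 x\<bar>"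
          using b(1) by (simp add: Y_def)
        ultimately have "k * ((pos (Y t1 x))\<^sup>2 / 2) + (1 / \<theta>) * ((pos (v n t1 x))\<^sup>2 / 2 + (pos (0 * F x - v n t1 x))\<^sup>2 / 2 - (pos (v n t1 x - c))\<^sup>2 / 2)
          \<le> (Bd\<^sup>2 / k + k * K * \<bar>v n t1 x - u t1 x\<bar>) + (1 / \<theta>) * (c * K + K * \<bar>v n t1 x - u t1 x\<bar>)"
          by (rule add_mono[rotated])
        also have "\<dots> = (Bd\<^sup>2 / k + (1 / \<theta>) * (c * K)) + C2 * \<bar>v n t1 x - u t1 x\<bar>"
          by (simp add: C2_def distrib_left distrib_right)
        finally show ?case .
      qed
    qed
    also have "\<dots> = (LINT x|M. (Bd\<^sup>2 / k + (1 / \<theta>) * (c * K))) + (LINT x|M. C2 * \<bar>v n t1 x - u t1 x\<bar>)"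
      using iu by (intro Bochner_Integration.integral_add finM.integrable_const integrable_mult_right)
    also have "\<dots> = (Bd\<^sup>2 / k + (1 / \<theta>) * (c * K)) * vol + C2 * (LINT x|M. \<bar>v n t1 x - u t1 x\<bar>)"
      unfolding integral_const_M by simp
    also have "\<dots> \<le> (Bd\<^sup>2 / k + (1 / \<theta>) * (c * K)) * vol + C2 * err n"
      using v_close[OF t(1), of n] C2 by (intro add_left_mono mult_left_mono) auto
    also have "(Bd\<^sup>2 / k + (1 / \<theta>) * (c * K)) * vol = C1 / k"
      using k \<theta> by (simp add: C1_def c_def field_simps)
    finally show ?thesis .
  qed
  have "g t2 - g t1 \<le> - m" using dec by (simp add: m_def)
  then show False using g2 g1 C1k n3 by linarith
qed

end

subsection \<open>Smoothing of differences of solutions\<close>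

context dirichlet_problem
begin

lemma emeasure_level_le:
  assumes z: "z \<in> W0" and a: "a > 0" and i: "integrable M z"
  shows "emeasure lebesgue {x. z x > a} \<le> ennreal ((LINT x|M. \<bar>z x\<bar>) / a)"
proof -
  note [measurable] = frac_sobolev0_measurable[OF p1 z]
  have S[measurable]: "{x. z x > a} \<in> sets lebesgue" using measurable_sets[of z lebesgue borel "{a<..}"] by (simp add: vimage_def)
  have "ennreal a * emeasure lebesgue {x. z x > a} = (\<integral>\<^sup>+ x. ennreal a * indicator {x. z x > a} x \<partial>lebesgue)"
    using S by (rule nn_integral_cmult_indicator[symmetric])
  also have "\<dots> \<le> (\<integral>\<^sup>+ x. ennreal \<bar>z x\<bar> * indicator \<Omega> x \<partial>lebesgue)"
    using W0_zero[OF z] by (intro nn_integral_mono_AE, elim eventually_mono) (use a in \<open>auto simp: indicator_def intro!: ennreal_leI\<close>)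
  also have "\<dots> = (\<integral>\<^sup>+ x. ennreal \<bar>z x\<bar> \<partial>M)" by (subst nn_integral_restrict_space) auto
  also have "\<dots> = ennreal (LINT x|M. \<bar>z x\<bar>)" using i by (intro nn_integral_eq_integral) auto
  also have "\<dots> = ennreal a * ennreal ((LINT x|M. \<bar>z x\<bar>) / a)" using a by (simp flip: ennreal_mult')
  finally show ?thesis using a by (simp add: ennreal_mult_le_mult_iff)
qed

lemma form_diff_ge_killing:
  assumes W: "f \<in> W0" "g \<in> W0" and L: "L2 M f" "L2 M g" and m: "m > 0" and r: "r > 0"
    and small: "2 * (LINT x|M. \<bar>f x - g x\<bar>) / m \<le> unit_ball_vol (real DIM('a)) / 2 * r ^ DIM('a)"
  shows "killing_rate TYPE('a) p s r * (m / 4) powr (p - 1) * (LINT x|M. pos (f x - g x - m))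
    \<le> form p s f (\<lambda>x. pos (f x - g x - m)) - form p s g (\<lambda>x. pos (f x - g x - m))"
proof -
  define z where "z x = f x - g x" for x
  define \<phi> where "\<phi> x = pos (z x - m)" for x
  have zW: "z \<in> W0" unfolding z_def by (rule frac_sobolev0_diff[OF p1 W])
  have \<phi>W: "\<phi> \<in> W0" unfolding \<phi>_def using m by (intro frac_sobolev0_truncate[OF p1 zW]) simp
  have zL: "L2 M z" unfolding z_def by (rule L2_diff[OF L])
  note [measurable] = frac_sobolev0_measurable[OF p1 zW] frac_sobolev0_measurable[OF p1 \<phi>W]
  define h where "h y = (psi p (dif f y) - psi p (dif g y)) * dif \<phi> y" for y
  have hi: "integrable (gmeasure p s) h"
    unfolding h_def left_diff_distrib by (intro Bochner_Integration.integrable_diff form_integrable[OF p1 W(1) \<phi>W] form_integrable[OF p1 W(2) \<phi>W])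
  have hI: "(LINT y|gmeasure p s. h y) = form p s f \<phi> - form p s g \<phi>"
    unfolding h_def left_diff_distrib form_def
    by (intro Bochner_Integration.integral_diff form_integrable[OF p1 W(1) \<phi>W] form_integrable[OF p1 W(2) \<phi>W])
  have h0: "0 \<le> h y" for y
    unfolding h_def
    by (rule psi_diff_mult_nonneg[OF p2]) (auto simp: dif_def \<phi>_def z_def pos_def)
  define S where "S = {x. z x > m / 2}"
  have [measurable]: "S \<in> sets lebesgue"
    unfolding S_def using measurable_sets[of z lebesgue borel "{m/2<..}"] by (simp add: vimage_def)
  have "emeasure lebesgue S \<le> ennreal ((LINT x|M. \<bar>z x\<bar>) / (m / 2))"
    unfolding S_def using m by (intro emeasure_level_le zW L2_integrable[OF finite_measure_M zL]) simp
  also have "\<dots> \<le> ennreal (unit_ball_vol (real DIM('a)) / 2 * r ^ DIM('a))"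
    using small by (intro ennreal_leI) (simp add: z_def mult.commute)
  finally have S: "emeasure lebesgue S \<le> ennreal (unit_ball_vol (real DIM('a)) / 2 * r ^ DIM('a))" .
  have le: "snd y \<notin> S \<longrightarrow> (m / 4) powr (p - 1) * \<phi> (fst y) \<le> h y" for y
  proof
    assume y: "snd y \<notin> S"
    show "(m / 4) powr (p - 1) * \<phi> (fst y) \<le> h y"
    proof (cases "z (fst y) > m")
      case True
      have dz: "dif f y - dif g y \<ge> m / 2" using True y by (simp add: S_def dif_def z_def)
      have "(m / 4) powr (p - 1) \<le> ((dif f y - dif g y) / 2) powr (p - 1)"
        using dz m p by (intro powr_mono2) auto
      also have "\<dots> \<le> psi p (dif f y) - psi p (dif g y)" using dz m by (intro psi_diff_ge p2) auto
      finally have "(m / 4) powr (p - 1) * \<phi> (fst y) \<le> (psi p (dif f y) - psi p (dif g y)) * \<phi> (fst y)"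
        by (intro mult_right_mono) (auto simp: \<phi>_def)
      moreover have "dif \<phi> y = \<phi> (fst y)" using y m by (simp add: dif_def S_def \<phi>_def pos_def)
      ultimately show ?thesis by (simp add: h_def)
    next
      case False
      then have "\<phi> (fst y) = 0" by (simp add: \<phi>_def pos_def)
      then show ?thesis using h0[of y] by simp
    qed
  qed
  have \<phi>i: "integrable M \<phi>"
    unfolding \<phi>_def by (intro integrable_pos L2_diff zL L2_const finite_measure_M)
  have I0: "0 \<le> (LINT x|M. \<phi> x)" by (intro integral_nonneg_AE) (auto simp: \<phi>_def)
  have k0: "0 \<le> killing_rate TYPE('a) p s r" using killing_rate_pos[OF r, where p = p and s = s] by (rule less_imp_le)
  have "ennreal (killing_rate TYPE('a) p s r * ((m / 4) powr (p - 1) * (LINT x|M. \<phi> x)))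
    = ennreal (killing_rate TYPE('a) p s r) * (\<integral>\<^sup>+ x. ennreal ((m / 4) powr (p - 1) * \<phi> x) \<partial>M)"
  proof -
    have "(\<integral>\<^sup>+ x. ennreal ((m / 4) powr (p - 1) * \<phi> x) \<partial>M) = ennreal (LINT x|M. (m / 4) powr (p - 1) * \<phi> x)"
    proof (rule nn_integral_eq_integral)
      show "integrable M (\<lambda>x. (m / 4) powr (p - 1) * \<phi> x)" using \<phi>i by simp
    qed (simp add: \<phi>_def)
    then show ?thesis using k0 by (simp add: ennreal_mult')
  qed
  also have "\<dots> \<le> ennreal (killing_rate TYPE('a) p s r) * (\<integral>\<^sup>+ x. ennreal ((m / 4) powr (p - 1) * \<phi> x) \<partial>lebesgue)"
    by (intro mult_left_mono, subst nn_integral_restrict_space) (auto intro!: nn_integral_mono simp: indicator_def)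
  also have "\<dots> \<le> ennreal (LINT y|gmeasure p s. h y)"
  proof (rule integral_ge_killing[OF _ r sp S hi h0])
    show "AE y in lebesgue \<Otimes>\<^sub>M lebesgue. snd y \<notin> S \<longrightarrow> (m / 4) powr (p - 1) * \<phi> (fst y) \<le> h y"
      using le by simp
  qed measurable
  finally have "killing_rate TYPE('a) p s r * ((m / 4) powr (p - 1) * (LINT x|M. \<phi> x)) \<le> (LINT y|gmeasure p s. h y)"
    using Bochner_Integration.integral_nonneg_AE[where f = h and M = "gmeasure p s"] h0 by (simp add: ennreal_le_iff)
  moreover have "\<phi> = (\<lambda>x. pos (f x - g x - m))" by (simp add: \<phi>_def z_def fun_eq_iff)
  ultimately show ?thesis unfolding hI by (simp add: mult.assoc)
qed

end

context semigroup_problem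
begin

text \<open>On the small set where the difference \<open>z\<close> exceeds half the level \<open>m(t)\<close>, the nonlocal
  absorption is strong enough to let \<open>m(t)\<close> decrease linearly.\<close>

lemma smoothing:
  assumes T: "T > 0" and B: "AE x in M. F x \<le> B" "B > 0" and \<eta>: "0 < \<eta>" "\<eta> \<le> 2 * B" and r: "r > 0"
    and rate: "2 * B * (4 / \<eta>) powr (p - 1) \<le> killing_rate TYPE('a) p s r"
    and small: "2 * d / \<eta> \<le> unit_ball_vol (real DIM('a)) / 2 * r ^ DIM('a)"
    and close: "\<And>t. T \<le> t \<Longrightarrow> t \<le> 2 * T \<Longrightarrow> (LINT x|M. \<bar>t powr (- \<gamma>) * F x - v n t x\<bar>) \<le> T powr (- \<gamma>) * d"
  shows "AE x in M. (2 * T) powr (- \<gamma>) * F x - v n (2 * T) x \<le> \<eta> * T powr (- \<gamma>)"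
proof -
  define a where "a = T powr (- \<gamma>)"
  have a: "a > 0" using T by (simp add: a_def)
  define l where "l = (2 * B - \<eta>) * a / T"
  have l: "l \<ge> 0" using \<eta> a T by (simp add: l_def)
  define m where "m t = \<eta> * a + l * (2 * T - t)" for t
  have m_ge: "m t \<ge> \<eta> * a" if "t \<le> 2 * T" for t using that l by (simp add: m_def)
  have mT: "m T = 2 * B * a" "m (2 * T) = \<eta> * a" 
  proof -
    have "l * T = (2 * B - \<eta>) * a" using T by (simp add: l_def)
    then show "m T = 2 * B * a" "m (2 * T) = \<eta> * a" by (simp_all add: m_def left_diff_distrib)
  qed
  define U where "U = (\<lambda>t x. t powr (- \<gamma>) * F x)"
  have U: "strong_curve U" using sep_strong[of 1 0] by (simp add: U_def)
  have cU: "l2_curve M U" and cv: "l2_curve M (v n)" using U v_curve by (auto simp: strong_curve_def)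
  have one: "L2 M (\<lambda>x. 1)" by (rule L2_const[OF finite_measure_M])
  have cz: "l2_curve M (\<lambda>t x. U t x - v n t x)" by (rule l2_curve_diff[OF cU cv])
  have cm: "l2_curve M (\<lambda>t x. m t * 1)"
  proof (rule l2_curve_scalar[OF one], intro exI[of _ l] ballI)
    fix s t show "\<bar>m t - m s\<bar> \<le> l * \<bar>t - s\<bar>"
    proof -
      have "m t - m s = l * (s - t)" by (simp add: m_def algebra_simps)
      then show ?thesis using l by (simp add: abs_mult abs_minus_commute)
    qed
  qed
  define Y where "Y = (\<lambda>t x. (U t x - v n t x) - m t * 1)"
  have cY: "l2_curve M Y" unfolding Y_def by (rule l2_curve_diff[OF cz cm])
  have YL: "L2 M (Y t)" if "t > 0" for t using cY that by (rule l2_curve_L2)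
  obtain N1 N2 where N: "negligible N1" "negligible N2"
    "\<And>t. t > 0 \<Longrightarrow> t \<notin> N1 \<Longrightarrow> \<exists>f. frac_plaplacian p s \<Omega> (U t) f \<and> l2_deriv M U (\<lambda>x. - f x) t"
    "\<And>t. t > 0 \<Longrightarrow> t \<notin> N2 \<Longrightarrow> \<exists>f. frac_plaplacian p s \<Omega> (v n t) f \<and> l2_deriv M (v n) (\<lambda>x. - f x) t"
    using U v_curve[of n] unfolding strong_curve_def by metis
  have "pos_energy M (Y (2 * T)) \<le> pos_energy M (Y T)"
  proof (rule abs_cont_increment_nonpos[where N = "N1 \<union> N2" and g = "\<lambda>t. pos_energy M (Y t)" and a = T and b = "2 * T"])
    show "abs_cont T (2 * T) (\<lambda>t. pos_energy M (Y t))" using T by (intro pos_energy_abs_cont cY) auto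
    show "negligible (N1 \<union> N2)" using N by (simp add: negligible_Un)
    fix t assume t: "t \<in> {T..2 * T} - (N1 \<union> N2)"
    then have t0: "t > 0" "T \<le> t" "t \<le> 2 * T" using T by auto
    obtain f where f: "frac_plaplacian p s \<Omega> (U t) f" "l2_deriv M U (\<lambda>x. - f x) t" using N(3) t t0 by blast
    obtain g where g: "frac_plaplacian p s \<Omega> (v n t) g" "l2_deriv M (v n) (\<lambda>x. - g x) t" using N(4) t t0 by blast
    note fW = frac_plaplacianD(1)[OF f(1)] and gW = frac_plaplacianD(1)[OF g(1)]
    have fL: "L2 M f" and gL: "L2 M g"
      using frac_plaplacianD(2)[OF f(1)] frac_plaplacianD(2)[OF g(1)] by (simp_all add: Lq_space_2)
    have mt: "m t > 0" "m t \<ge> \<eta> * a" using m_ge[OF t0(3)] \<eta> a by (auto intro: less_le_trans[OF mult_pos_pos])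
    define \<phi> where "\<phi> x = pos (U t x - v n t x - m t)" for x
    have zW: "(\<lambda>x. U t x - v n t x) \<in> W0" by (rule frac_sobolev0_diff[OF p1 fW gW])
    have \<phi>W: "\<phi> \<in> W0" unfolding \<phi>_def using mt by (intro frac_sobolev0_truncate[OF p1 zW]) simp
    have \<phi>L: "L2 M \<phi>" unfolding \<phi>_def
      by (intro L2_pos L2_diff l2_curve_L2[OF cU t0(1)] l2_curve_L2[OF cv t0(1)] L2_const finite_measure_M)
    have dm: "(m has_real_derivative (- l)) (at t)"
      unfolding m_def by (auto intro!: derivative_eq_intros)
    have dY: "l2_deriv M Y (\<lambda>x. (- f x - - g x) - (- l) * 1) t"
      unfolding Y_def by (intro l2_deriv_diff cz cm cU cv t0(1) f(2) g(2) l2_deriv_scalar one dm)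
    have D: "((\<lambda>t. pos_energy M (Y t)) has_real_derivative (LINT x|M. pos (Y t x) * ((- f x - - g x) - (- l) * 1))) (at t)"
      by (rule pos_energy_deriv[OF cY t0(1) dY])
    have i: "integrable M (\<lambda>x. f x * \<phi> x)" "integrable M (\<lambda>x. g x * \<phi> x)" "integrable M \<phi>"
      by (intro L2_mult_integrable fL gL \<phi>L L2_integrable[OF finite_measure_M])+
    have "(LINT x|M. pos (Y t x) * ((- f x - - g x) - (- l) * 1)) = (LINT x|M. g x * \<phi> x - f x * \<phi> x + l * \<phi> x)"
      by (intro Bochner_Integration.integral_cong) (auto simp: Y_def \<phi>_def algebra_simps)
    also have "\<dots> = (form p s (v n t) \<phi> - form p s (U t) \<phi>) + l * (LINT x|M. \<phi> x)"
      using i frac_plaplacianD(3)[OF f(1) \<phi>W] frac_plaplacianD(3)[OF g(1) \<phi>W] by simp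
    also have "\<dots> \<le> 0"
    proof -
      have zsmall: "2 * (LINT x|M. \<bar>U t x - v n t x\<bar>) / m t \<le> unit_ball_vol (real DIM('a)) / 2 * r ^ DIM('a)"
      proof -
        have c: "(LINT x|M. \<bar>U t x - v n t x\<bar>) \<le> a * d" using close[OF t0(2,3)] by (simp add: U_def a_def)
        have "0 \<le> (LINT x|M. \<bar>U t x - v n t x\<bar>)" by (intro integral_nonneg_AE) auto
        then have "2 * (LINT x|M. \<bar>U t x - v n t x\<bar>) / m t \<le> 2 * (LINT x|M. \<bar>U t x - v n t x\<bar>) / (\<eta> * a)"
          using mt \<eta> a by (intro divide_left_mono) auto
        also have "\<dots> \<le> 2 * (a * d) / (\<eta> * a)" using c \<eta> a by (intro divide_right_mono) auto
        also have "\<dots> = 2 * d / \<eta>" using a by simp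
        finally show ?thesis using small by linarith
      qed
      have I0: "0 \<le> (LINT x|M. \<phi> x)" by (intro integral_nonneg_AE) (auto simp: \<phi>_def)
      have "l \<le> killing_rate TYPE('a) p s r * (m t / 4) powr (p - 1)"
      proof -
        have "l \<le> 2 * B * (a / T)" using \<eta> a T by (simp add: l_def divide_right_mono mult_right_mono)
        also have "a / T = a powr (p - 1)"
        proof -
          have "- \<gamma> * (p - 1) = - \<gamma> - 1" using p by (simp add: field_simps)
          then have "a powr (p - 1) = T powr (- \<gamma> - 1)" unfolding a_def by (simp only: powr_powr)
          then show ?thesis using T by (simp add: a_def powr_diff)
        qed
        also have "2 * B * a powr (p - 1) = (2 * B * (4 / \<eta>) powr (p - 1)) * (\<eta> * a / 4) powr (p - 1)"
        proof -
          have "(4 / \<eta>) powr (p - 1) * (\<eta> * a / 4) powr (p - 1) = ((4 / \<eta>) * (\<eta> * a / 4)) powr (p - 1)"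
            by (rule powr_mult[symmetric])
          also have "(4 / \<eta>) * (\<eta> * a / 4) = a" using \<eta> by simp
          finally show ?thesis by (simp add: mult.assoc)
        qed
        also have "\<dots> \<le> killing_rate TYPE('a) p s r * (m t / 4) powr (p - 1)"
          using rate mt \<eta> a B p killing_rate_pos[OF r, where p = p and s = s]
          by (intro mult_mono powr_mono2) (auto intro: less_imp_le)
        finally show ?thesis .
      qed
      then have "l * (LINT x|M. \<phi> x) \<le> killing_rate TYPE('a) p s r * (m t / 4) powr (p - 1) * (LINT x|M. \<phi> x)"
        using I0 by (rule mult_right_mono)
      also have "\<dots> \<le> form p s (U t) \<phi> - form p s (v n t) \<phi>"
        unfolding \<phi>_def
        by (rule form_diff_ge_killing[OF fW gW l2_curve_L2[OF cU t0(1)] l2_curve_L2[OF cv t0(1)] mt(1) r zsmall])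
      finally show ?thesis by linarith
    qed
    finally show "\<exists>D\<le>0. ((\<lambda>t. pos_energy M (Y t)) has_real_derivative D) (at t)" using D by blast
  qed (use T in auto)
  also have "pos_energy M (Y T) = 0"
  proof -
    have "AE x in M. (pos (Y T x))\<^sup>2 / 2 = 0"
      using v_bound[OF T, of n] B(1)
    proof eventually_elim
      case (elim x)
      have "U T x - v n T x \<le> a * F x + a * F x" using elim(1) unfolding U_def a_def by linarith
      also have "\<dots> \<le> a * B + a * B" using elim(2) a by (intro add_mono mult_left_mono) auto
      finally have "Y T x \<le> 0" by (simp add: Y_def mT)
      then show ?case by (simp add: pos_def)
    qed
    then show ?thesis unfolding pos_energy_def by (rule integral_eq_zero_AE)
  qed
  finally have "pos_energy M (Y (2 * T)) = 0" using pos_energy_nonneg[of M "Y (2 * T)"] by linarith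
  then have "AE x in M. (pos (Y (2 * T) x))\<^sup>2 / 2 = 0"
    unfolding pos_energy_def using pos_energy_integrable[OF YL, of "2 * T"] T
    by (subst (asm) integral_nonneg_eq_0_iff_AE) auto
  then show ?thesis
    by eventually_elim (auto simp: Y_def mT U_def a_def pos_def max_def split: if_splits)
qed

lemma comparison_below:
  assumes t: "0 < t0" "t0 \<le> t" and \<tau>: "\<tau> > 0"
  shows "(LINT x|M. pos ((t + \<tau>) powr (- \<gamma>) * F x - u t x)) \<le> (LINT x|M. pos ((t0 + \<tau>) powr (- \<gamma>) * F x - u t0 x))"
proof -
  have t': "t > 0" using t by simp
  have ip: "integrable M (\<lambda>x. pos (c * F x - u r x))" if "r > 0" for c r
  proof (rule Bochner_Integration.integrable_bound)
    show i: "integrable M (\<lambda>x. c * F x - u r x)" using u_int[OF that] F_integrable by simp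
    show "(\<lambda>x. pos (c * F x - u r x)) \<in> borel_measurable M"
      using measurable_compose[OF borel_measurable_integrable[OF i] borel_measurable_pos] .
  qed (auto simp: pos_le_abs)
  have iv: "integrable M (\<lambda>x. pos (c * F x - v n r x))" if "r > 0" for c r n
    using that by (intro integrable_pos L2_diff L2_cmult F_L2 v_L2)
  have id: "integrable M (\<lambda>x. \<bar>v n r x - u r x\<bar>)" if "r > 0" for r n using u_int v_int that by simp
  have "(LINT x|M. pos ((t + \<tau>) powr (- \<gamma>) * F x - u t x)) \<le> (LINT x|M. pos ((t0 + \<tau>) powr (- \<gamma>) * F x - u t0 x)) + (err n + err n)" for n
  proof -
    have "(LINT x|M. pos ((t + \<tau>) powr (- \<gamma>) * F x - u t x)) \<le> (LINT x|M. pos ((t + \<tau>) powr (- \<gamma>) * F x - v n t x) + \<bar>v n t x - u t x\<bar>)"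
      using ip iv id t' by (intro integral_mono) (auto simp: pos_def)
    also have "\<dots> = (LINT x|M. pos ((t + \<tau>) powr (- \<gamma>) * F x - v n t x)) + (LINT x|M. \<bar>v n t x - u t x\<bar>)"
      using iv id t' by simp
    also have "\<dots> \<le> (LINT x|M. pos ((t0 + \<tau>) powr (- \<gamma>) * F x - v n t0 x)) + err n"
      using contraction_pos[OF sep_strong[of 1 \<tau>] v_curve[of n] t] \<tau> v_close[OF t'] by (intro add_mono) auto
    also have "(LINT x|M. pos ((t0 + \<tau>) powr (- \<gamma>) * F x - v n t0 x)) \<le> (LINT x|M. pos ((t0 + \<tau>) powr (- \<gamma>) * F x - u t0 x) + \<bar>v n t0 x - u t0 x\<bar>)"
      using ip iv id t by (intro integral_mono) (auto simp: pos_def)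
    also have "\<dots> = (LINT x|M. pos ((t0 + \<tau>) powr (- \<gamma>) * F x - u t0 x)) + (LINT x|M. \<bar>v n t0 x - u t0 x\<bar>)"
      using ip id t by simp
    finally show ?thesis using v_close[OF t(1), of n] by linarith
  qed
  moreover have "(\<lambda>n. (LINT x|M. pos ((t0 + \<tau>) powr (- \<gamma>) * F x - u t0 x)) + (err n + err n)) \<longlonglongrightarrow> (LINT x|M. pos ((t0 + \<tau>) powr (- \<gamma>) * F x - u t0 x)) + (0 + 0)"
    by (intro tendsto_add tendsto_const err_lim)
  ultimately have "(LINT x|M. pos ((t + \<tau>) powr (- \<gamma>) * F x - u t x)) \<le> (LINT x|M. pos ((t0 + \<tau>) powr (- \<gamma>) * F x - u t0 x)) + (0 + 0)"
    by (intro LIMSEQ_le_const) auto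
  then show ?thesis by simp
qed

end

subsection \<open>Convergence\<close>

context semigroup_problem
begin

lemma powr_gamma_cancel: "t > 0 \<Longrightarrow> t powr \<gamma> * t powr (- \<gamma>) = 1"
  by (simp add: powr_minus)

lemma powr_gamma_cancel':
  "t > 0 \<Longrightarrow> t powr \<gamma> * (t powr (- \<gamma>) * y) = y" "t > 0 \<Longrightarrow> t powr (- \<gamma>) * (t powr \<gamma> * y) = y"
  using powr_gamma_cancel[of t] by (metis mult.assoc mult_1, metis mult.assoc mult.commute mult_1)

lemma filterlim_shift_powr: "filterlim (\<lambda>n. (t0 + real (Suc n)) powr \<gamma>) at_top sequentially" if "t0 > 0"
proof (rule filterlim_at_top_mono)
  show "filterlim (\<lambda>n. (1 / real (Suc n)) powr (- \<gamma>)) at_top sequentially" by (rule filterlim_inverse_powr)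
  have "(1 / real (Suc n)) powr (- \<gamma>) = real (Suc n) powr \<gamma>" for n
    by (simp add: powr_minus_divide powr_divide)
  moreover have "real (Suc n) powr \<gamma> \<le> (t0 + real (Suc n)) powr \<gamma>" for n
  proof (rule powr_mono2)
    show "0 \<le> \<gamma>" using \<gamma>_pos by (rule less_imp_le)
  qed (use that in auto)
  ultimately show "\<forall>\<^sub>F n in sequentially. (1 / real (Suc n)) powr (- \<gamma>) \<le> (t0 + real (Suc n)) powr \<gamma>"
    by simp
qed

lemma integrable_pos_F_u: "r > 0 \<Longrightarrow> integrable M (\<lambda>x. pos (b * F x - c * u r x))"
proof (rule Bochner_Integration.integrable_bound)
  assume r: "r > 0"
  show i: "integrable M (\<lambda>x. b * F x - c * u r x)" using u_int[OF r] F_integrable by simp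
  show "(\<lambda>x. pos (b * F x - c * u r x)) \<in> borel_measurable M"
    using measurable_compose[OF borel_measurable_integrable[OF i] borel_measurable_pos] .
qed (auto simp: pos_le_abs)

lemma integral_pos_scale:
  assumes "c > 0"
  shows "(LINT x|M. pos (F x - c powr \<gamma> * f x)) = c powr \<gamma> * (LINT x|M. pos (c powr (- \<gamma>) * F x - f x))"
proof -
  have "c powr \<gamma> * pos (c powr (- \<gamma>) * a - b) = pos (a - c powr \<gamma> * b)" for a b
  proof -
    have "c powr \<gamma> * pos y = pos (c powr \<gamma> * y)" for y
      by (auto simp: pos_def max_def mult_le_0_iff)
    moreover have "c powr \<gamma> * (c powr (- \<gamma>) * a - b) = a - c powr \<gamma> * b"
      unfolding right_diff_distrib powr_gamma_cancel'[OF assms] ..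
    ultimately show ?thesis by simp
  qed
  then show ?thesis by (simp flip: Bochner_Integration.integral_mult_right_zero)
qed

lemma rescaled_le: "t > 0 \<Longrightarrow> AE x in M. t powr \<gamma> * u t x \<le> F x"
proof -
  assume t: "t > 0"
  show ?thesis
    using u_le[OF t]
  proof eventually_elim
    case (elim x)
    then have "t powr \<gamma> * u t x \<le> t powr \<gamma> * (t powr (- \<gamma>) * F x)" by (intro mult_left_mono) auto
    then show ?case unfolding powr_gamma_cancel'[OF t] .
  qed
qed

text \<open>Compare \<open>u\<close> from time \<open>t\<^sub>0\<close> on with \<open>U(\<cdot> + \<tau>)\<close>, where \<open>\<tau> = t / K\<close>: the loss in the time shift is
  \<open>(1 + 1/K)\<^bsup>\<gamma>\<^esup>\<close>, and the defect at \<open>t\<^sub>0\<close> is amplified by at most \<open>(1 + K)\<^bsup>\<gamma>\<^esup>\<close>.\<close>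

lemma rescaled_L1_limit:
  assumes "\<epsilon> > 0"
  shows "\<exists>T>0. \<forall>t\<ge>T. (LINT x|M. pos (F x - t powr \<gamma> * u t x)) \<le> \<epsilon>"
proof -
  define J where "J = (LINT x|M. F x)"
  have "(\<lambda>n. ((1 + 1 / real (Suc n)) powr \<gamma> - 1) * J) \<longlonglongrightarrow> ((1 + 0) powr \<gamma> - 1) * J"
    by (intro tendsto_mult tendsto_diff tendsto_const tendsto_powr tendsto_add LIMSEQ_Suc[OF lim_1_over_n]) simp
  then have "\<forall>\<^sub>F n in sequentially. ((1 + 1 / real (Suc n)) powr \<gamma> - 1) * J < \<epsilon> / 2"
    using \<open>\<epsilon> > 0\<close> by (intro order_tendstoD(2)) auto
  then obtain n0 where n0: "((1 + 1 / real (Suc n0)) powr \<gamma> - 1) * J < \<epsilon> / 2"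
    by (auto simp: eventually_sequentially)
  define K where "K = real (Suc n0)"
  have K: "K > 0" "((1 + 1 / K) powr \<gamma> - 1) * J < \<epsilon> / 2" using n0 by (simp_all add: K_def)
  define e where "e = \<epsilon> / (2 * (K + 1) powr \<gamma>)"
  have Kg: "(K + 1) powr \<gamma> > 0" using K by simp
  have e: "e > 0" "(K + 1) powr \<gamma> * e = \<epsilon> / 2" using Kg \<open>\<epsilon> > 0\<close> K by (simp_all add: e_def)
  obtain t0 where t0: "t0 > 0" "(LINT x|M. (if u t0 x > 0 then 0 else F x)) < e" using positivity[OF e(1)] by blast
  have pF: "pos (F x) = F x" for x using F_nonneg by (simp add: pos_def)
  have lim: "(\<lambda>n. LINT x|M. pos (F x - (t0 + real (Suc n)) powr \<gamma> * u t0 x)) \<longlonglongrightarrow> (LINT x|M. (if u t0 x > 0 then 0 else F x))"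
    using LIMSEQ_integral_pos_diff[OF F_integrable borel_measurable_integrable[OF u_int[OF t0(1)]] u_nonneg[OF t0(1)]
        filterlim_shift_powr[OF t0(1)]] by (simp only: pF powr_ge_zero)
  then have "\<forall>\<^sub>F n in sequentially. (LINT x|M. pos (F x - (t0 + real (Suc n)) powr \<gamma> * u t0 x)) < e"
    by (rule order_tendstoD(2)[OF _ t0(2)])
  then obtain n1 where n1: "(LINT x|M. pos (F x - (t0 + real (Suc n1)) powr \<gamma> * u t0 x)) < e"
    by (auto simp: eventually_sequentially)
  define \<tau>0 where "\<tau>0 = real (Suc n1)"
  have g0: "0 \<le> \<gamma>" using \<gamma>_pos by (rule less_imp_le)
  have "(LINT x|M. pos (F x - t powr \<gamma> * u t x)) \<le> \<epsilon>" if t: "t \<ge> max t0 (K * \<tau>0)" for t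
  proof -
    have tt: "t0 \<le> t" "t > 0" using t t0 by auto
    define \<tau> where "\<tau> = t / K"
    have \<tau>: "\<tau> \<ge> \<tau>0" "\<tau> > 0" "t = K * \<tau>" using t K tt by (auto simp: \<tau>_def field_simps)
    have "(LINT x|M. pos (F x - (t + \<tau>) powr \<gamma> * u t x)) = (t + \<tau>) powr \<gamma> * (LINT x|M. pos ((t + \<tau>) powr (- \<gamma>) * F x - u t x))"
      using tt \<tau> by (intro integral_pos_scale) simp
    also have "\<dots> \<le> ((K + 1) powr \<gamma> * (t0 + \<tau>) powr \<gamma>) * (LINT x|M. pos ((t0 + \<tau>) powr (- \<gamma>) * F x - u t0 x))"
    proof (rule mult_mono)
      have "(t + \<tau>) powr \<gamma> \<le> ((K + 1) * (t0 + \<tau>)) powr \<gamma>"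
      proof (rule powr_mono2[OF g0])
        show "t + \<tau> \<le> (K + 1) * (t0 + \<tau>)"
          unfolding \<tau>(3) using K t0 by (simp add: algebra_simps add_increasing)
      qed (use tt \<tau> in simp)
      then show "(t + \<tau>) powr \<gamma> \<le> (K + 1) powr \<gamma> * (t0 + \<tau>) powr \<gamma>" by (simp add: powr_mult)
      show "(LINT x|M. pos ((t + \<tau>) powr (- \<gamma>) * F x - u t x)) \<le> (LINT x|M. pos ((t0 + \<tau>) powr (- \<gamma>) * F x - u t0 x))"
        by (rule comparison_below[OF t0(1) tt(1) \<tau>(2)])
    qed auto
    also have "\<dots> = (K + 1) powr \<gamma> * (LINT x|M. pos (F x - (t0 + \<tau>) powr \<gamma> * u t0 x))"
      using t0 \<tau> by (subst integral_pos_scale) auto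
    also have "\<dots> \<le> (K + 1) powr \<gamma> * (LINT x|M. pos (F x - (t0 + \<tau>0) powr \<gamma> * u t0 x))"
    proof (intro mult_left_mono integral_mono_AE)
      show "integrable M (\<lambda>x. pos (F x - (t0 + \<tau>) powr \<gamma> * u t0 x))" "integrable M (\<lambda>x. pos (F x - (t0 + \<tau>0) powr \<gamma> * u t0 x))"
        using integrable_pos_F_u[OF t0(1), of 1] by auto
      have "(t0 + \<tau>0) powr \<gamma> \<le> (t0 + \<tau>) powr \<gamma>" using \<tau> t0 by (intro powr_mono2[OF g0]) (auto simp: \<tau>0_def)
      then show "AE x in M. pos (F x - (t0 + \<tau>) powr \<gamma> * u t0 x) \<le> pos (F x - (t0 + \<tau>0) powr \<gamma> * u t0 x)"
        using u_nonneg[OF t0(1)] by (elim eventually_mono) (intro pos_mono diff_left_mono mult_right_mono)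
    qed auto
    also have "\<dots> \<le> (K + 1) powr \<gamma> * e" using n1 Kg unfolding \<tau>0_def by (intro mult_left_mono) auto
    finally have 1: "(LINT x|M. pos (F x - (t + \<tau>) powr \<gamma> * u t x)) \<le> \<epsilon> / 2" using e(2) by simp
    define b where "b = (1 + 1 / K) powr \<gamma>"
    have "(1 + 1 / K) * t = t + \<tau>" by (simp add: \<tau>_def distrib_right)
    then have bt: "(t + \<tau>) powr \<gamma> = b * t powr \<gamma>" unfolding b_def by (metis powr_mult)
    have b: "b \<ge> 1" unfolding b_def using K g0 by (intro ge_one_powr_ge_zero) auto
    have "(LINT x|M. pos (F x - t powr \<gamma> * u t x)) \<le> (LINT x|M. pos (F x - (t + \<tau>) powr \<gamma> * u t x) + (b - 1) * F x)"
    proof (rule integral_mono_AE)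
      show "integrable M (\<lambda>x. pos (F x - t powr \<gamma> * u t x))" using integrable_pos_F_u[OF tt(2), of 1] by auto
      show "integrable M (\<lambda>x. pos (F x - (t + \<tau>) powr \<gamma> * u t x) + (b - 1) * F x)"
        using integrable_pos_F_u[OF tt(2), of 1] F_integrable by auto
      show "AE x in M. pos (F x - t powr \<gamma> * u t x) \<le> pos (F x - (t + \<tau>) powr \<gamma> * u t x) + (b - 1) * F x"
        using rescaled_le[OF tt(2)]
      proof eventually_elim
        case (elim x)
        then have "(b - 1) * (t powr \<gamma> * u t x) \<le> (b - 1) * F x" using b by (intro mult_left_mono) auto
        moreover have "0 \<le> (b - 1) * F x" using b F_nonneg by simp
        ultimately show ?case unfolding bt pos_def by (auto simp: algebra_simps)
      qed
    qed
    also have "\<dots> = (LINT x|M. pos (F x - (t + \<tau>) powr \<gamma> * u t x)) + (b - 1) * J"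
      using integrable_pos_F_u[OF tt(2), of 1 "(t + \<tau>) powr \<gamma>"] F_integrable by (simp add: J_def)
    also have "\<dots> \<le> \<epsilon>" using 1 K(2) by (simp add: b_def)
    finally show ?thesis .
  qed
  moreover have "max t0 (K * \<tau>0) > 0" using t0 by auto
  ultimately show ?thesis by blast
qed

lemma rescaled_uniform_limit:
  assumes "\<epsilon> > 0"
  shows "\<exists>T>0. \<forall>t\<ge>T. AE x in M. \<bar>t powr \<gamma> * u t x - F x\<bar> \<le> \<epsilon>"
proof -
  obtain B where B: "B > 0" "AE x in M. F x \<le> B" using F_AE_bounded by blast
  define \<eta> where "\<eta> = min (\<epsilon> / 2 powr \<gamma>) (2 * B)"
  have \<eta>: "\<eta> > 0" "\<eta> \<le> 2 * B" using \<open>\<epsilon> > 0\<close> B by (auto simp: \<eta>_def)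
  have \<eta>\<epsilon>: "2 powr \<gamma> * \<eta> \<le> \<epsilon>"
  proof -
    have "2 powr \<gamma> * \<eta> \<le> 2 powr \<gamma> * (\<epsilon> / 2 powr \<gamma>)" by (intro mult_left_mono) (auto simp: \<eta>_def)
    then show ?thesis by simp
  qed
  obtain r where r: "r > 0" "2 * B * (4 / \<eta>) powr (p - 1) \<le> killing_rate TYPE('a) p s r"
    using killing_rate_large[OF sp] by blast
  define V where "V = unit_ball_vol (real DIM('a)) / 2 * r ^ DIM('a)"
  have V: "V > 0" using r by (simp add: V_def)
  define d where "d = \<eta> * V / 2"
  have d: "d > 0" "2 * d / \<eta> \<le> V" using \<eta> V by (simp_all add: d_def)
  obtain T0 where T0: "T0 > 0" "\<And>t. t \<ge> T0 \<Longrightarrow> (LINT x|M. pos (F x - t powr \<gamma> * u t x)) \<le> d / 2"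
    using rescaled_L1_limit[of "d / 2"] d by auto
  have "AE x in M. \<bar>t powr \<gamma> * u t x - F x\<bar> \<le> \<epsilon>" if t: "t \<ge> 2 * T0" for t
  proof -
    define T where "T = t / 2"
    have T: "T > 0" "T \<ge> T0" "t = 2 * T" "t > 0" using t T0 by (auto simp: T_def)
    define a where "a = T powr (- \<gamma>)"
    have a: "a > 0" using T by (simp add: a_def)
    have L1: "(LINT x|M. \<bar>q powr (- \<gamma>) * F x - u q x\<bar>) \<le> a * (d / 2)" if q: "T \<le> q" for q
    proof -
      have q0: "q > 0" "q \<ge> T0" using q T by auto
      note [measurable] = borel_measurable_integrable[OF u_int[OF q0(1)]]
      have "(LINT x|M. \<bar>q powr (- \<gamma>) * F x - u q x\<bar>) = (LINT x|M. pos (q powr (- \<gamma>) * F x - u q x))"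
      proof (rule integral_cong_AE)
        show "AE x in M. \<bar>q powr (- \<gamma>) * F x - u q x\<bar> = pos (q powr (- \<gamma>) * F x - u q x)"
          using u_le[OF q0(1)] by eventually_elim (simp add: pos_def)
        show "(\<lambda>x. \<bar>q powr (- \<gamma>) * F x - u q x\<bar>) \<in> borel_measurable M"
          by measurable
        show "(\<lambda>x. pos (q powr (- \<gamma>) * F x - u q x)) \<in> borel_measurable M"
          by measurable
      qed
      also have "\<dots> = q powr (- \<gamma>) * (LINT x|M. pos (F x - q powr \<gamma> * u q x))"
        unfolding integral_pos_scale[OF q0(1), of "u q"] powr_gamma_cancel'[OF q0(1)] ..
      also have "\<dots> \<le> a * (d / 2)"
        unfolding a_def
      proof (rule mult_mono)
        show "q powr (- \<gamma>) \<le> T powr (- \<gamma>)"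
        proof (rule powr_mono2')
          show "- \<gamma> \<le> 0" using \<gamma>_pos by linarith
        qed (use q T in auto)
      qed (use T0(2)[OF q0(2)] in auto)
      finally show ?thesis .
    qed
    have vn: "AE x in M. t powr (- \<gamma>) * F x - v n t x \<le> \<eta> * a" if n: "err n \<le> a * (d / 2)" for n
      unfolding T(3) a_def
    proof (rule smoothing[OF T(1) B(2,1) \<eta> r])
      show "2 * d / \<eta> \<le> unit_ball_vol (real DIM('a)) / 2 * r ^ DIM('a)" using d(2) by (simp add: V_def)
      fix q assume q: "T \<le> q" "q \<le> 2 * T"
      then have q0: "q > 0" using T by simp
      have "(LINT x|M. \<bar>q powr (- \<gamma>) * F x - v n q x\<bar>) \<le> (LINT x|M. \<bar>q powr (- \<gamma>) * F x - u q x\<bar>) + (LINT x|M. \<bar>u q x - v n q x\<bar>)"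
        using F_integrable u_int[OF q0] v_int[OF q0] by (intro integral_abs_triangle) auto
      also have "\<dots> \<le> a * (d / 2) + a * (d / 2)"
        using L1[OF q(1)] v_close[OF q0, of n] n by (intro add_mono) (auto simp: integral_abs_commute[of "u q"])
      also have "\<dots> = T powr (- \<gamma>) * d" unfolding a_def by (simp only: field_sum_of_halves flip: distrib_left)
      finally show "(LINT x|M. \<bar>q powr (- \<gamma>) * F x - v n q x\<bar>) \<le> T powr (- \<gamma>) * d" .
    qed
    have ipos: "integrable M (\<lambda>x. pos (t powr (- \<gamma>) * F x - u t x - \<eta> * a))"
    proof (rule Bochner_Integration.integrable_bound)
      show i: "integrable M (\<lambda>x. t powr (- \<gamma>) * F x - u t x - \<eta> * a)"
        using u_int[OF T(4)] F_integrable by (intro Bochner_Integration.integrable_diff integrable_mult_right finM.integrable_const)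
      show "(\<lambda>x. pos (t powr (- \<gamma>) * F x - u t x - \<eta> * a)) \<in> borel_measurable M"
        using measurable_compose[OF borel_measurable_integrable[OF i] borel_measurable_pos] .
    qed (auto simp: pos_le_abs)
    have "\<forall>\<^sub>F n in sequentially. err n < a * (d / 2)"
      using a d by (intro order_tendstoD(2)[OF err_lim]) simp
    then have "\<forall>\<^sub>F n in sequentially. (LINT x|M. pos (t powr (- \<gamma>) * F x - u t x - \<eta> * a)) \<le> err n"
    proof eventually_elim
      case (elim n)
      have "(LINT x|M. pos (t powr (- \<gamma>) * F x - u t x - \<eta> * a)) \<le> (LINT x|M. \<bar>v n t x - u t x\<bar>)"
      proof (rule integral_mono_AE[OF ipos])
        show "integrable M (\<lambda>x. \<bar>v n t x - u t x\<bar>)" using u_int v_int T by simp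
        show "AE x in M. pos (t powr (- \<gamma>) * F x - u t x - \<eta> * a) \<le> \<bar>v n t x - u t x\<bar>"
          using vn[of n] elim by (auto elim!: eventually_mono simp: pos_def)
      qed
      then show ?case using v_close[OF T(4), of n] by linarith
    qed
    then have "(LINT x|M. pos (t powr (- \<gamma>) * F x - u t x - \<eta> * a)) \<le> 0"
      by (intro tendsto_lowerbound[OF err_lim]) auto
    moreover have "0 \<le> (LINT x|M. pos (t powr (- \<gamma>) * F x - u t x - \<eta> * a))" by (intro integral_nonneg_AE) auto
    ultimately have "(LINT x|M. pos (t powr (- \<gamma>) * F x - u t x - \<eta> * a)) = 0" by simp
    then have "AE x in M. pos (t powr (- \<gamma>) * F x - u t x - \<eta> * a) = 0"
      using ipos by (subst (asm) integral_nonneg_eq_0_iff_AE) auto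
    then show ?thesis
      using rescaled_le[OF T(4)]
    proof eventually_elim
      case (elim x)
      have "t powr (- \<gamma>) * F x - u t x \<le> \<eta> * a" using elim(1) by (simp add: pos_def max_def split: if_splits)
      then have "t powr \<gamma> * (t powr (- \<gamma>) * F x - u t x) \<le> t powr \<gamma> * (\<eta> * a)" by (intro mult_left_mono) auto
      also have "t powr \<gamma> * (t powr (- \<gamma>) * F x - u t x) = F x - t powr \<gamma> * u t x"
        unfolding right_diff_distrib powr_gamma_cancel'[OF T(4)] ..
      also have "t powr \<gamma> * (\<eta> * a) = 2 powr \<gamma> * \<eta> * (T powr \<gamma> * T powr (- \<gamma>))"
        unfolding T(3) a_def by (simp only: powr_mult mult_ac)
      also have "\<dots> \<le> \<epsilon>" using \<eta>\<epsilon> powr_gamma_cancel[OF T(1)] by simp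
      finally show ?case using elim(2) by simp
    qed
  qed
  then show ?thesis using T0(1) by (intro exI[of _ "2 * T0"]) auto
qed

end

context dirichlet_problem
begin

lemma Lq_norm_le:
  assumes f: "f \<in> borel_measurable M" and le: "AE x in M. \<bar>f x\<bar> \<le> a" and "a \<ge> 0" and q: "1 \<le> q"
  shows "Lq_norm \<Omega> q f \<le> ennreal (a * (vol + 1))"
proof (cases "q = \<infinity>")
  case True
  have "esssup M (\<lambda>x. ennreal \<bar>f x\<bar>) \<le> ennreal a"
    using f le by (intro esssup_I) (auto elim!: eventually_mono intro: ennreal_leI)
  also have "\<dots> \<le> ennreal (a * (vol + 1))"
    using \<open>a \<ge> 0\<close> vol_nonneg by (intro ennreal_leI) (simp add: algebra_simps)
  finally show ?thesis using True by (simp add: Lq_norm_def)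
next
  case False
  define r where "r = enn2real q"
  have qr: "q = ennreal r" using False by (simp add: r_def less_top)
  have r: "r \<ge> 1" using q unfolding qr using ennreal_le_iff2[of 1 r] by (auto simp flip: ennreal_1)
  have em: "emeasure M (space M) = ennreal vol"
    using dom_lmeasurable by (simp add: vol_def emeasure_restrict_space emeasure_eq_measure2 del: emeasure_completion)
  have "(\<integral>\<^sup>+ x. ennreal (\<bar>f x\<bar> powr r) \<partial>M) \<le> (\<integral>\<^sup>+ x. ennreal (a powr r) \<partial>M)"
    using le r by (intro nn_integral_mono_AE, elim eventually_mono) (auto intro!: ennreal_leI powr_mono2)
  also have "\<dots> = ennreal (a powr r * vol)" 
    unfolding nn_integral_const em using vol_nonneg by (simp add: ennreal_mult')
  finally have le': "(\<integral>\<^sup>+ x. ennreal (\<bar>f x\<bar> powr r) \<partial>M) \<le> ennreal (a powr r * vol)" .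
  define I where "I = (\<integral>\<^sup>+ x. ennreal (\<bar>f x\<bar> powr r) \<partial>M)"
  have Ifin: "I \<noteq> \<infinity>" using le' by (auto simp: I_def top_unique)
  have "enn2real I \<le> a powr r * vol"
    using le' vol_nonneg unfolding I_def by (intro enn2real_leI) auto
  then have "enn2real I powr (1 / r) \<le> (a powr r * vol) powr (1 / r)"
    using r by (intro powr_mono2) auto
  also have "\<dots> = a * vol powr (1 / r)"
    using r \<open>a \<ge> 0\<close> vol_nonneg by (simp add: powr_mult powr_powr)
  also have "\<dots> \<le> a * (vol + 1)"
  proof (rule mult_left_mono[OF _ \<open>a \<ge> 0\<close>])
    have "vol powr (1 / r) \<le> (vol + 1) powr (1 / r)" using vol_nonneg r by (intro powr_mono2) auto
    also have "\<dots> \<le> (vol + 1) powr 1" using vol_nonneg r by (intro powr_mono) auto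
    finally show "vol powr (1 / r) \<le> vol + 1" using vol_nonneg by simp
  qed
  finally show ?thesis
    using False Ifin by (simp add: Lq_norm_def ennreal_root_def I_def r_def ennreal_leI)
qed

end

theorem theorem4p1:
  fixes \<Omega> :: "'a::euclidean_space set" and s p :: real
    and F u0 :: "'a \<Rightarrow> real" and u :: "real \<Rightarrow> 'a \<Rightarrow> real"
  assumes "0 < s" "s < 1" "2 < p"
    and "smooth_bounded_domain \<Omega>"
    and "positive_profile p s \<Omega> F"
    and "u0 \<in> Lq_space \<Omega> 1"
    and "AE x in lebesgue_on \<Omega>. u0 x \<ge> 0"
    and "\<not> (AE x in lebesgue_on \<Omega>. u0 x = 0)"
    and "dirichlet_solution p s \<Omega> u0 u"
    and "\<forall>t>0. AE x in lebesgue_on \<Omega>. u t x \<ge> 0"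
  shows "(\<forall>q::ennreal. 1 \<le> q \<longrightarrow>
            ((\<lambda>t. ennreal (t powr (1 / (p - 2))) *
                  Lq_norm \<Omega> q (\<lambda>x. u t x - separated_solution p F x t)) \<longlongrightarrow> 0) at_top)
       \<and> (\<forall>\<epsilon>>0. \<forall>\<^sub>F t in at_top. AE x in lebesgue_on \<Omega>.
            \<bar>t powr (1 / (p - 2)) * u t x - F x\<bar> < \<epsilon>)"
proof -
  interpret dirichlet_problem p s \<Omega>
    using assms(1,3,4) by unfold_locales (auto simp: smooth_bounded_domain_def)
  obtain v0 v where v: "\<And>n::nat. strong_solution p s \<Omega> (v0 n) (v n)"
    and v0l: "(\<lambda>n. Lq_norm \<Omega> 1 (\<lambda>x. v0 n x - u0 x)) \<longlonglongrightarrow> 0"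
    and vl: "\<And>t. t \<ge> 0 \<Longrightarrow> (\<lambda>n. Lq_norm \<Omega> 1 (\<lambda>x. v n t x - u t x)) \<longlonglongrightarrow> 0"
    and uL: "\<And>t. t \<ge> 0 \<Longrightarrow> u t \<in> Lq_space \<Omega> 1"
    using assms(9) by (auto simp: dirichlet_solution_def semigroup_solution_def)
  have L1: "(\<lambda>n. LINT x|M. \<bar>f n x - g x\<bar>) \<longlonglongrightarrow> 0"
    if "\<And>n. integrable M (f n)" "integrable M g" "(\<lambda>n. Lq_norm \<Omega> 1 (\<lambda>x. f n x - g x)) \<longlonglongrightarrow> 0" for f g
  proof -
    have "(\<lambda>n. ennreal (LINT x|M. \<bar>f n x - g x\<bar>)) \<longlonglongrightarrow> ennreal 0"
      using that by (simp add: Lq_norm_1)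
    then show ?thesis by (subst (asm) tendsto_ennreal_iff) auto
  qed
  have v0i: "integrable M (v0 n)" for n
    using v[of n] by (intro L2_integrable[OF finite_measure_M]) (simp add: strong_solution_def Lq_space_2)
  have vi: "integrable M (v n t)" if "t > 0" for n t
    using v[of n] that by (intro L2_integrable[OF finite_measure_M]) (simp add: strong_solution_def Lq_space_2)
  interpret semigroup_problem p s \<Omega> F u0 u v0 v
  proof unfold_locales
    show "positive_profile p s \<Omega> F" by fact
    show "strong_solution p s \<Omega> (v0 n) (v n)" for n by (rule v)
    show "integrable M u0" using assms(6) by (simp add: Lq_space_1)
    then show "(\<lambda>n. LINT x|M. \<bar>v0 n x - u0 x\<bar>) \<longlonglongrightarrow> 0" by (intro L1 v0i v0l)
    show ui: "integrable M (u t)" if "t > 0" for t using uL[of t] that by (simp add: Lq_space_1)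
    show "(\<lambda>n. LINT x|M. \<bar>v n t x - u t x\<bar>) \<longlonglongrightarrow> 0" if "t > 0" for t
      using that by (intro L1 vi ui vl) auto
  qed (use assms in auto)
  have sep: "separated_solution p F x t = t powr (- \<gamma>) * F x" for x t
    by (simp add: separated_solution_def)
  have small: "\<forall>\<^sub>F t in at_top. ennreal (t powr \<gamma>) * Lq_norm \<Omega> q (\<lambda>x. u t x - separated_solution p F x t) < e"
    if q: "1 \<le> q" and e: "e > 0" for q e :: ennreal
  proof -
    obtain b where b: "b > 0" "ennreal b < e"
    proof -
      obtain c where "0 < c" "c < e" using dense[OF e] by blast
      then show ?thesis using that[of "enn2real c"] by (cases c) auto
    qed
    define d where "d = b / (vol + 1)"
    have d: "d > 0" using b vol_nonneg by (simp add: d_def)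
    obtain T where T: "T > 0" "\<And>t. t \<ge> T \<Longrightarrow> AE x in M. \<bar>t powr \<gamma> * u t x - F x\<bar> \<le> d"
      using rescaled_uniform_limit[OF d] by blast
    show ?thesis
      unfolding eventually_at_top_linorder
    proof (intro exI[of _ T] allI impI)
      fix t assume t: "t \<ge> T"
      then have t0: "t > 0" using T by simp
      have "Lq_norm \<Omega> q (\<lambda>x. u t x - separated_solution p F x t) \<le> ennreal (t powr (- \<gamma>) * d * (vol + 1))"
      proof (rule Lq_norm_le[OF _ _ _ q])
        show "(\<lambda>x. u t x - separated_solution p F x t) \<in> borel_measurable M"
          unfolding sep using borel_measurable_integrable[OF u_int[OF t0]] by measurable
        show "AE x in M. \<bar>u t x - separated_solution p F x t\<bar> \<le> t powr (- \<gamma>) * d"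
          using T(2)[OF t]
        proof eventually_elim
          case (elim x)
          have "u t x - separated_solution p F x t = t powr (- \<gamma>) * (t powr \<gamma> * u t x - F x)"
            unfolding sep right_diff_distrib powr_gamma_cancel'[OF t0] ..
          then show ?case using elim by (simp add: abs_mult mult_left_mono)
        qed
      qed (use d in simp)
      then have "ennreal (t powr \<gamma>) * Lq_norm \<Omega> q (\<lambda>x. u t x - separated_solution p F x t)
        \<le> ennreal (t powr \<gamma>) * ennreal (t powr (- \<gamma>) * d * (vol + 1))" by (rule mult_left_mono) simp
      also have "\<dots> = ennreal (t powr \<gamma> * (t powr (- \<gamma>) * d * (vol + 1)))" by (rule ennreal_mult'[symmetric]) simp
      also have "t powr \<gamma> * (t powr (- \<gamma>) * d * (vol + 1)) = (t powr \<gamma> * t powr (- \<gamma>)) * (d * (vol + 1))"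
        by (simp only: mult.assoc)
      also have "\<dots> = b" using powr_gamma_cancel[OF t0] vol_nonneg by (simp add: d_def)
      finally show "ennreal (t powr \<gamma>) * Lq_norm \<Omega> q (\<lambda>x. u t x - separated_solution p F x t) < e"
        using b(2) by simp
    qed
  qed
  show ?thesis
  proof (intro conjI allI impI)
    fix q :: ennreal assume q: "1 \<le> q"
    show "((\<lambda>t. ennreal (t powr \<gamma>) * Lq_norm \<Omega> q (\<lambda>x. u t x - separated_solution p F x t)) \<longlongrightarrow> 0) at_top"
      by (rule order_tendstoI) (use small[OF q] in auto)
  next
    fix \<epsilon> :: real assume e: "\<epsilon> > 0"
    obtain T where T: "\<And>t. t \<ge> T \<Longrightarrow> AE x in M. \<bar>t powr \<gamma> * u t x - F x\<bar> \<le> \<epsilon> / 2"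
      using rescaled_uniform_limit[of "\<epsilon> / 2"] e by auto
    have "AE x in M. \<bar>t powr \<gamma> * u t x - F x\<bar> < \<epsilon>" if "t \<ge> T" for t
      using T[OF that] by (rule eventually_mono) (use e in linarith)
    then show "\<forall>\<^sub>F t in at_top. AE x in M. \<bar>t powr \<gamma> * u t x - F x\<bar> < \<epsilon>"
      unfolding eventually_at_top_linorder by blast
  qed
qed

end
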